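(* The simplex $S$ together with the vertex $[T_p(H)]=[\mathrm{Fil}_\infty V]$ completely determine the set of vertices $\{[\mathrm{Fil}_\lambda V]:\lambda\in\,]0,+\infty]\}$ of the building $\mathcal I(V)$ attached to the lower ramification filtration. This set is contained in the enclosure of $S\cup\{[T_p(H)]\}$, and is equal to $$\bigcup_{x\in S}\big(x\vee[\mathrm{Fil}_\infty V]\big),$$ where $x$ runs over the vertices of $S$.
   Context: $F/\mathbb{Q}_p$ is a finite extension, $\mathcal O=\mathcal O_F$, $\pi$ a uniformizer, $q$ the residue cardinality. $K$ is an algebraically closed field containing $F$, complete for a valuation $v:K\to\mathbb{R}\cup\{+\infty\}$ extending the valuation of $F$ normalized by $v(\pi)=1$. $H$ is a $\pi$-divisible $\mathcal O$-module over $\mathrm{Spec}(\mathcal O_K)$ of dimension $1$ and $\mathcal O$-height $n$ ($\mathcal O$ acting on the Lie algebra through $\mathcal O\to\mathcal O_K$) with formal special fibre; $\widehat H$ is the associated formal group. An isomorphism of pointed formal schemes $\widehat H\simeq\mathrm{Spf}(\mathcal O_K[[T]])$ identifies $\widehat H(\mathcal O_K)$ with $\{a\in\mathcal O_K: v(a)>0\}$; $v(y)$ is the valuation of the coordinate of $y$ (independent of choices; $v(0)=+\infty$). $V=V_p(H)$ is identified with sequences $(x_i)_{i\in\mathbb Z}$, $x_i\in\widehat H(\mathcal O_K)$, $\pi x_{i+1}=x_i$, $x_i=0$ for $i\ll0$; $v((x_i)_i)=v(x_0)$; $\mathrm{Fil}_\lambda V=\{x\in V: v(x)\ge\lambda\}$,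 lattices with $\mathrm{Fil}_\infty V=T_p(H)$. $\mathcal I(V)$ is the building of $\mathrm{PGL}(V)$ (vertices: homothety classes $[\Lambda]$ of lattices; simplices: finite sets of vertices having representatives $\pi\Lambda_1\subsetneq\Lambda_d\subsetneq\dots\subsetneq\Lambda_1$). The apartment of a basis $(e_i)$ of $V$ has vertices $[\langle\pi^{a_1}e_1,\dots,\pi^{a_n}e_n\rangle]$; its half-apartments are the subsets $\{a_j-a_i\ge b\}$ for $i\ne j$, $b\in\mathbb Z$. The enclosure of a finite set of vertices contained in an apartment is the intersection of the half-apartments of that apartment containing it (it does not depend on the apartment). $S$ is the simplex of $\mathcal I(V)$ with vertices $\{[\mathrm{Fil}_\lambda V]: 0<\lambda\le\varepsilon\}$, where $\varepsilon>0$ is any real number $\le$ the smallest valuation of a point of $H[\pi](\mathcal O_K)$ (independent of $\varepsilon$, since then $\mathrm{Fil}_{\lambda/q^n}V=\pi^{-1}\mathrm{Fil}_\lambda V$ for $0<\lambda\le\varepsilon$). For two vertices $x,y$ of $\mathcal I(V)$, $x\vee y=\{[\Lambda_1+\Lambda_2]:[\Lambda_1]=x,\ [\Lambda_2]=y\}$. *)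

theory Defs
  imports
    "HOL-Analysis.Analysis"
    "HOL-Computational_Algebra.Computational_Algebra"
    "HOL-Algebra.Module"
    "HOL-Algebra.AbelCoset"
    "HOL-Algebra.Algebraic_Closure_Type"
begin

section \<open>The base fields\<close>

text \<open>The big field \<open>K\<close> is the whole type \<open>'k\<close>, and \<open>v\<close> is its additive valuation.\<close>

definition vtendsto :: "('k::field \<Rightarrow> ereal) \<Rightarrow> (nat \<Rightarrow> 'k) \<Rightarrow> 'k \<Rightarrow> bool" where
  "vtendsto v s l \<longleftrightarrow> (\<lambda>n. v (s n - l)) \<longlonglongrightarrow> \<infinity>"

definition vCauchy :: "('k::field \<Rightarrow> ereal) \<Rightarrow> (nat \<Rightarrow> 'k) \<Rightarrow> bool" where
  "vCauchy v s \<longleftrightarrow> (\<forall>C::real. \<exists>N. \<forall>m\<ge>N. \<forall>n\<ge>N. ereal C \<le> v (s m - s n))"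

definition vlim :: "('k::field \<Rightarrow> ereal) \<Rightarrow> (nat \<Rightarrow> 'k) \<Rightarrow> 'k" where
  "vlim v s = (THE l. vtendsto v s l)"

definition complete_valuation :: "('k::field \<Rightarrow> ereal) \<Rightarrow> bool" where
  "complete_valuation v \<longleftrightarrow>
     (\<forall>x. v x \<noteq> -\<infinity>) \<and> (\<forall>x. v x = \<infinity> \<longleftrightarrow> x = 0) \<and>
     (\<forall>x y. v (x * y) = v x + v y) \<and>
     (\<forall>x y. min (v x) (v y) \<le> v (x + y)) \<and>
     (\<forall>s. vCauchy v s \<longrightarrow> (\<exists>l. vtendsto v s l))"

text \<open>\<open>\<rat>\<^sub>p\<close> is realised inside the complete field \<open>K\<close> as the closure of \<open>\<rat>\<close>. When
  \<open>0 < v p < \<infinity>\<close> the valuation \<open>v\<close> restricts to a positive multiple of the \<open>p\<close>-adic valuation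
  on \<open>\<rat>\<close>, so this closure is the \<open>p\<close>-adic completion of \<open>\<rat>\<close>.\<close>

definition Qp_in :: "('k::field_char_0 \<Rightarrow> ereal) \<Rightarrow> 'k set" where
  "Qp_in v = {x. \<exists>s::nat \<Rightarrow> rat. vtendsto v (\<lambda>n. of_rat (s n)) x}"

text \<open>The last two conditions say that \<open>v\<close> extends the valuation of \<open>F\<close> with value group
  \<open>\<int>\<close>, and that \<open>\<pi>\<close> is a uniformizer.\<close>

definition padic_setting ::
  "nat \<Rightarrow> ('k::{alg_closed_field, field_char_0} \<Rightarrow> ereal) \<Rightarrow> 'k set \<Rightarrow> 'k \<Rightarrow> bool" where
  "padic_setting p v F \<pi> \<longleftrightarrow>
     Factorial_Ring.prime p \<and> complete_valuation v \<and> 0 < v (of_nat p) \<and>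
     subfield F ring_of_type_algebra \<and> Qp_in v \<subseteq> F \<and>
     (\<exists>B. finite B \<and> B \<subseteq> F \<and>
        (\<forall>x\<in>F. \<exists>c. (\<forall>b\<in>B. c b \<in> Qp_in v) \<and> x = (\<Sum>b\<in>B. c b * b))) \<and>
     (\<forall>x\<in>F. x \<noteq> 0 \<longrightarrow> (\<exists>k::int. v x = ereal (of_int k))) \<and>
     \<pi> \<in> F \<and> v \<pi> = 1"

definition int_ring :: "('k::field \<Rightarrow> ereal) \<Rightarrow> 'k set \<Rightarrow> 'k set" where
  "int_ring v F = {a \<in> F. 0 \<le> v a}"

definition residue_card :: "('k::field \<Rightarrow> ereal) \<Rightarrow> 'k set \<Rightarrow> nat" where
  "residue_card v F =
     card (int_ring v F // {(a, b). a \<in> int_ring v F \<and> b \<in> int_ring v F \<and> 0 < v (a - b)})"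

section \<open>One-dimensional formal modules\<close>

text \<open>A \<open>\<pi>\<close>-divisible \<open>\<O>\<close>-module \<open>H\<close> of dimension 1 over \<open>\<O>\<^sub>K\<close> with formal special fibre is
  presented by its formal group in a coordinate \<open>T\<close>: a formal group law over \<open>\<O>\<^sub>K\<close> together
  with the power series \<open>[a](T)\<close>, \<open>a \<in> \<O>\<close>. Then \<open>H[\<pi>\<^sup>m]\<close> is the closed subscheme
  \<open>[\<pi>\<^sup>m](T) = 0\<close> of \<open>Spf \<O>\<^sub>K[[T]]\<close>. In \<open>fgl H\<close> the coefficient of \<open>X\<^sup>i Y\<^sup>j\<close> is
  \<open>fgl H $ i $ j\<close>; the values of \<open>act H\<close> outside \<open>\<O>\<close> are irrelevant.\<close>

record 'k formal_module =
  fgl :: "'k fps fps"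
  act :: "'k \<Rightarrow> 'k fps"

text \<open>Identities between formal power series in at most three variables are stated in
  \<open>K[[X\<^sub>1, X\<^sub>2, X\<^sub>3]]\<close>. Substituting series without constant term, only
  the terms of degree at most \<open>a + b + c\<close> contribute to a coefficient of total degree
  \<open>a + b + c\<close>, so the sums below are the full formal substitutions.\<close>

type_synonym 'k fps3 = "'k fps fps fps"

definition X1 :: "'k::field fps3" where "X1 = fps_X"
definition X2 :: "'k::field fps3" where "X2 = fps_const fps_X"
definition X3 :: "'k::field fps3" where "X3 = fps_const (fps_const fps_X)"

definition subst1 :: "'k::field fps \<Rightarrow> 'k fps3 \<Rightarrow> 'k fps3" where
  "subst1 f A = Abs_fps (\<lambda>a. Abs_fps (\<lambda>b. Abs_fps (\<lambda>c.
     \<Sum>i\<le>a + b + c. f $ i * (A ^ i) $ a $ b $ c)))"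

definition subst2 :: "'k::field fps fps \<Rightarrow> 'k fps3 \<Rightarrow> 'k fps3 \<Rightarrow> 'k fps3" where
  "subst2 f A B = Abs_fps (\<lambda>a. Abs_fps (\<lambda>b. Abs_fps (\<lambda>c.
     \<Sum>i\<le>a + b + c. \<Sum>j\<le>a + b + c. f $ i $ j * (A ^ i * B ^ j) $ a $ b $ c)))"

definition formal_group_law :: "('k::field \<Rightarrow> ereal) \<Rightarrow> 'k fps fps \<Rightarrow> bool" where
  "formal_group_law v G \<longleftrightarrow>
     (\<forall>i j. 0 \<le> v (G $ i $ j)) \<and>
     subst2 G X1 0 = X1 \<and>
     subst2 G X1 X2 = subst2 G X2 X1 \<and>
     subst2 G (subst2 G X1 X2) X3 = subst2 G X1 (subst2 G X2 X3)"

text \<open>The condition \<open>act H a $ 1 = a\<close> says that \<open>\<O>\<close> acts on the Lie algebra through the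
  inclusion \<open>\<O> \<rightarrow> \<O>\<^sub>K\<close>.\<close>

definition formal_O_module :: "('k::field \<Rightarrow> ereal) \<Rightarrow> 'k set \<Rightarrow> 'k formal_module \<Rightarrow> bool" where
  "formal_O_module v F H \<longleftrightarrow>
     formal_group_law v (fgl H) \<and>
     (\<forall>a\<in>int_ring v F.
        (\<forall>i. 0 \<le> v (act H a $ i)) \<and> act H a $ 0 = 0 \<and> act H a $ 1 = a \<and>
        subst1 (act H a) (subst2 (fgl H) X1 X2) =
          subst2 (fgl H) (subst1 (act H a) X1) (subst1 (act H a) X2)) \<and>
     act H 1 = fps_X \<and>
     (\<forall>a\<in>int_ring v F. \<forall>b\<in>int_ring v F.
        subst1 (act H (a + b)) X1 = subst2 (fgl H) (subst1 (act H a) X1) (subst1 (act H b) X1) \<and>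
        act H (a * b) = act H a oo act H b)"

text \<open>\<open>\<O>\<close>-height \<open>n\<close>: on the special fibre the series \<open>[\<pi>]\<close> has order \<open>q\<^sup>n\<close>, that is, \<open>H[\<pi>]\<close>
  has order \<open>q\<^sup>n\<close>.\<close>

definition O_height ::
  "('k::field \<Rightarrow> ereal) \<Rightarrow> 'k set \<Rightarrow> 'k \<Rightarrow> 'k formal_module \<Rightarrow> nat \<Rightarrow> bool" where
  "O_height v F \<pi> H n \<longleftrightarrow>
     (\<forall>i < residue_card v F ^ n. 0 < v (act H \<pi> $ i)) \<and>
     v (act H \<pi> $ (residue_card v F ^ n)) = 0"

section \<open>Points and the rational Tate module\<close>

definition points :: "('k::field \<Rightarrow> ereal) \<Rightarrow> 'k set" where
  "points v = {a. 0 < v a}"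

definition eval1 :: "('k::field \<Rightarrow> ereal) \<Rightarrow> 'k fps \<Rightarrow> 'k \<Rightarrow> 'k" where
  "eval1 v f x = vlim v (\<lambda>N. \<Sum>i<N. f $ i * x ^ i)"

definition eval2 :: "('k::field \<Rightarrow> ereal) \<Rightarrow> 'k fps fps \<Rightarrow> 'k \<Rightarrow> 'k \<Rightarrow> 'k" where
  "eval2 v f x y = vlim v (\<lambda>N. \<Sum>i<N. \<Sum>j<N. f $ i $ j * x ^ i * y ^ j)"

definition pi_torsion_points :: "('k::field \<Rightarrow> ereal) \<Rightarrow> 'k \<Rightarrow> 'k formal_module \<Rightarrow> 'k set" where
  "pi_torsion_points v \<pi> H = {y \<in> points v. eval1 v (act H \<pi>) y = 0}"

text \<open>\<open>V\<^sub>p(H)\<close> as an \<open>F\<close>-vector space. Multiplication by \<open>\<pi>\<close> is the shift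
  \<open>(\<pi> x)\<^sub>i = x\<^sub>i\<^sub>-\<^sub>1\<close>, so \<open>c = \<pi>\<^sup>-\<^sup>k (c \<pi>\<^sup>k)\<close> acts by \<open>(c x)\<^sub>i = [c \<pi>\<^sup>k](x\<^sub>i\<^sub>+\<^sub>k)\<close> for
  any \<open>k\<close> with \<open>c \<pi>\<^sup>k \<in> \<O>\<close>. The ring multiplication and unit of the record
  play no role.\<close>

definition V_p ::
  "('k::field \<Rightarrow> ereal) \<Rightarrow> 'k \<Rightarrow> 'k formal_module \<Rightarrow> ('k, int \<Rightarrow> 'k) module" where
  "V_p v \<pi> H = \<lparr>
     carrier = {x. (\<forall>i. x i \<in> points v) \<and> (\<forall>i. eval1 v (act H \<pi>) (x (i + 1)) = x i) \<and>
                   (\<exists>N. \<forall>i<N. x i = 0)},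
     mult = undefined,
     one = undefined,
     zero = (\<lambda>i. 0),
     add = (\<lambda>x y i. eval2 v (fgl H) (x i) (y i)),
     smult = (\<lambda>c x. let k = (LEAST k::nat. 0 \<le> v (c * \<pi> ^ k))
                     in (\<lambda>i. eval1 v (act H (c * \<pi> ^ k)) (x (i + int k)))) \<rparr>"

text \<open>\<open>Fil v \<pi> H \<infinity>\<close> consists of the sequences with \<open>x\<^sub>0 = 0\<close>, i.e. it is \<open>T\<^sub>p(H)\<close>.\<close>

definition Fil ::
  "('k::field \<Rightarrow> ereal) \<Rightarrow> 'k \<Rightarrow> 'k formal_module \<Rightarrow> ereal \<Rightarrow> (int \<Rightarrow> 'k) set" where
  "Fil v \<pi> H \<mu> = {x \<in> carrier (V_p v \<pi> H). \<mu> \<le> v (x 0)}"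

section \<open>The building of PGL(V)\<close>

text \<open>Here \<open>M\<close> is an \<open>F\<close>-vector space, \<open>F\<close> being given as a subset of \<open>K\<close>.\<close>

definition lin_comb ::
  "('k, 'a) module \<Rightarrow> nat \<Rightarrow> (nat \<Rightarrow> 'a) \<Rightarrow> (nat \<Rightarrow> 'k) \<Rightarrow> 'a" where
  "lin_comb M d e c = (\<Oplus>\<^bsub>M\<^esub>i\<in>{..<d}. c i \<odot>\<^bsub>M\<^esub> e i)"

definition is_basis :: "'k set \<Rightarrow> ('k, 'a) module \<Rightarrow> nat \<Rightarrow> (nat \<Rightarrow> 'a) \<Rightarrow> bool" where
  "is_basis F M d e \<longleftrightarrow>
     (\<forall>i<d. e i \<in> carrier M) \<and>
     (\<forall>x\<in>carrier M. \<exists>!c. c \<in> {..<d} \<rightarrow>\<^sub>E F \<and> x = lin_comb M d e c)"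

definition O_span ::
  "('k::field \<Rightarrow> ereal) \<Rightarrow> 'k set \<Rightarrow> ('k, 'a) module \<Rightarrow> nat \<Rightarrow> (nat \<Rightarrow> 'a) \<Rightarrow> 'a set" where
  "O_span v F M d e = lin_comb M d e ` ({..<d} \<rightarrow>\<^sub>E int_ring v F)"

definition is_lattice ::
  "('k::field \<Rightarrow> ereal) \<Rightarrow> 'k set \<Rightarrow> ('k, 'a) module \<Rightarrow> 'a set \<Rightarrow> bool" where
  "is_lattice v F M \<Lambda> \<longleftrightarrow> (\<exists>d e. is_basis F M d e \<and> \<Lambda> = O_span v F M d e)"

definition homothety_class ::
  "'k::field set \<Rightarrow> ('k, 'a) module \<Rightarrow> 'a set \<Rightarrow> 'a set set" where
  "homothety_class F M \<Lambda> = {(\<lambda>x. c \<odot>\<^bsub>M\<^esub> x) ` \<Lambda> |c. c \<in> F - {0}}"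

definition apartment_vertex ::
  "('k::field \<Rightarrow> ereal) \<Rightarrow> 'k set \<Rightarrow> 'k \<Rightarrow> ('k, 'a) module \<Rightarrow> nat \<Rightarrow> (nat \<Rightarrow> 'a) \<Rightarrow>
   (nat \<Rightarrow> int) \<Rightarrow> 'a set set" where
  "apartment_vertex v F \<pi> M d e a =
     homothety_class F M (O_span v F M d (\<lambda>i. (\<pi> powi a i) \<odot>\<^bsub>M\<^esub> e i))"

definition apartment ::
  "('k::field \<Rightarrow> ereal) \<Rightarrow> 'k set \<Rightarrow> 'k \<Rightarrow> ('k, 'a) module \<Rightarrow> nat \<Rightarrow> (nat \<Rightarrow> 'a) \<Rightarrow>
   'a set set set" where
  "apartment v F \<pi> M d e = range (apartment_vertex v F \<pi> M d e)"

definition half_apartment ::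
  "('k::field \<Rightarrow> ereal) \<Rightarrow> 'k set \<Rightarrow> 'k \<Rightarrow> ('k, 'a) module \<Rightarrow> nat \<Rightarrow> (nat \<Rightarrow> 'a) \<Rightarrow>
   nat \<Rightarrow> nat \<Rightarrow> int \<Rightarrow> 'a set set set" where
  "half_apartment v F \<pi> M d e i j b =
     {apartment_vertex v F \<pi> M d e a |a. b \<le> a j - a i}"

text \<open>The intersection is taken inside the apartment, so that it is the whole apartment when no
  half-apartment contains \<open>Xs\<close> (in particular when \<open>d = 1\<close>).\<close>

definition enclosure_in ::
  "('k::field \<Rightarrow> ereal) \<Rightarrow> 'k set \<Rightarrow> 'k \<Rightarrow> ('k, 'a) module \<Rightarrow> nat \<Rightarrow> (nat \<Rightarrow> 'a) \<Rightarrow>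
   'a set set set \<Rightarrow> 'a set set set" where
  "enclosure_in v F \<pi> M d e Xs =
     apartment v F \<pi> M d e \<inter>
     \<Inter>{D. (\<exists>i<d. \<exists>j<d. \<exists>b. i \<noteq> j \<and> D = half_apartment v F \<pi> M d e i j b) \<and> Xs \<subseteq> D}"

text \<open>The enclosure of \<open>Xs\<close> makes sense when \<open>Xs\<close> is finite and lies in some apartment; as it
  does not depend on the apartment, being contained in it is required for all of them.\<close>

definition contained_in_enclosure ::
  "('k::field \<Rightarrow> ereal) \<Rightarrow> 'k set \<Rightarrow> 'k \<Rightarrow> ('k, 'a) module \<Rightarrow>
   'a set set set \<Rightarrow> 'a set set set \<Rightarrow> bool" where
  "contained_in_enclosure v F \<pi> M Ys Xs \<longleftrightarrow>
     finite Xs \<and>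
     (\<exists>d e. is_basis F M d e \<and> Xs \<subseteq> apartment v F \<pi> M d e) \<and>
     (\<forall>d e. is_basis F M d e \<and> Xs \<subseteq> apartment v F \<pi> M d e \<longrightarrow>
        Ys \<subseteq> enclosure_in v F \<pi> M d e Xs)"

definition vertex_join ::
  "('k::field \<Rightarrow> ereal) \<Rightarrow> 'k set \<Rightarrow> ('k, 'a) module \<Rightarrow> 'a set set \<Rightarrow> 'a set set \<Rightarrow>
   'a set set set" where
  "vertex_join v F M x y =
     {homothety_class F M (\<Lambda>1 <+>\<^bsub>M\<^esub> \<Lambda>2) |\<Lambda>1 \<Lambda>2.
        is_lattice v F M \<Lambda>1 \<and> is_lattice v F M \<Lambda>2 \<and>
        homothety_class F M \<Lambda>1 = x \<and> homothety_class F M \<Lambda>2 = y}"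

definition linear_iso ::
  "'k set \<Rightarrow> ('k, 'a) module \<Rightarrow> ('k, 'b) module \<Rightarrow> ('a \<Rightarrow> 'b) \<Rightarrow> bool" where
  "linear_iso F M M' \<phi> \<longleftrightarrow>
     bij_betw \<phi> (carrier M) (carrier M') \<and>
     (\<forall>x\<in>carrier M. \<forall>y\<in>carrier M. \<phi> (x \<oplus>\<^bsub>M\<^esub> y) = \<phi> x \<oplus>\<^bsub>M'\<^esub> \<phi> y) \<and>
     (\<forall>c\<in>F. \<forall>x\<in>carrier M. \<phi> (c \<odot>\<^bsub>M\<^esub> x) = c \<odot>\<^bsub>M'\<^esub> \<phi> x)"

definition vertex_image :: "('a \<Rightarrow> 'b) \<Rightarrow> 'a set set \<Rightarrow> 'b set set" where
  "vertex_image \<phi> x = (\<lambda>\<Lambda>. \<phi> ` \<Lambda>) ` x"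

section \<open>Vertices attached to the ramification filtration\<close>

definition Fil_vertex ::
  "('k::field \<Rightarrow> ereal) \<Rightarrow> 'k set \<Rightarrow> 'k \<Rightarrow> 'k formal_module \<Rightarrow> ereal \<Rightarrow>
   (int \<Rightarrow> 'k) set set" where
  "Fil_vertex v F \<pi> H \<mu> = homothety_class F (V_p v \<pi> H) (Fil v \<pi> H \<mu>)"

definition Fil_vertices ::
  "('k::field \<Rightarrow> ereal) \<Rightarrow> 'k set \<Rightarrow> 'k \<Rightarrow> 'k formal_module \<Rightarrow> (int \<Rightarrow> 'k) set set set" where
  "Fil_vertices v F \<pi> H = {Fil_vertex v F \<pi> H \<mu> |\<mu>. 0 < \<mu> \<and> \<mu> \<le> \<infinity>}"

definition S_bound :: "('k::field \<Rightarrow> ereal) \<Rightarrow> 'k \<Rightarrow> 'k formal_module \<Rightarrow> real \<Rightarrow> bool" where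
  "S_bound v \<pi> H \<epsilon> \<longleftrightarrow> 0 < \<epsilon> \<and> (\<forall>y\<in>pi_torsion_points v \<pi> H. ereal \<epsilon> \<le> v y)"

definition S_vertices ::
  "('k::field \<Rightarrow> ereal) \<Rightarrow> 'k set \<Rightarrow> 'k \<Rightarrow> 'k formal_module \<Rightarrow> real \<Rightarrow>
   (int \<Rightarrow> 'k) set set set" where
  "S_vertices v F \<pi> H \<epsilon> = {Fil_vertex v F \<pi> H \<mu> |\<mu>. 0 < \<mu> \<and> \<mu> \<le> ereal \<epsilon>}"

end

theory Submission
  imports Defs
begin

text \<open>Write \<open>f = [\<pi>]\<close>, of Weierstrass degree \<open>Q = q\<^sup>n\<close>. By the Newton polygon of \<open>f - y\<close>, the
  points of valuation at least \<open>\<kappa>\<close> are mapped by \<open>f\<close> onto those of valuation at least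
  \<open>min\<^sub>i (v(f\<^sub>i) + i \<kappa>)\<close>, so that \<open>\<pi> Fil\<^sub>\<kappa> + T\<close> is again a step \<open>Fil\<^sub>\<kappa>\<^sub>'\<close> of the filtration; every
  step is reached in this way from one with \<open>\<kappa> \<le> \<epsilon>\<close>. Hence the lattices \<open>Fil\<^sub>\<kappa>\<close> are, up to
  homothety, the sums \<open>c Fil\<^sub>\<mu> + T\<close> with \<open>0 < \<mu> \<le> \<epsilon>\<close>. Such a sum only depends on the classes of its
  summands up to the choice of \<open>c\<close>, and in an apartment containing both classes it is computed by
  coordinatewise minima, which preserve the half-apartments.

  That \<open>S\<close> and \<open>[T]\<close> lie in a common apartment follows from a basis of \<open>T\<close> which is orthogonal
  for the inverse norm \<open>lim Q\<^sup>k v(\<pi>\<^sup>-\<^sup>k x)\<close>, whose superlevel sets are the \<open>Fil\<^sub>\<mu>\<close> with \<open>\<mu> \<le> \<epsilon>\<close>; it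
  is found greedily from the finite quotient \<open>T / \<pi> T = H[\<pi>]\<close>, using that \<open>F\<close> is complete.\<close>

text \<open>The analytic input is that \<open>\<epsilon>\<close> bounds the zeros of
  \<open>[\<pi>]\<close> from below: this forces the coefficient of degree \<open>i \<le> Q\<close>
  to have valuation at least \<open>(Q - i) \<epsilon>\<close>. So below \<open>\<epsilon>\<close>
  the term of degree \<open>Q\<close> dominates and \<open>[\<pi>]\<close> multiplies valuations by
  exactly \<open>Q\<close>, which makes the inverse norm well defined; above
  \<open>\<epsilon>\<close> each application adds at least \<open>\<epsilon>\<close>, which bounds
  the order of torsion points there. The obstacle in solving \<open>f(z) = y\<close> is that
  \<open>f\<close> is a power series and that its derivative need not be a unit. A truncation is
  factored over the algebraically closed \<open>K\<close>, and its root is moved to a root of the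
  series; the unit coefficient in degree \<open>Q\<close> keeps this under control at the price of
  dividing the precision by \<open>Q\<close>. The adapted basis shows that one apartment contains
  the data, but the enclosure has to be checked in every such apartment, so joins are computed in an
  arbitrary one. That \<open>S\<close> and \<open>[T]\<close> determine the vertices is read as
  follows: an \<open>F\<close>-linear isomorphism of two rational Tate modules that matches these
  data matches all vertices.\<close>

unbundle no vec_syntax
hide_const (open) up_ring.coeff up_ring.monom Polynomials.lead_coeff Polynomials.degree

section \<open>Valuations\<close>

locale valued_field =
  fixes v :: "'k::field_char_0 \<Rightarrow> ereal"
  assumes complete_valuation: "complete_valuation v"
begin

lemma v_eq_infty [simp]: "v x = \<infinity> \<longleftrightarrow> x = 0"
  and v_not_MInf [simp]: "v x \<noteq> -\<infinity>"
  and v_mult: "v (x * y) = v x + v y"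
  and v_add: "min (v x) (v y) \<le> v (x + y)"
  using complete_valuation by (auto simp: complete_valuation_def)

lemma v_0 [simp]: "v 0 = \<infinity>"
  by simp

lemma v_1 [simp]: "v 1 = 0"
proof -
  have "v 1 = v 1 + v 1" using v_mult[of 1 1] by simp
  then show ?thesis using v_not_MInf[of 1] v_eq_infty[of 1] by (cases "v 1") auto
qed

lemma v_uminus [simp]: "v (- x) = v x"
proof -
  have "v (-1) + v (-1) = 0" using v_mult[of "-1" "-1"] by simp
  then have "v (-1) = 0" by (cases "v (-1)") auto
  then show ?thesis using v_mult[of "-1" x] by simp
qed

lemma v_add_ge: "C \<le> v x \<Longrightarrow> C \<le> v y \<Longrightarrow> C \<le> v (x + y)"
  using v_add[of x y] by (metis min.boundedI order_trans)

lemma v_diff_ge: "C \<le> v x \<Longrightarrow> C \<le> v y \<Longrightarrow> C \<le> v (x - y)"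
  using v_add_ge[of C x "- y"] by simp

lemma v_diff_commute: "v (x - y) = v (y - x)"
  using v_uminus[of "x - y"] by simp

lemma v_sum_ge: "(\<And>i. i \<in> A \<Longrightarrow> C \<le> v (f i)) \<Longrightarrow> C \<le> v (sum f A)"
  by (induction A rule: infinite_finite_induct) (auto intro!: v_add_ge)

lemma v_add_eq: assumes "v x < v y" shows "v (x + y) = v x"
proof (rule antisym)
  show "v x \<le> v (x + y)" using assms by (intro v_add_ge) auto
  show "v (x + y) \<le> v x"
  proof (rule ccontr)
    assume "\<not> v (x + y) \<le> v x"
    then have "v x < min (v (x + y)) (v y)" using assms by simp
    moreover have "min (v (x + y)) (v y) \<le> v ((x + y) - y)" by (rule v_diff_ge) auto
    ultimately have "v x < v ((x + y) - y)" by (rule less_le_trans)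
    then show False by simp
  qed
qed

lemma v_power: "v (x ^ n) = ereal (real n) * v x"
proof (induction n)
  case 0
  then show ?case by (simp add: zero_ereal_def[symmetric])
next
  case (Suc n)
  then show ?case using v_not_MInf[of x]
    by (cases "v x") (auto simp: v_mult algebra_simps)
qed

lemma v_mult_ge: "ereal C \<le> v x \<Longrightarrow> ereal D \<le> v y \<Longrightarrow> ereal (C + D) \<le> v (x * y)"
  using add_mono[of "ereal C" "v x" "ereal D" "v y"] by (simp add: v_mult)

lemma v_mult_nonneg: "0 \<le> v x \<Longrightarrow> 0 \<le> v y \<Longrightarrow> 0 \<le> v (x * y)"
  by (simp add: v_mult)

lemma v_mult_ge_right: "0 \<le> v x \<Longrightarrow> C \<le> v y \<Longrightarrow> C \<le> v (x * y)"
  using add_mono[of 0 "v x" C "v y"] by (simp add: v_mult)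

lemma v_power_ge: "ereal r \<le> v x \<Longrightarrow> ereal (real n * r) \<le> v (x ^ n)"
  by (induction n) (auto simp: algebra_simps v_mult zero_ereal_def[symmetric] add_mono
      simp flip: plus_ereal.simps(1))

lemma v_power_nonneg: "0 \<le> v x \<Longrightarrow> 0 \<le> v (x ^ n)"
  using v_power_ge[of 0 x n] by (simp add: zero_ereal_def)

lemma v_real: assumes "x \<noteq> 0" obtains r where "v x = ereal r"
  using assms v_not_MInf[of x] v_eq_infty[of x] by (cases "v x") auto

lemma v_inverse: assumes x: "x \<noteq> 0" shows "v (inverse x) = - v x"
proof -
  have sum: "v x + v (inverse x) = 0" using x v_mult[of x "inverse x"] by simp
  obtain r s where "v x = ereal r" "v (inverse x) = ereal s"
    using v_real x inverse_nonzero_iff_nonzero by metis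
  then show ?thesis using sum by simp
qed

lemma v_eqI: assumes "\<And>C::real. ereal C \<le> v (x - y)" shows "x = y"
proof -
  have "v (x - y) = \<infinity>" using assms ereal_top by blast
  then show ?thesis by simp
qed

lemma v_pos_real: assumes "0 < v x" obtains r :: real where "0 < r" "ereal r \<le> v x"
  using assms
proof (cases "v x")
  case (real r) then show ?thesis using that[of r] assms by auto
next
  case PInf then show ?thesis using that[of 1] by auto
qed auto

lemma vtendsto_iff: "vtendsto v s l \<longleftrightarrow> (\<forall>C::real. \<exists>N. \<forall>n\<ge>N. ereal C \<le> v (s n - l))"
  by (simp add: vtendsto_def Lim_PInfty)

lemma vtendsto_unique: assumes "vtendsto v s l" "vtendsto v s m" shows "l = m"
proof (rule v_eqI)
  fix C :: real
  obtain N1 where N1: "\<forall>n\<ge>N1. ereal C \<le> v (s n - l)" using assms(1) vtendsto_iff by blast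
  obtain N2 where N2: "\<forall>n\<ge>N2. ereal C \<le> v (s n - m)" using assms(2) vtendsto_iff by blast
  let ?n = "max N1 N2"
  have "ereal C \<le> v (s ?n - m)" "ereal C \<le> v (s ?n - l)" using N1 N2 by auto
  then have "ereal C \<le> v ((s ?n - m) - (s ?n - l))" by (rule v_diff_ge)
  then show "ereal C \<le> v (l - m)" by simp
qed

lemma vlim_eq: "vtendsto v s l \<Longrightarrow> vlim v s = l"
  unfolding vlim_def using vtendsto_unique by blast

lemma archimedean_bound: assumes "0 < r" obtains N :: nat where "\<And>n. N \<le> n \<Longrightarrow> C \<le> real n * r"
proof -
  obtain N :: nat where N: "C / r < real N" using reals_Archimedean2 by blast
  show ?thesis
  proof (rule that[of N])
    fix n assume "N \<le> n"
    then have "C / r \<le> real n" using N by linarith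
    then show "C \<le> real n * r" using assms by (simp add: field_simps)
  qed
qed

lemma vtendstoI_linear:
  assumes "0 < r" "\<And>N. ereal (real N * r) \<le> v (s N - l)" shows "vtendsto v s l"
  unfolding vtendsto_iff
proof
  fix C :: real
  obtain N where "\<And>n. N \<le> n \<Longrightarrow> C \<le> real n * r" using archimedean_bound[OF assms(1)] by blast
  then have "ereal C \<le> v (s n - l)" if "N \<le> n" for n
    using assms(2)[of n] that by (meson ereal_less_eq(3) order_trans)
  then show "\<exists>N. \<forall>n\<ge>N. ereal C \<le> v (s n - l)" by blast
qed

lemma v_limit_ge:
  assumes "vtendsto v s l" "\<And>n. ereal C \<le> v (s n - y)" shows "ereal C \<le> v (l - y)"
proof -
  obtain N where "\<forall>n\<ge>N. ereal C \<le> v (s n - l)" using assms(1) vtendsto_iff by blast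
  then have "ereal C \<le> v ((s N - y) - (s N - l))" by (intro v_diff_ge[OF assms(2)]) blast
  then show ?thesis by simp
qed

text \<open>By the ultrametric inequality a bound on consecutive differences bounds all differences.
  The linear rate is kept explicit because later estimates need the distance from each finite stage
  to the limit, not just convergence.\<close>

lemma vlim_exists_linear:
  assumes r: "0 < r" and step: "\<And>N. ereal (real N * r + D) \<le> v (s (Suc N) - s N)"
  obtains l where "\<And>N. ereal (real N * r + D) \<le> v (s N - l)" "vtendsto v s l"
proof -
  have diff: "ereal (real N * r + D) \<le> v (s (N + m) - s N)" for N m
  proof (induction m)
    case (Suc m)
    have "ereal (real N * r + D) \<le> ereal (real (N + m) * r + D)" using r by (simp add: mult_right_mono)
    also have "\<dots> \<le> v (s (Suc (N + m)) - s (N + m))" by (rule step)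
    finally have "ereal (real N * r + D) \<le> v ((s (Suc (N + m)) - s (N + m)) + (s (N + m) - s N))"
      using Suc by (intro v_add_ge)
    then show ?case by simp
  qed auto
  have "vCauchy v s" unfolding vCauchy_def
  proof
    fix C :: real
    obtain N where N: "C - D \<le> real N * r" using archimedean_bound[OF r, of "C - D"] by blast
    show "\<exists>N. \<forall>m\<ge>N. \<forall>n\<ge>N. ereal C \<le> v (s m - s n)"
    proof (intro exI allI impI)
      fix m n assume "N \<le> m" "N \<le> n"
      then have "ereal (real N * r + D) \<le> v (s m - s N)" "ereal (real N * r + D) \<le> v (s n - s N)"
        using diff[of N "m - N"] diff[of N "n - N"] by auto
      then have "ereal (real N * r + D) \<le> v ((s m - s N) - (s n - s N))" by (rule v_diff_ge)
      moreover have "ereal C \<le> ereal (real N * r + D)" using N by simp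
      ultimately show "ereal C \<le> v (s m - s n)" by (metis diff_diff_eq2 diff_add_cancel order_trans)
    qed
  qed
  then obtain l where l: "vtendsto v s l"
    using complete_valuation unfolding complete_valuation_def by blast
  have "ereal (real N * r + D) \<le> v (s N - l)" for N
  proof -
    have "vtendsto v (\<lambda>m. s (N + m)) l"
      using l unfolding vtendsto_iff by (meson le_add2 order_trans)
    then have "ereal (real N * r + D) \<le> v (l - s N)" using diff by (rule v_limit_ge)
    then show ?thesis by (simp add: v_diff_commute)
  qed
  with l show ?thesis using that by blast
qed

end

section \<open>Evaluation of power series\<close>

definition fps_all :: "('a::zero \<Rightarrow> bool) \<Rightarrow> 'a fps \<Rightarrow> bool" where
  "fps_all I f \<longleftrightarrow> (\<forall>i. I (f $ i))"

definition fps_map :: "('a::zero \<Rightarrow> 'b::zero) \<Rightarrow> 'a fps \<Rightarrow> 'b fps" where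
  "fps_map h f = Abs_fps (\<lambda>i. h (f $ i))"

text \<open>Evaluation is controlled only on series with integral coefficients, so it is treated as
  a homomorphism relative to a predicate that cuts out a subring. Both notions pass to
  coefficientwise series, and the one-variable case can be iterated up to three variables.\<close>

locale subring_pred =
  fixes I :: "'a::comm_ring_1 \<Rightarrow> bool"
  assumes I_0: "I 0" and I_1: "I 1" and I_add: "I a \<Longrightarrow> I b \<Longrightarrow> I (a + b)"
    and I_mult: "I a \<Longrightarrow> I b \<Longrightarrow> I (a * b)" and I_uminus: "I a \<Longrightarrow> I (- a)"
begin

lemma I_diff: "I a \<Longrightarrow> I b \<Longrightarrow> I (a - b)"
  using I_add[of a "- b"] I_uminus[of b] by simp

lemma I_sum: "(\<And>i. i \<in> A \<Longrightarrow> I (f i)) \<Longrightarrow> I (sum f A)"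
  by (induction A rule: infinite_finite_induct) (auto intro: I_0 I_add)

lemma I_power: "I a \<Longrightarrow> I (a ^ n)"
  by (induction n) (auto intro: I_1 I_mult)

lemma fps_all: "subring_pred (fps_all I)"
  by unfold_locales (auto simp: fps_all_def fps_mult_nth I_0 I_1 I_add I_uminus intro!: I_sum I_mult)

end

locale hom_pred = subring_pred I for I :: "'a::comm_ring_1 \<Rightarrow> bool" +
  fixes h :: "'a \<Rightarrow> 'b::comm_ring_1"
  assumes h_0: "h 0 = 0" and h_1: "h 1 = 1"
    and h_add: "I a \<Longrightarrow> I b \<Longrightarrow> h (a + b) = h a + h b"
    and h_mult: "I a \<Longrightarrow> I b \<Longrightarrow> h (a * b) = h a * h b"
begin

lemma h_uminus: "I a \<Longrightarrow> h (- a) = - h a"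
  using h_add[of a "- a"] I_uminus[of a] h_0 by (simp add: eq_neg_iff_add_eq_0 add.commute)

lemma h_diff: "I a \<Longrightarrow> I b \<Longrightarrow> h (a - b) = h a - h b"
  using h_add[of a "- b"] h_uminus[of b] I_uminus[of b] by simp

lemma h_sum: "(\<And>i. i \<in> A \<Longrightarrow> I (f i)) \<Longrightarrow> h (sum f A) = (\<Sum>i\<in>A. h (f i))"
  by (induction A rule: infinite_finite_induct) (auto simp: h_0 h_add I_sum)

lemma h_power: "I a \<Longrightarrow> h (a ^ n) = h a ^ n"
  by (induction n) (auto simp: h_1 h_mult I_power)

lemma fps_map: "hom_pred (fps_all I) (fps_map h)"
proof -
  interpret A: subring_pred "fps_all I" by (rule fps_all)
  show ?thesis
    by unfold_locales
      (auto simp: fps_map_def fps_eq_iff fps_all_def fps_mult_nth h_0 h_1 h_add h_mult h_sum I_mult)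
qed

lemma comp:
  assumes "hom_pred J g" "\<And>a. I a \<Longrightarrow> J (h a)" shows "hom_pred I (\<lambda>a. g (h a))"
proof -
  interpret g: hom_pred J g by fact
  show ?thesis
    by unfold_locales (auto simp: h_0 h_1 h_add h_mult g.h_0 g.h_1 g.h_add g.h_mult assms(2))
qed

end

lemma fps_map_const: "h 0 = 0 \<Longrightarrow> fps_map h (fps_const c) = fps_const (h c)"
  by (auto simp: fps_map_def fps_eq_iff)

lemma fps_map_X: "h 0 = 0 \<Longrightarrow> h 1 = 1 \<Longrightarrow> fps_map h fps_X = fps_X"
  by (auto simp: fps_map_def fps_eq_iff fps_X_def)

section \<open>Evaluation in one variable at points of positive valuation\<close>

context valued_field
begin

definition int0 :: "'k \<Rightarrow> bool" where "int0 a \<longleftrightarrow> 0 \<le> v a"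

abbreviation "int1 \<equiv> fps_all int0"
abbreviation "int2 \<equiv> fps_all int1"
abbreviation "int3 \<equiv> fps_all int2"

sublocale i0: subring_pred int0
  by unfold_locales (auto simp: int0_def intro: v_add_ge v_mult_nonneg)
sublocale i1: subring_pred int1 by (rule i0.fps_all)
sublocale i2: subring_pred int2 by (rule i1.fps_all)
sublocale i3: subring_pred int3 by (rule i2.fps_all)

lemma int1_nth: "int1 f \<Longrightarrow> 0 \<le> v (f $ i)"
  by (simp add: fps_all_def int0_def)

abbreviation "ev f x \<equiv> eval1 v f x"

lemma term_ge:
  assumes "int1 f" "ereal r \<le> v x" shows "ereal (real i * r) \<le> v (f $ i * x ^ i)"
  using assms int1_nth v_power_ge v_mult_ge_right by blast

lemma ev_tendsto:
  assumes f: "int1 f" and x: "0 < v x"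
  shows "vtendsto v (\<lambda>N. \<Sum>i<N. f $ i * x ^ i) (ev f x)"
proof -
  obtain r where r: "0 < r" "ereal r \<le> v x" using v_pos_real[OF x] by blast
  obtain l where "vtendsto v (\<lambda>N. \<Sum>i<N. f $ i * x ^ i) l"
    by (rule vlim_exists_linear[OF r(1), of 0 "\<lambda>N. \<Sum>i<N. f $ i * x ^ i"])
      (auto simp: term_ge[OF f r(2)])
  then show ?thesis unfolding eval1_def using vlim_eq by simp
qed

lemma ev_approx:
  assumes f: "int1 f" and r: "0 < r" "ereal r \<le> v x"
  shows "ereal (real N * r) \<le> v (ev f x - (\<Sum>i<N. f $ i * x ^ i))"
proof -
  obtain l where "\<And>N. ereal (real N * r + 0) \<le> v ((\<Sum>i<N. f $ i * x ^ i) - l)"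
    "vtendsto v (\<lambda>N. \<Sum>i<N. f $ i * x ^ i) l"
    by (rule vlim_exists_linear[OF r(1), of 0 "\<lambda>N. \<Sum>i<N. f $ i * x ^ i"])
      (auto simp: term_ge[OF f r(2)])
  then show ?thesis unfolding eval1_def using vlim_eq by (simp add: v_diff_commute)
qed

lemma ev_unique:
  assumes "0 < r" "\<And>N. ereal (real N * r) \<le> v ((\<Sum>i<N. f $ i * x ^ i) - y)"
  shows "ev f x = y"
  unfolding eval1_def by (rule vlim_eq[OF vtendstoI_linear[OF assms]])

lemma ev_ge:
  assumes f: "int1 f" and x: "0 < v x" and L: "\<And>i. ereal L \<le> v (f $ i * x ^ i)"
  shows "ereal L \<le> v (ev f x)"
  using v_limit_ge[OF ev_tendsto[OF f x], of L 0] L by (simp add: v_sum_ge)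

lemma ev_int: "int1 f \<Longrightarrow> 0 < v x \<Longrightarrow> int0 (ev f x)"
  using ev_ge[of f x 0] by (simp add: int0_def int1_nth v_mult_nonneg v_power_nonneg less_imp_le
      flip: zero_ereal_def)

lemma ev_const [simp]: "ev (fps_const c) x = c"
proof -
  have "(\<Sum>i<N. fps_const c $ i * x ^ i) = c" if "0 < N" for N
    using that by (subst sum.remove[of _ 0]) auto
  then have "vtendsto v (\<lambda>N. \<Sum>i<N. fps_const c $ i * x ^ i) c"
    unfolding vtendsto_iff by (metis diff_self v_0 ereal_less_eq(1) less_eq_Suc_le)
  then show ?thesis unfolding eval1_def by (rule vlim_eq)
qed

lemma ev_0 [simp]: "ev 0 x = 0" and ev_1 [simp]: "ev 1 x = 1"
  using ev_const[of 0 x] ev_const[of 1 x] by simp_all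

lemma ev_add:
  assumes f: "int1 f" and g: "int1 g" and x: "0 < v x" shows "ev (f + g) x = ev f x + ev g x"
proof -
  obtain r where r: "0 < r" "ereal r \<le> v x" using v_pos_real[OF x] by blast
  show ?thesis
  proof (rule ev_unique[OF r(1)])
    fix N
    have "ereal (real N * r) \<le> v ((ev f x - (\<Sum>i<N. f $ i * x ^ i)) + (ev g x - (\<Sum>i<N. g $ i * x ^ i)))"
      using ev_approx[OF f r] ev_approx[OF g r] by (rule v_add_ge)
    also have "\<dots> = v ((\<Sum>i<N. (f + g) $ i * x ^ i) - (ev f x + ev g x))"
      by (subst v_diff_commute) (simp add: algebra_simps sum.distrib)
    finally show "ereal (real N * r) \<le> \<dots>" .
  qed
qed

lemma ev_cmult:
  assumes c: "int0 c" and f: "int1 f" and x: "0 < v x" shows "ev (fps_const c * f) x = c * ev f x"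
proof -
  obtain r where r: "0 < r" "ereal r \<le> v x" using v_pos_real[OF x] by blast
  show ?thesis
  proof (rule ev_unique[OF r(1)])
    fix N
    have "ereal (real N * r) \<le> v (c * (ev f x - (\<Sum>i<N. f $ i * x ^ i)))"
      using ev_approx[OF f r] c unfolding int0_def by (rule v_mult_ge_right[rotated])
    also have "\<dots> = v ((\<Sum>i<N. (fps_const c * f) $ i * x ^ i) - c * ev f x)"
      by (subst v_diff_commute) (simp add: algebra_simps sum_distrib_left)
    finally show "ereal (real N * r) \<le> \<dots>" .
  qed
qed

lemma ev_X_mult:
  assumes f: "int1 f" and x: "0 < v x" shows "ev (fps_X * f) x = x * ev f x"
proof -
  obtain r where r: "0 < r" "ereal r \<le> v x" using v_pos_real[OF x] by blast
  show ?thesis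
  proof (rule ev_unique[OF r(1)])
    fix N
    show "ereal (real N * r) \<le> v ((\<Sum>i<N. (fps_X * f) $ i * x ^ i) - x * ev f x)"
    proof (cases N)
      case 0
      then show ?thesis using ev_int[OF f x] x
        by (simp add: v_mult int0_def flip: zero_ereal_def)
    next
      case (Suc M)
      have "(\<Sum>i<N. (fps_X * f) $ i * x ^ i) = x * (\<Sum>i<M. f $ i * x ^ i)"
        unfolding Suc sum.lessThan_Suc_shift by (simp add: sum_distrib_left mult_ac del: sum.lessThan_Suc)
      then have "(\<Sum>i<N. (fps_X * f) $ i * x ^ i) - x * ev f x
          = - (x * (ev f x - (\<Sum>i<M. f $ i * x ^ i)))" by (simp add: algebra_simps)
      moreover have "ereal (r + real M * r) \<le> v (x * (ev f x - (\<Sum>i<M. f $ i * x ^ i)))"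
        using r(2) ev_approx[OF f r] by (rule v_mult_ge)
      moreover have "r + real M * r = real N * r" by (simp add: Suc algebra_simps)
      ultimately show ?thesis by (simp only: v_uminus)
    qed
  qed
qed

lemma ev_X [simp]: "0 < v x \<Longrightarrow> ev fps_X x = x"
  using ev_X_mult[of 1 x] by (simp add: i1.I_1)

text \<open>Peeling off the terms of \<open>f\<close> one at a time only uses multiplication by
  constants and by the variable. The rest carries a factor \<open>x ^ N\<close>, so the same partial
  sums converge to both sides, and no Cauchy product has to be rearranged.\<close>

lemma ev_mult:
  assumes f: "int1 f" and g: "int1 g" and x: "0 < v x" shows "ev (f * g) x = ev f x * ev g x"
proof -
  have split: "ev (f * g) x = (\<Sum>i<N. f $ i * x ^ i) * ev g x + x ^ N * ev (fps_shift N f * g) x" for N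
  proof (induction N)
    case (Suc N)
    have sh: "int1 (fps_shift m f)" for m using f by (simp add: fps_all_def)
    have "fps_shift N f = fps_const (f $ N) + fps_X * fps_shift (Suc N) f"
      by (auto simp: fps_eq_iff)
    then have "fps_shift N f * g = fps_const (f $ N) * g + fps_X * (fps_shift (Suc N) f * g)"
      by (simp add: algebra_simps)
    moreover have "ev (fps_const (f $ N) * g + fps_X * (fps_shift (Suc N) f * g)) x
        = f $ N * ev g x + x * ev (fps_shift (Suc N) f * g) x"
    proof -
      have c: "int0 (f $ N)" using f by (simp add: fps_all_def)
      have 1: "int1 (fps_const (f $ N) * g)"
        using c g i0.I_0 by (intro i1.I_mult) (auto simp: fps_all_def)
      have 2: "int1 (fps_shift (Suc N) f * g)" using sh g by (rule i1.I_mult)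
      have 3: "int1 (fps_X * (fps_shift (Suc N) f * g))"
        using 2 i0.I_0 by (auto simp: fps_all_def)
      show ?thesis using ev_add[OF 1 3 x] ev_cmult[OF c g x] ev_X_mult[OF 2 x] by simp
    qed
    ultimately show ?case using Suc by (simp add: algebra_simps)
  qed simp
  obtain r where r: "0 < r" "ereal r \<le> v x" using v_pos_real[OF x] by blast
  have "vtendsto v (\<lambda>N. (\<Sum>i<N. f $ i * x ^ i) * ev g x) (ev (f * g) x)"
  proof (rule vtendstoI_linear[OF r(1)])
    fix N
    have "int1 (fps_shift N f * g)" using f g by (intro i1.I_mult) (simp add: fps_all_def)
    then have "0 \<le> v (ev (fps_shift N f * g) x)" using ev_int[OF _ x] int0_def by blast
    then have "ereal (real N * r) \<le> v (x ^ N * ev (fps_shift N f * g) x)"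
      using v_mult_ge_right[OF _ v_power_ge[OF r(2)]] by (metis mult.commute)
    then show "ereal (real N * r) \<le> v ((\<Sum>i<N. f $ i * x ^ i) * ev g x - ev (f * g) x)"
      using split[of N] by simp
  qed
  moreover have "vtendsto v (\<lambda>N. (\<Sum>i<N. f $ i * x ^ i) * ev g x) (ev f x * ev g x)"
  proof (rule vtendstoI_linear[OF r(1)])
    fix N
    have "0 \<le> v (ev g x)" using ev_int[OF g x] int0_def by blast
    then have "ereal (real N * r) \<le> v (ev g x * (ev f x - (\<Sum>i<N. f $ i * x ^ i)))"
      using v_mult_ge_right[OF _ ev_approx[OF f r]] by blast
    then show "ereal (real N * r) \<le> v ((\<Sum>i<N. f $ i * x ^ i) * ev g x - ev f x * ev g x)"
      by (subst v_diff_commute) (simp add: algebra_simps)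
  qed
  ultimately show ?thesis by (rule vtendsto_unique)
qed

lemma ev_hom: "0 < v x \<Longrightarrow> hom_pred int1 (\<lambda>f. ev f x)"
  by unfold_locales (auto simp: ev_add ev_mult)

end

section \<open>Evaluation in several variables and formal substitution\<close>

lemma fps_sum_nth3: "(\<Sum>i\<in>A. f i) $ a $ b $ c = (\<Sum>i\<in>A. f i $ a $ b $ c)"
  by (simp add: fps_sum_nth)

text \<open>The filtration by total degree, in which truncation errors of substitutions are
  measured.\<close>

definition low :: "nat \<Rightarrow> 'k::field fps3 \<Rightarrow> bool" where
  "low m A \<longleftrightarrow> (\<forall>a b c. a + b + c < m \<longrightarrow> A $ a $ b $ c = 0)"

lemma low_mult: assumes "low m A" "low n B" shows "low (m + n) (A * B)"
  unfolding low_def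
proof (intro allI impI)
  fix a b c assume abc: "a + b + c < m + n"
  have "A $ i $ j $ k * B $ (a - i) $ (b - j) $ (c - k) = 0"
    if "i \<le> a" "j \<le> b" "k \<le> c" for i j k
  proof (cases "i + j + k < m")
    case False
    then have "(a - i) + (b - j) + (c - k) < n" using abc that by linarith
    then show ?thesis using assms(2) by (simp add: low_def)
  qed (use assms(1) in \<open>simp add: low_def\<close>)
  then show "(A * B) $ a $ b $ c = 0"
    by (simp add: fps_mult_nth fps_sum_nth) (auto intro!: sum.neutral)
qed

lemma low_power: "low 1 A \<Longrightarrow> low n (A ^ n)"
proof (induction n)
  case (Suc n)
  then show ?case using low_mult[of 1 A n "A ^ n"] by simp
qed (simp add: low_def)

lemma low_0: "low m 0"
  by (simp add: low_def)

lemma low_X: "low 1 X1" "low 1 X2" "low 1 X3"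
  by (simp_all add: low_def X1_def X2_def X3_def)

lemma low_subst2: "G $ 0 $ 0 = 0 \<Longrightarrow> low 1 (subst2 G A B)"
  by (auto simp: low_def subst2_def)

text \<open>A one-variable series is a two-variable series that is constant in the second variable.
  Substituting 0 there leaves only the terms with \<open>j = 0\<close>, as
  \<open>0 ^ 0 = 1\<close>.\<close>

lemma subst1_conv_subst2: "subst1 f A = subst2 (fps_map fps_const f) A 0"
proof -
  have "(\<Sum>j\<le>n. fps_const (f $ i) $ j * (A ^ i * 0 ^ j) $ a $ b $ c) = f $ i * (A ^ i) $ a $ b $ c"
    for i n a b c by (subst sum.remove[of _ 0]) (auto intro!: sum.neutral)
  then show ?thesis by (simp add: subst1_def subst2_def fps_map_def)
qed

definition const3 :: "'k::field \<Rightarrow> 'k fps3" where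
  "const3 g = fps_const (fps_const (fps_const g))"

lemma const3_mult_nth: "(const3 g * A) $ a $ b $ c = g * A $ a $ b $ c"
  by (simp add: const3_def)

context valued_field
begin

definition ev2 :: "'k \<Rightarrow> 'k \<Rightarrow> 'k fps fps \<Rightarrow> 'k" where
  "ev2 x y f = ev (fps_map (\<lambda>g. ev g y) f) x"

definition ev3 :: "'k \<Rightarrow> 'k \<Rightarrow> 'k \<Rightarrow> 'k fps3 \<Rightarrow> 'k" where
  "ev3 x y z A = ev (fps_map (ev2 y z) A) x"

lemma int1_map_ev: "0 < v y \<Longrightarrow> int2 f \<Longrightarrow> int1 (fps_map (\<lambda>g. ev g y) f)"
  using ev_int by (simp add: fps_map_def fps_all_def)

lemma ev2_int: "0 < v x \<Longrightarrow> 0 < v y \<Longrightarrow> int2 f \<Longrightarrow> int0 (ev2 x y f)"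
  using int1_map_ev ev_int by (simp add: ev2_def)

lemma int1_map_ev2: "0 < v y \<Longrightarrow> 0 < v z \<Longrightarrow> int3 f \<Longrightarrow> int1 (fps_map (ev2 y z) f)"
  using ev2_int by (simp add: fps_map_def fps_all_def)

lemma ev2_hom: assumes "0 < v x" "0 < v y" shows "hom_pred int2 (ev2 x y)"
proof -
  interpret hom_pred int2 "fps_map (\<lambda>g. ev g y)" by (rule hom_pred.fps_map[OF ev_hom[OF assms(2)]])
  show ?thesis unfolding ev2_def
    by (rule comp[OF ev_hom[OF assms(1)]]) (rule int1_map_ev[OF assms(2)])
qed

lemma ev3_hom: assumes "0 < v x" "0 < v y" "0 < v z" shows "hom_pred int3 (ev3 x y z)"
proof -
  interpret hom_pred int3 "fps_map (ev2 y z)" by (rule hom_pred.fps_map[OF ev2_hom[OF assms(2,3)]])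
  show ?thesis unfolding ev3_def
    by (rule comp[OF ev_hom[OF assms(1)]]) (rule int1_map_ev2[OF assms(2,3)])
qed

text \<open>Here \<open>k\<close> is the degree already used up by the outer variables. The
  difference is taken in the reals, so that for \<open>k > m\<close> the bound is negative and still
  correct.\<close>

lemma ev_low:
  assumes f: "int1 f" and r: "0 < r" "ereal r \<le> v x" and low: "\<And>i. k + i < m \<Longrightarrow> f $ i = 0"
  shows "ereal ((real m - real k) * r) \<le> v (ev f x)"
proof (rule ev_ge[OF f])
  show "0 < v x" using r by (meson ereal_less(2) less_le_trans)
  fix i
  show "ereal ((real m - real k) * r) \<le> v (f $ i * x ^ i)"
  proof (cases "k + i < m")
    case False
    then have "(real m - real k) * r \<le> real i * r" using r(1) by (intro mult_right_mono) auto
    then show ?thesis using term_ge[OF f r(2), of i] by (meson ereal_less_eq(3) order_trans)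
  qed (simp add: low)
qed

lemma ev2_low:
  assumes f: "int2 f" and r: "0 < r" "ereal r \<le> v x" "ereal r \<le> v y"
    and low: "\<And>i j. k + i + j < m \<Longrightarrow> f $ i $ j = 0"
  shows "ereal ((real m - real k) * r) \<le> v (ev2 x y f)"
  unfolding ev2_def
proof (rule ev_ge)
  show x: "0 < v x" using r by (meson ereal_less(2) less_le_trans)
  have y: "0 < v y" using r by (meson ereal_less(2) less_le_trans)
  show "int1 (fps_map (\<lambda>g. ev g y) f)" using int1_map_ev[OF y f] .
  fix i
  have "ereal ((real m - real (k + i)) * r + real i * r) \<le> v (ev (f $ i) y * x ^ i)"
    by (rule v_mult_ge[OF ev_low[OF _ r(1,3)] v_power_ge[OF r(2)]])
      (use f low in \<open>auto simp: fps_all_def\<close>)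
  then show "ereal ((real m - real k) * r) \<le> v (fps_map (\<lambda>g. ev g y) f $ i * x ^ i)"
    by (simp add: fps_map_def algebra_simps)
qed

lemma ev3_low:
  assumes f: "int3 f" and r: "0 < r" "ereal r \<le> v x" "ereal r \<le> v y" "ereal r \<le> v z"
    and low: "low m f"
  shows "ereal (real m * r) \<le> v (ev3 x y z f)"
  unfolding ev3_def
proof (rule ev_ge)
  show x: "0 < v x" using r by (meson ereal_less(2) less_le_trans)
  have yz: "0 < v y" "0 < v z" using r by (meson ereal_less(2) less_le_trans)+
  show "int1 (fps_map (ev2 y z) f)" using int1_map_ev2[OF yz f] .
  fix i
  have "ereal ((real m - real i) * r + real i * r) \<le> v (ev2 y z (f $ i) * x ^ i)"
    by (rule v_mult_ge[OF ev2_low[OF _ r(1,3,4)] v_power_ge[OF r(2)]])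
      (use f low in \<open>auto simp: fps_all_def low_def\<close>)
  then show "ereal (real m * r) \<le> v (fps_map (ev2 y z) f $ i * x ^ i)"
    by (simp add: fps_map_def algebra_simps)
qed

text \<open>Links the square partial sums of \<open>eval2\<close> to iterated evaluation: cutting
  off the inner and the outer series each costs an error of valuation at least
  \<open>N r\<close>.\<close>

lemma ev2_approx:
  assumes f: "int2 f" and r: "0 < r" "ereal r \<le> v x" "ereal r \<le> v y"
  shows "ereal (real N * r) \<le> v ((\<Sum>i<N. \<Sum>j<N. f $ i $ j * x ^ i * y ^ j) - ev2 x y f)"
proof -
  have y: "0 < v y" and x: "0 < v x" using r by (meson ereal_less(2) less_le_trans)+
  let ?S = "\<Sum>i<N. ev (f $ i) y * x ^ i"
  have fi: "int1 (f $ i)" for i using f by (simp add: fps_all_def)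
  have 1: "ereal (real N * r) \<le> v (?S - ev2 x y f)"
    using ev_approx[OF int1_map_ev[OF y f] r(1,2), of N]
    by (subst v_diff_commute) (simp add: ev2_def fps_map_def)
  have "ereal (real N * r) \<le> v (\<Sum>i<N. x ^ i * (ev (f $ i) y - (\<Sum>j<N. f $ i $ j * y ^ j)))"
    using ev_approx[OF fi r(1,3)] x by (intro v_sum_ge v_mult_ge_right v_power_nonneg) auto
  also have "(\<Sum>i<N. x ^ i * (ev (f $ i) y - (\<Sum>j<N. f $ i $ j * y ^ j)))
      = ?S - (\<Sum>i<N. \<Sum>j<N. f $ i $ j * x ^ i * y ^ j)"
    by (simp add: right_diff_distrib sum_subtractf sum_distrib_left mult_ac)
  finally have "ereal (real N * r) \<le> v ((?S - ev2 x y f) - (?S - (\<Sum>i<N. \<Sum>j<N. f $ i $ j * x ^ i * y ^ j)))"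
    by (rule v_diff_ge[OF 1])
  then show ?thesis by simp
qed

lemma v_pos_real2:
  assumes "0 < v x" "0 < v y" obtains r :: real where "0 < r" "ereal r \<le> v x" "ereal r \<le> v y"
proof -
  obtain r s :: real where "0 < r" "ereal r \<le> v x" "0 < s" "ereal s \<le> v y"
    using assms v_pos_real by metis
  then show ?thesis
    by (intro that[of "min r s"]) (auto simp: min_le_iff_disj intro: order_trans[of _ "ereal r"] order_trans[of _ "ereal s"])
qed

lemma v_pos_real3:
  assumes "0 < v x" "0 < v y" "0 < v z"
  obtains r :: real where "0 < r" "ereal r \<le> v x" "ereal r \<le> v y" "ereal r \<le> v z"
proof -
  obtain r s :: real where "0 < r" "ereal r \<le> v x" "ereal r \<le> v y" "0 < s" "ereal s \<le> v z"
    using assms v_pos_real v_pos_real2 by metis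
  then show ?thesis
    by (intro that[of "min r s"]) (auto simp: min_le_iff_disj intro: order_trans[of _ "ereal r"] order_trans[of _ "ereal s"])
qed

lemma eval2_eq_ev2: assumes f: "int2 f" and x: "0 < v x" and y: "0 < v y"
  shows "eval2 v f x y = ev2 x y f"
proof -
  obtain r where "0 < r" "ereal r \<le> v x" "ereal r \<le> v y" using v_pos_real2[OF x y] by blast
  then show ?thesis unfolding eval2_def using ev2_approx[OF f]
    by (intro vlim_eq vtendstoI_linear[of r]) auto
qed

lemma v_eqI_linear: assumes "0 < r" "\<And>N::nat. ereal (real N * r) \<le> v (x - y)" shows "x = y"
proof (rule v_eqI)
  fix C
  obtain N where "\<And>n. N \<le> n \<Longrightarrow> C \<le> real n * r" using archimedean_bound[OF assms(1)] by blast
  then show "ereal C \<le> v (x - y)" using assms(2)[of N] by (meson ereal_less_eq(3) order_refl order_trans)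
qed

lemma int3_const3: "int0 c \<Longrightarrow> int3 (const3 c)"
  by (auto simp: const3_def fps_all_def i0.I_0 int0_def)

lemma int3_X: "int3 X1" "int3 X2" "int3 X3"
  by (auto simp: X1_def X2_def X3_def fps_all_def int0_def fps_X_def)

lemma int3_subst2: assumes "int2 G" "int3 A" "int3 B" shows "int3 (subst2 G A B)"
proof -
  have "int3 (A ^ i * B ^ j)" for i j using assms by (intro i3.I_mult i3.I_power)
  then show ?thesis using assms(1)
    by (auto simp: fps_all_def subst2_def intro!: i0.I_sum i0.I_mult)
qed

lemma ev3_const3: "ev3 x y z (const3 c) = c"
proof -
  have "ev2 y z (fps_const (fps_const a)) = a" "ev2 y z 0 = 0" for a
    using fps_map_const[of "\<lambda>g. ev g z" 0] by (simp_all add: ev2_def fps_map_const)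
  then show ?thesis by (simp add: ev3_def const3_def fps_map_const)
qed

lemma ev3_X: assumes "0 < v x" "0 < v y" "0 < v z"
  shows "ev3 x y z X1 = x" "ev3 x y z X2 = y" "ev3 x y z X3 = z"
proof -
  interpret h: hom_pred int2 "ev2 y z" by (rule ev2_hom[OF assms(2,3)])
  interpret g: hom_pred int1 "\<lambda>g. ev g z" by (rule ev_hom[OF assms(3)])
  have y: "ev2 y z fps_X = y" "ev2 y z (fps_const fps_X) = z"
    unfolding ev2_def using assms by (simp_all add: fps_map_const fps_map_X)
  then show "ev3 x y z X1 = x" "ev3 x y z X2 = y" "ev3 x y z X3 = z"
    unfolding ev3_def X1_def X2_def X3_def using assms
    by (simp_all add: fps_map_const fps_map_X h.h_0 h.h_1)
qed

text \<open>This turns formal identities into identities between points. The polynomial truncation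
  \<open>P\<close> agrees with the substitution below total degree \<open>N\<close>, so after
  evaluation both discrepancies have valuation at least \<open>N r\<close>, for every
  \<open>N\<close>.\<close>

lemma ev3_subst2:
  assumes G: "int2 G" and A: "int3 A" "low 1 A" and B: "int3 B" "low 1 B"
    and xyz: "0 < v x" "0 < v y" "0 < v z"
  shows "ev3 x y z (subst2 G A B) = eval2 v G (ev3 x y z A) (ev3 x y z B)"
proof -
  interpret h: hom_pred int3 "ev3 x y z" by (rule ev3_hom[OF xyz])
  obtain r where r: "0 < r" "ereal r \<le> v x" "ereal r \<le> v y" "ereal r \<le> v z"
    using v_pos_real3[OF xyz] by blast
  define \<alpha> \<beta> where "\<alpha> = ev3 x y z A" and "\<beta> = ev3 x y z B"
  have ab: "ereal r \<le> v \<alpha>" "ereal r \<le> v \<beta>"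
    unfolding \<alpha>_def \<beta>_def using ev3_low[OF _ r] A B by fastforce+
  then have ab0: "0 < v \<alpha>" "0 < v \<beta>" using r by (meson ereal_less(2) less_le_trans)+
  have "ev3 x y z (subst2 G A B) = ev2 \<alpha> \<beta> G"
  proof (rule v_eqI_linear[OF r(1)])
    fix N
    define P where "P = (\<Sum>i<N. \<Sum>j<N. const3 (G $ i $ j) * (A ^ i * B ^ j))"
    have G0: "int0 (G $ i $ j)" for i j using G by (simp add: fps_all_def)
    have iterm: "int3 (const3 (G $ i $ j) * (A ^ i * B ^ j))" for i j
      using G0 A(1) B(1) int3_const3 i3.I_mult i3.I_power by simp
    have iP: "int3 P" unfolding P_def by (intro i3.I_sum iterm)
    have "ev3 x y z P = (\<Sum>i<N. \<Sum>j<N. G $ i $ j * \<alpha> ^ i * \<beta> ^ j)"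
      unfolding P_def \<alpha>_def \<beta>_def using A(1) B(1) G0
      by (simp add: h.h_sum iterm i3.I_sum h.h_mult h.h_power int3_const3 i3.I_mult i3.I_power
          ev3_const3 mult.assoc)
    then have 1: "ereal (real N * r) \<le> v (ev3 x y z P - ev2 \<alpha> \<beta> G)"
      using ev2_approx[OF G r(1) ab, of N] by simp
    have "low N (subst2 G A B - P)"
      unfolding low_def
    proof (intro allI impI)
      fix a b c assume abc: "a + b + c < N"
      have zero: "(A ^ i * B ^ j) $ a $ b $ c = 0" if "a + b + c < i + j" for i j
        using low_mult[OF low_power[OF A(2)] low_power[OF B(2)], of i j] that by (simp add: low_def)
      have "P $ a $ b $ c = (\<Sum>i<N. \<Sum>j<N. G $ i $ j * (A ^ i * B ^ j) $ a $ b $ c)"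
        unfolding P_def by (simp only: fps_sum_nth3 const3_mult_nth)
      also have "\<dots> = (\<Sum>i\<le>a+b+c. \<Sum>j<N. G $ i $ j * (A ^ i * B ^ j) $ a $ b $ c)"
        using abc zero by (intro sum.mono_neutral_right) (auto intro!: sum.neutral)
      also have "\<dots> = (\<Sum>i\<le>a+b+c. \<Sum>j\<le>a+b+c. G $ i $ j * (A ^ i * B ^ j) $ a $ b $ c)"
        using abc zero by (intro sum.cong sum.mono_neutral_right) auto
      finally show "(subst2 G A B - P) $ a $ b $ c = 0" by (simp add: subst2_def)
    qed
    then have "ereal (real N * r) \<le> v (ev3 x y z (subst2 G A B - P))"
      using ev3_low[OF i3.I_diff[OF int3_subst2[OF G A(1) B(1)] iP] r] by blast
    then have "ereal (real N * r) \<le> v (ev3 x y z (subst2 G A B) - ev3 x y z P)"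
      by (simp add: h.h_diff int3_subst2[OF G A(1) B(1)] iP)
    then have "ereal (real N * r) \<le> v ((ev3 x y z (subst2 G A B) - ev3 x y z P) + (ev3 x y z P - ev2 \<alpha> \<beta> G))"
      using 1 by (rule v_add_ge)
    then show "ereal (real N * r) \<le> v (ev3 x y z (subst2 G A B) - ev2 \<alpha> \<beta> G)" by simp
  qed
  then show ?thesis using eval2_eq_ev2[OF G ab0] by (simp add: \<alpha>_def \<beta>_def)
qed

lemma int2_map_const: "int1 f \<Longrightarrow> int2 (fps_map fps_const f)"
  by (auto simp: fps_all_def fps_map_def int0_def)

lemma ev3_subst1:
  assumes f: "int1 f" and A: "int3 A" "low 1 A" and xyz: "0 < v x" "0 < v y" "0 < v z"
  shows "ev3 x y z (subst1 f A) = ev f (ev3 x y z A)"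
proof -
  interpret h: hom_pred int3 "ev3 x y z" by (rule ev3_hom[OF xyz])
  obtain r where r: "0 < r" "ereal r \<le> v x" "ereal r \<le> v y" "ereal r \<le> v z"
    using v_pos_real3[OF xyz] by blast
  have "ereal r \<le> v (ev3 x y z A)" using ev3_low[OF A(1) r A(2)] by simp
  then have a: "0 < v (ev3 x y z A)" using r by (meson ereal_less(2) less_le_trans)
  have "ev3 x y z (subst1 f A) = ev2 (ev3 x y z A) 0 (fps_map fps_const f)"
    unfolding subst1_conv_subst2
    using ev3_subst2[OF int2_map_const[OF f] A i3.I_0 low_0 xyz]
      eval2_eq_ev2[OF int2_map_const[OF f] a, of 0] by (simp add: h.h_0)
  also have "fps_map (\<lambda>g. ev g 0) (fps_map fps_const f) = f"
    by (simp add: fps_map_def fps_eq_iff)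
  then have "ev2 (ev3 x y z A) 0 (fps_map fps_const f) = ev f (ev3 x y z A)" by (simp add: ev2_def)
  finally show ?thesis .
qed

lemma int3_subst1: "int1 f \<Longrightarrow> int3 A \<Longrightarrow> int3 (subst1 f A)"
  unfolding subst1_conv_subst2 by (intro int3_subst2 int2_map_const i3.I_0)

lemma low_subst1: "f $ 0 = 0 \<Longrightarrow> low 1 (subst1 f A)"
  unfolding subst1_conv_subst2 by (intro low_subst2) (simp add: fps_map_def)

lemma ev_no_const_ge:
  assumes "int1 f" "f $ 0 = 0" "0 < v x" shows "v x \<le> v (ev f x)"
proof -
  have eq: "f = fps_X * fps_shift 1 f" using assms(2) by (auto simp: fps_eq_iff)
  have i: "int1 (fps_shift 1 f)" using assms(1) by (simp add: fps_all_def)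
  have "ev f x = x * ev (fps_shift 1 f) x" using ev_X_mult[OF i assms(3)] eq by metis
  moreover have "0 \<le> v (ev (fps_shift 1 f) x)" using ev_int[OF i assms(3)] by (simp add: int0_def)
  ultimately show ?thesis by (metis v_mult_ge_right mult.commute order_refl)
qed

lemma int1_compose: assumes "int1 f" "int1 g" shows "int1 (f oo g)"
proof -
  have "int1 (g ^ i)" for i using assms(2) by (rule i1.I_power)
  then show ?thesis using assms(1)
    by (auto simp: fps_all_def fps_compose_def intro!: i0.I_sum i0.I_mult)
qed

lemma ev_compose:
  assumes f: "int1 f" and g: "int1 g" "g $ 0 = 0" and x: "0 < v x"
  shows "ev (f oo g) x = ev f (ev g x)"
proof -
  interpret h: hom_pred int1 "\<lambda>f. ev f x" by (rule ev_hom[OF x])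
  obtain r where r: "0 < r" "ereal r \<le> v x" using v_pos_real[OF x] by blast
  define y where "y = ev g x"
  have y: "ereal r \<le> v y" using ev_no_const_ge[OF g x] r(2) by (simp add: y_def)
  show ?thesis
  proof (rule v_eqI_linear[OF r(1)])
    fix N
    define P where "P = (\<Sum>i<N. fps_const (f $ i) * g ^ i)"
    have f0: "int0 (f $ i)" for i using f by (simp add: fps_all_def)
    have ic: "int1 (fps_const (f $ i))" for i using f0[of i] by (auto simp: fps_all_def int0_def)
    have iterm: "int1 (fps_const (f $ i) * g ^ i)" for i
      using ic g(1) by (intro i1.I_mult i1.I_power)
    have iP: "int1 P" unfolding P_def by (intro i1.I_sum iterm)
    have "ev P x = (\<Sum>i<N. f $ i * y ^ i)"
      unfolding P_def y_def using g(1) ic by (simp add: h.h_sum iterm h.h_mult i1.I_power h.h_power)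
    then have 1: "ereal (real N * r) \<le> v (ev f y - ev P x)" using ev_approx[OF f r(1) y, of N] by simp
    have low: "((f oo g) - P) $ n = 0" if n: "0 + n < N" for n
    proof -
      have "P $ n = (\<Sum>i<N. f $ i * (g ^ i) $ n)" by (simp add: P_def fps_sum_nth)
      also have "\<dots> = (\<Sum>i=0..n. f $ i * (g ^ i) $ n)"
        using n startsby_zero_power_prefix[OF g(2)] by (intro sum.mono_neutral_right) auto
      finally show ?thesis by (simp add: fps_compose_def)
    qed
    have "ereal ((real N - real 0) * r) \<le> v (ev ((f oo g) - P) x)"
      by (rule ev_low[OF i1.I_diff[OF int1_compose[OF f g(1)] iP] r low])
    then have "ereal (real N * r) \<le> v (ev (f oo g) x - ev P x)"
      by (simp add: h.h_diff int1_compose[OF f g(1)] iP)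
    then have "ereal (real N * r) \<le> v ((ev (f oo g) x - ev P x) - (ev f y - ev P x))"
      using 1 by (rule v_diff_ge)
    then show "ereal (real N * r) \<le> v (ev (f oo g) x - ev f (ev g x))" by (simp add: y_def)
  qed
qed

end

section \<open>Newton polygons\<close>

lemma coeff_linear_mult:
  "coeff ([:a, b:] * q) k = a * coeff q k + (if k = 0 then 0 else b * coeff q (k - 1))"
  for a b :: "'a::comm_ring_1"
  by (cases k) (auto simp: mult_pCons_left coeff_pCons)

definition trunc_poly :: "nat \<Rightarrow> 'a::comm_ring_1 fps \<Rightarrow> 'a poly" where
  "trunc_poly M f = (\<Sum>i<M. monom (f $ i) i)"

lemma poly_trunc_poly: "poly (trunc_poly M f) x = (\<Sum>i<M. f $ i * x ^ i)"
  by (simp add: trunc_poly_def poly_sum poly_monom)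

lemma coeff_trunc_poly: "coeff (trunc_poly M f) i = (if i < M then f $ i else 0)"
  by (auto simp: trunc_poly_def coeff_sum)

context valued_field
begin

lemma v_add_gt: "C < v x \<Longrightarrow> C < v y \<Longrightarrow> C < v (x + y)"
  using v_add[of x y] by (metis min_less_iff_conj order_less_le_trans)

lemma v_add_eq_0: "v x = 0 \<Longrightarrow> 0 < v y \<Longrightarrow> v (x + y) = 0"
  using v_add_eq[of x y] by simp

lemma v_eq_of_close: "v x < v (y - x) \<Longrightarrow> v y = v x"
  using v_add_eq[of x "y - x"] by simp

lemma ev_lipschitz:
  assumes f: "int1 f" and x: "0 < v x" "0 < v y" and C: "ereal C \<le> v (x - y)"
  shows "ereal C \<le> v (ev f x - ev f y)"
proof -
  obtain r where r: "0 < r" "ereal r \<le> v x" "ereal r \<le> v y" using v_pos_real2[OF x] by blast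
  obtain N where N: "\<And>n. N \<le> n \<Longrightarrow> C \<le> real n * r" using archimedean_bound[OF r(1)] by blast
  have 1: "ereal C \<le> v (ev f u - (\<Sum>i<N. f $ i * u ^ i))" if "ereal r \<le> v u" for u
    using ev_approx[OF f r(1) that, of N] N[of N] by (meson ereal_less_eq(3) order_refl order_trans)
  have "ereal C \<le> v (\<Sum>i<N. f $ i * x ^ i - f $ i * y ^ i)"
  proof (rule v_sum_ge)
    fix i
    have eq: "f $ i * x ^ i - f $ i * y ^ i = (f $ i * (\<Sum>j<i. y ^ (i - Suc j) * x ^ j)) * (x - y)"
      using power_diff_sumr2[of x i y] by (simp add: right_diff_distrib[symmetric] mult_ac)
    have "0 \<le> v (f $ i * (\<Sum>j<i. y ^ (i - Suc j) * x ^ j))"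
      using x f by (intro v_mult_nonneg v_sum_ge v_power_nonneg int1_nth) auto
    then show "ereal C \<le> v (f $ i * x ^ i - f $ i * y ^ i)"
      unfolding eq using C by (rule v_mult_ge_right)
  qed
  from v_add_ge[OF this v_diff_ge[OF 1[OF r(2)] 1[OF r(3)]]]
  show ?thesis by (simp add: sum_subtractf)
qed

text \<open>Modulo the maximal ideal \<open>z\<close> vanishes, so the shift of the variable by
  \<open>z\<close> is the identity there.\<close>

lemma v_coeff_shift:
  assumes p: "\<And>k. 0 \<le> v (coeff p k)" and z: "0 < v z"
  shows "0 \<le> v (coeff (pcompose p [:z, 1:]) k) \<and> 0 < v (coeff (pcompose p [:z, 1:]) k - coeff p k)"
  using p
proof (induction p arbitrary: k)
  case (pCons a p)
  have p: "0 \<le> v (coeff p k)" for k using pCons.prems[of "Suc k"] by simp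
  have a: "0 \<le> v a" using pCons.prems[of 0] by simp
  let ?q = "pcompose p [:z, 1:]"
  note IH = pCons.IH[OF p]
  have z1: "0 < v (z * coeff ?q j)" for j using z IH[of j] by (simp add: v_mult add_pos_nonneg)
  show ?case
  proof (cases k)
    case 0
    then show ?thesis using z1[of 0] a
      by (simp add: pcompose_pCons coeff_linear_mult v_add_ge less_imp_le)
  next
    case (Suc j)
    have eq: "coeff (pcompose (pCons a p) [:z, 1:]) k = z * coeff ?q k + coeff ?q j"
      by (simp add: pcompose_pCons coeff_linear_mult Suc)
    have "0 < v (z * coeff ?q k + (coeff ?q j - coeff p j))" using z1 IH by (intro v_add_gt) auto
    then show ?thesis unfolding eq using Suc z1 IH
      by (auto simp: algebra_simps intro!: v_add_ge less_imp_le[OF z1])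
  qed
qed simp

end

locale ac_valued_field = valued_field v
  for v :: "'k::{alg_closed_field, field_char_0} \<Rightarrow> ereal"
begin

text \<open>If every root had valuation below \<open>\<mu>\<close>, then \<open>P / P(0)\<close>,
  the product of the factors \<open>1 - X / x\<close>, would have all its coefficients of degree
  \<open>k \<ge> 1\<close> of valuation greater than \<open>- k \<mu>\<close>, contrary to the
  hypothesis in degree \<open>i\<close>.\<close>

lemma poly_root_ge:
  assumes "1 \<le> i" "v (coeff P i) + ereal (real i * \<mu>) \<le> v (coeff P 0)"
  obtains r where "poly P r = 0" "ereal \<mu> \<le> v r"
proof (cases "coeff P 0 = 0")
  case True
  then show ?thesis using that[of 0] by (simp add: poly_0_coeff_0)
next
  case False
  then have "P \<noteq> 0" by auto
  then obtain A where A: "P = Polynomial.smult (lead_coeff P) (\<Prod>x\<in>#A. [:- x, 1:])"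
    using alg_closed_imp_factorization by blast
  have root: "poly P x = 0" if "x \<in># A" for x
    using that by (subst A) (auto simp: poly_prod_mset prod_mset_zero_iff)
  have "\<exists>r. poly P r = 0 \<and> ereal \<mu> \<le> v r"
  proof (rule ccontr)
    assume "\<not> ?thesis"
    then have less: "v x < ereal \<mu>" if "x \<in># A" for x using root that not_le by blast
    have nz: "x \<noteq> 0" if "x \<in># A" for x using less[OF that] by auto
    have "\<exists>c. (\<Prod>x\<in>#B. [:- x, 1:]) = Polynomial.smult c (\<Prod>x\<in>#B. [:1, - inverse x:]) \<and>
       coeff (\<Prod>x\<in>#B. [:1, - inverse x:]) 0 = 1 \<and>
       (\<forall>k\<ge>1. ereal (- (real k * \<mu>)) < v (coeff (\<Prod>x\<in>#B. [:1, - inverse x:]) k))"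
      if "B \<subseteq># A" for B
      using that
    proof (induction B)
      case (add x B)
      then have xA: "x \<in># A" and BA: "B \<subseteq># A" using mset_subset_eq_insertD by fastforce+
      define q where "q = (\<Prod>x\<in>#B. [:1, - inverse x:])"
      obtain c where c: "(\<Prod>x\<in>#B. [:- x, 1:]) = Polynomial.smult c q" and q0: "coeff q 0 = 1"
        and q: "\<And>k. 1 \<le> k \<Longrightarrow> ereal (- (real k * \<mu>)) < v (coeff q k)"
        using add.IH[OF BA] unfolding q_def by blast
      have q': "ereal (- (real k * \<mu>)) \<le> v (coeff q k)" for k
        using q[of k] q0 by (cases k) (auto simp flip: zero_ereal_def intro: less_imp_le)
      have "[:- x, 1:] = Polynomial.smult (- x) [:1, - inverse x:]" using nz[OF xA] by simp
      then have "[:- x, 1:] * Polynomial.smult c q = Polynomial.smult (- x * c) ([:1, - inverse x:] * q)"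
        by (metis mult_smult_left mult_smult_right smult_smult)
      then have 1: "(\<Prod>x\<in>#add_mset x B. [:- x, 1:]) = Polynomial.smult (- x * c) ([:1, - inverse x:] * q)"
        using c by (simp only: image_mset_add_mset prod_mset.add_mset)
      have "ereal (- (real k * \<mu>)) < v (coeff ([:1, - inverse x:] * q) k)" if k: "1 \<le> k" for k
      proof -
        obtain r where r: "v x = ereal r" using v_real nz[OF xA] by blast
        have "r < \<mu>" using less[OF xA] r by simp
        moreover have "v (- inverse x) = ereal (- r)" using v_inverse[OF nz[OF xA]] r by simp
        moreover have "ereal (- r - real (k - 1) * \<mu>) \<le> v (- inverse x * coeff q (k - 1))"
          using v_mult_ge[of "- r" "- inverse x" "- (real (k - 1) * \<mu>)"] q'[of "k - 1"] calculation(2) by simp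
        ultimately have "ereal (- (real k * \<mu>)) < v (- inverse x * coeff q (k - 1))"
          using k by (elim less_le_trans[rotated]) (simp add: of_nat_diff algebra_simps)
        then have "ereal (- (real k * \<mu>)) < v (1 * coeff q k + (- inverse x * coeff q (k - 1)))"
          using q[OF k] by (intro v_add_gt) simp_all
        then show ?thesis using k unfolding coeff_linear_mult by simp
      qed
      moreover have "coeff ([:1, - inverse x:] * q) 0 = 1" using q0 by (simp add: coeff_linear_mult)
      ultimately show ?case using 1 unfolding q_def image_mset_add_mset prod_mset.add_mset by blast
    qed (auto intro!: exI[of _ 1] simp: coeff_1)
    from this[of A] obtain c q where q: "(\<Prod>x\<in>#A. [:- x, 1:]) = Polynomial.smult c q" "coeff q 0 = 1"
      "\<And>k. 1 \<le> k \<Longrightarrow> ereal (- (real k * \<mu>)) < v (coeff q k)" by blast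
    have P: "P = Polynomial.smult (coeff P 0) q" using A q(1,2) by (metis coeff_smult mult.right_neutral smult_smult)
    obtain b where b: "v (coeff P 0) = ereal b" using v_real False by blast
    have "v (coeff P i) = ereal b + v (coeff q i)" using P b v_mult by (metis coeff_smult)
    then have "ereal b < v (coeff P i) + ereal (real i * \<mu>)"
      using q(3)[OF assms(1)] by (cases "v (coeff q i)") auto
    then show False using assms(2) b by simp
  qed
  then show ?thesis using that by blast
qed

end

text \<open>A power series over the valuation ring whose reduction modulo the maximal ideal has order
  exactly \<open>Q\<close>.\<close>

locale weierstrass_series = ac_valued_field v
  for v :: "'k::{alg_closed_field, field_char_0} \<Rightarrow> ereal" +
  fixes f :: "'k fps" and Q :: nat
  assumes int_f: "int1 f" and f_0: "f $ 0 = 0" and Q_pos: "0 < Q"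
    and f_Q: "v (f $ Q) = 0" and f_less: "i < Q \<Longrightarrow> 0 < v (f $ i)"
begin

lemma int_f_nth: "0 \<le> v (f $ i)"
  using int_f by (rule int1_nth)

text \<open>After the shift by \<open>z\<close> the coefficient of degree \<open>Q\<close> is still
  a unit, and the constant term is the defect at \<open>z\<close>. Hence some root lies within
  \<open>C / Q\<close> of \<open>z\<close>.\<close>

lemma trunc_near_root:
  assumes z: "0 < v z" and y: "0 < v y" and M: "Q < M"
    and C: "ereal C \<le> v ((\<Sum>i<M. f $ i * z ^ i) - y)"
  obtains z' where "(\<Sum>i<M. f $ i * z' ^ i) = y" "ereal (C / real Q) \<le> v (z' - z)"
proof -
  define p where "p = trunc_poly M f - [:y:]"
  have coeff_p: "coeff p k = (if k < M then f $ k else 0) - (if k = 0 then y else 0)" for k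
    by (simp add: p_def coeff_trunc_poly coeff_pCons split: nat.split)
  have int_p: "0 \<le> v (coeff p k)" for k
    unfolding coeff_p using y int_f_nth by (intro v_diff_ge) (auto intro: less_imp_le)
  have poly_p: "poly p x = (\<Sum>i<M. f $ i * x ^ i) - y" for x by (simp add: p_def poly_trunc_poly)
  define P where "P = pcompose p [:z, 1:]"
  have "0 < v (coeff P Q - coeff p Q)" unfolding P_def using v_coeff_shift[OF int_p z] by blast
  moreover have "v (coeff p Q) = 0" using coeff_p M Q_pos f_Q by simp
  ultimately have "v (coeff P Q) = 0" by (metis v_eq_of_close)
  moreover have "coeff P 0 = poly p z" by (simp add: P_def poly_pcompose flip: poly_0_coeff_0)
  ultimately have "v (coeff P Q) + ereal (real Q * (C / real Q)) \<le> v (coeff P 0)"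
    using C Q_pos by (simp add: poly_p)
  then obtain t where t: "poly P t = 0" "ereal (C / real Q) \<le> v t"
    using poly_root_ge[of Q P "C / real Q"] Q_pos by auto
  then show ?thesis using that[of "z + t"] by (simp add: P_def poly_pcompose poly_p)
qed

text \<open>An exact root of a truncation whose tail has valuation at least \<open>C + 1\<close>
  solves the equation of the series to precision \<open>C + 1\<close>.\<close>

lemma near_root_step:
  assumes z: "0 < v z" and y: "0 < v y" and C0: "0 < C" and C: "ereal C \<le> v (ev f z - y)"
  obtains z' where "0 < v z'" "ereal (C + 1) \<le> v (ev f z' - y)" "ereal (C / real Q) \<le> v (z' - z)"
proof -
  obtain s where s: "0 < s" "ereal s \<le> v z" using v_pos_real[OF z] by blast
  \<comment> \<open>A common lower bound for \<open>v z\<close> and for the displacement, so that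
    one truncation degree serves both \<open>z\<close> and \<open>z'\<close>.\<close>
  define r where "r = min s (C / real Q)"
  have r: "0 < r" "r \<le> s" "r \<le> C / real Q" using s C0 Q_pos by (auto simp: r_def)
  have rz: "ereal r \<le> v z" using r(2) s(2) by (meson ereal_less_eq(3) order_trans)
  obtain N where N: "\<And>n. N \<le> n \<Longrightarrow> C + 1 \<le> real n * r" using archimedean_bound[OF r(1)] by blast
  define M where "M = max N (Suc Q)"
  have M: "Q < M" "C + 1 \<le> real M * r" using N[of M] by (auto simp: M_def)
  have trunc: "ereal (C + 1) \<le> v (ev f u - (\<Sum>i<M. f $ i * u ^ i))" if "ereal r \<le> v u" for u
    using ev_approx[OF int_f r(1) that, of M] M(2) by (meson ereal_less_eq(3) order_trans)
  have "ereal C \<le> v (ev f z - (\<Sum>i<M. f $ i * z ^ i))"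
    by (rule order_trans[OF _ trunc[OF rz]]) simp
  from v_diff_ge[OF C this] have "ereal C \<le> v ((\<Sum>i<M. f $ i * z ^ i) - y)" by simp
  from trunc_near_root[OF z y M(1) this] obtain z' where
    z': "(\<Sum>i<M. f $ i * z' ^ i) = y" "ereal (C / real Q) \<le> v (z' - z)" by blast
  have "ereal r \<le> v (z' - z)" using z'(2) r(3) by (meson ereal_less_eq(3) order_trans)
  then have "ereal r \<le> v z'" using v_add_ge[of "ereal r" "z' - z" z] rz by simp
  moreover from this have "0 < v z'" using r(1) by (meson ereal_less(2) less_le_trans)
  ultimately show ?thesis using that[of z'] z' trunc[of z'] by simp
qed

text \<open>The steps have size \<open>(C + k) / Q\<close> and tend to infinity in valuation, so
  they add up to a limit. This replaces Hensel's lemma, which would ask for a unit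
  derivative.\<close>

lemma near_root:
  assumes z: "0 < v z" and y: "0 < v y" and C0: "0 < C" and C: "ereal C \<le> v (ev f z - y)"
  obtains z' where "ev f z' = y" "ereal (C / real Q) \<le> v (z' - z)"
proof -
  define good where "good k u \<longleftrightarrow> 0 < v u \<and> ereal (C + real k) \<le> v (ev f u - y)" for k u
  have "\<exists>u'. good (Suc k) u' \<and> ereal ((C + real k) / real Q) \<le> v (u' - u)" if "good k u" for k u
  proof -
    have "0 < C + real k" using C0 by simp
    with that obtain u' where "0 < v u'" "ereal (C + real k + 1) \<le> v (ev f u' - y)"
      "ereal ((C + real k) / real Q) \<le> v (u' - u)"
      using near_root_step[OF _ y] unfolding good_def by metis
    then show ?thesis by (auto simp: good_def algebra_simps)
  qed
  \<comment> \<open>The clause for \<open>k = 0\<close> pins the sequence to \<open>z\<close>, so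
    that the limit stays within \<open>C / Q\<close> of \<open>z\<close>.\<close>
  then obtain s where s': "\<And>k. good k (s k) \<and> (k = 0 \<longrightarrow> s k = z)"
    "\<And>k. ereal ((C + real k) / real Q) \<le> v (s (Suc k) - s k)"
    using dependent_nat_choice[where P = "\<lambda>k u. good k u \<and> (k = 0 \<longrightarrow> u = z)"
        and Q = "\<lambda>k u u'. ereal ((C + real k) / real Q) \<le> v (u' - u)"] z C
    unfolding good_def by (metis add_0_right of_nat_0 nat.distinct(1))
  then have s: "s 0 = z" "\<And>k. good k (s k)" "\<And>k. ereal ((C + real k) / real Q) \<le> v (s (Suc k) - s k)"
    by auto
  have Q1: "0 < 1 / real Q" using Q_pos by simp
  have "ereal (real k * (1 / real Q) + C / real Q) \<le> v (s (Suc k) - s k)" for k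
    using s(3)[of k] by (simp add: add_divide_distrib add.commute)
  from vlim_exists_linear[OF Q1 this] obtain l where
    l: "\<And>k. ereal (real k * (1 / real Q) + C / real Q) \<le> v (s k - l)" by blast
  have 0: "ereal (C / real Q) \<le> v (l - z)" using l[of 0] s(1) by (simp add: v_diff_commute)
  have "0 < ereal (C / real Q)" using C0 Q_pos by simp
  then have "0 < v (l - z)" using 0 by (rule less_le_trans)
  then have lpos: "0 < v l" using v_add_gt[of 0 "l - z" z] z by simp
  have "ev f l = y"
  proof (rule v_eqI_linear[OF Q1])
    fix k
    have "ereal (real k * (1 / real Q)) \<le> v (s k - l)"
      by (rule order_trans[OF _ l]) (use C0 Q_pos in simp)
    then have 1: "ereal (real k * (1 / real Q)) \<le> v (ev f (s k) - ev f l)"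
      using s(2)[of k] lpos by (intro ev_lipschitz[OF int_f]) (auto simp: good_def)
    have "real k * (1 / real Q) \<le> real k" using Q_pos by (intro mult_right_le_one_le) auto
    then have "ereal (real k * (1 / real Q)) \<le> ereal (C + real k)" using C0 by simp
    then have "ereal (real k * (1 / real Q)) \<le> v (ev f (s k) - y)"
      using s(2)[of k] unfolding good_def by (meson order_trans)
    from v_diff_ge[OF this 1] show "ereal (real k * (1 / real Q)) \<le> v (ev f l - y)" by simp
  qed
  then show ?thesis using that 0 by blast
qed

text \<open>The truncation keeps degree \<open>i\<close>, where the hypothesis is used, and degree
  \<open>Q\<close>, where the coefficient is a unit. Passing from its root to a root of the series
  changes it by valuation at least \<open>M \<mu> / Q\<close>, which is at least
  \<open>\<mu>\<close> as \<open>M > Q\<close>.\<close>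

lemma root_ge:
  assumes i: "1 \<le> i" and l: "0 < \<mu>" and y: "v (f $ i) + ereal (real i * \<mu>) \<le> v y"
  obtains z where "ev f z = y" "ereal \<mu> \<le> v z"
proof -
  define M where "M = Suc (max i Q)"
  have "0 < ereal (real i * \<mu>)" using i l by simp
  also have "\<dots> \<le> v (f $ i) + ereal (real i * \<mu>)" using int_f_nth[of i] by (simp add: add_increasing)
  finally have y0: "0 < v y" using y by (rule less_le_trans)
  define p where "p = trunc_poly M f - [:y:]"
  have "coeff p i = f $ i" "coeff p 0 = - y"
    using i f_0 by (auto simp: p_def M_def coeff_trunc_poly coeff_pCons split: nat.split)
  then obtain z where z: "poly p z = 0" "ereal \<mu> \<le> v z"
    using poly_root_ge[OF i, of p \<mu>] y by auto
  have z0: "0 < v z" using z(2) l by (meson ereal_less(2) less_le_trans)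
  have "(\<Sum>i<M. f $ i * z ^ i) = y" using z(1) by (simp add: p_def poly_trunc_poly)
  then have "ereal (real M * \<mu>) \<le> v (ev f z - y)" using ev_approx[OF int_f l z(2), of M] by simp
  moreover have "0 < real M * \<mu>" using l by (simp add: M_def)
  ultimately obtain z' where z': "ev f z' = y" "ereal (real M * \<mu> / real Q) \<le> v (z' - z)"
    using near_root[OF z0 y0] by metis
  have "real Q * \<mu> \<le> real M * \<mu>" using l by (intro mult_right_mono) (auto simp: M_def)
  then have "ereal \<mu> \<le> v (z' - z)" using z'(2) Q_pos by (intro order_trans[OF _ z'(2)]) (simp add: field_simps)
  then have "ereal \<mu> \<le> v z'" using v_add_ge[of "ereal \<mu>" "z' - z" z] z(2) by simp
  then show ?thesis using that z' by blast
qed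

end

locale weierstrass_series_bound = weierstrass_series +
  fixes \<epsilon> :: real
  assumes eps_pos: "0 < \<epsilon>" and zero_ge: "0 < v z \<Longrightarrow> ev f z = 0 \<Longrightarrow> ereal \<epsilon> \<le> v z"
begin

text \<open>A zero of the truncation of finite valuation \<open>r\<close> has a zero of the series
  within \<open>M r / Q > r\<close>, which therefore has the same valuation
  \<open>r\<close>.\<close>

lemma trunc_zero_ge:
  assumes z: "0 < v z" "(\<Sum>i<M. f $ i * z ^ i) = 0" and M: "Q < M" shows "ereal \<epsilon> \<le> v z"
proof (cases "z = 0")
  case False
  then obtain r where r: "v z = ereal r" using v_real by blast
  then have r0: "0 < r" using z(1) by simp
  have "ereal (real M * r) \<le> v (ev f z - 0)" using ev_approx[OF int_f r0, of z M] r z(2) by simp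
  moreover have "0 < real M * r" using r0 M by simp
  ultimately obtain z' where z': "ev f z' = 0" "ereal (real M * r / real Q) \<le> v (z' - z)"
    using near_root[OF z(1), of 0 "real M * r"] by auto
  have "real Q * r < real M * r" using r0 M by simp
  then have "ereal r < ereal (real M * r / real Q)" using Q_pos by (simp add: field_simps)
  then have "v z < v (z' - z)" unfolding r using z'(2) by (rule less_le_trans)
  then have "v z' = v z" by (rule v_eq_of_close)
  then show ?thesis using zero_ge[of z'] z z'(1) by simp
qed simp

text \<open>The polynomial is split into its roots of positive valuation, which all have valuation at
  least \<open>\<epsilon>\<close>, and the other ones, whose factors are normalised to have constant coefficient \<open>1\<close>.\<close>

lemma trunc_factor:
  assumes M: "Q < M"
  shows "\<And>i. i \<le> Q \<Longrightarrow> ereal (real (Q - i) * \<epsilon>) \<le> v (f $ i)"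
    and "card {z. 0 < v z \<and> (\<Sum>i<M. f $ i * z ^ i) = 0} \<le> Q"
    and "finite {z. 0 < v z \<and> (\<Sum>i<M. f $ i * z ^ i) = 0}"
proof -
  define P where "P = trunc_poly M f"
  have coeff_P: "coeff P k = (if k < M then f $ k else 0)" for k by (simp add: P_def coeff_trunc_poly)
  have "coeff P Q \<noteq> 0" using coeff_P M f_Q by auto
  then have P0: "P \<noteq> 0" by auto
  then obtain A where A: "P = Polynomial.smult (lead_coeff P) (\<Prod>x\<in>#A. [:- x, 1:])"
    using alg_closed_imp_factorization by blast
  have root: "poly P x = 0 \<longleftrightarrow> x \<in># A" for x
    using P0 by (subst A) (auto simp: poly_prod_mset prod_mset_zero_iff)
  have dich: "ereal \<epsilon> \<le> v x \<or> v x \<le> 0" if "x \<in># A" for x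
    using trunc_zero_ge[OF _ _ M, of x] root[of x] that by (auto simp: P_def poly_trunc_poly not_le)
  \<comment> \<open>The Newton polygon of \<open>g\<close> lies on or above the line of slope
    \<open>- \<epsilon>\<close> that ends at a unit coefficient in degree \<open>m\<close>. Each
    factor with a root of positive valuation raises \<open>m\<close> by one; the others preserve
    it.\<close>
  define good where "good m g \<longleftrightarrow> (\<forall>k. 0 \<le> v (coeff g k)) \<and> v (coeff g m) = 0 \<and>
      (\<forall>k<m. ereal (real (m - k) * \<epsilon>) \<le> v (coeff g k))" for m g
  define pos where "pos B = filter_mset (\<lambda>x. ereal \<epsilon> \<le> v x) B" for B
  have "\<exists>c g. (\<Prod>x\<in>#B. [:- x, 1:]) = Polynomial.smult c g \<and> good (size (pos B)) g" if "B \<subseteq># A" for B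
    using that
  proof (induction B)
    case empty
    show ?case by (intro exI[of _ 1] exI[of _ 1]) (auto simp: good_def pos_def coeff_1)
  next
    case (add x B)
    then have xA: "x \<in># A" and BA: "B \<subseteq># A" using mset_subset_eq_insertD by fastforce+
    obtain c g where c: "(\<Prod>x\<in>#B. [:- x, 1:]) = Polynomial.smult c g" and g: "good (size (pos B)) g"
      using add.IH[OF BA] by blast
    define m where "m = size (pos B)"
    have g0: "0 \<le> v (coeff g k)" and gm: "v (coeff g m) = 0"
      and gk: "k < m \<Longrightarrow> ereal (real (m - k) * \<epsilon>) \<le> v (coeff g k)" for k
      using g by (auto simp: good_def m_def)
    have gk': "k \<le> m \<Longrightarrow> ereal (real (m - k) * \<epsilon>) \<le> v (coeff g k)" for k
      using gk[of k] gm by (cases "k = m") (auto simp flip: zero_ereal_def)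
    show ?case
    proof (cases "ereal \<epsilon> \<le> v x")
      case True
      then have x0: "0 < v x" using eps_pos by (meson ereal_less(2) less_le_trans)
      let ?h = "[:- x, 1:] * g"
      have h: "coeff ?h k = (- x) * coeff g k + (if k = 0 then 0 else coeff g (k - 1))" for k
        by (simp only: coeff_linear_mult) simp
      have "good (Suc m) ?h" unfolding good_def h
      proof (intro conjI allI impI)
        fix k
        show "0 \<le> v ((- x) * coeff g k + (if k = 0 then 0 else coeff g (k - 1)))"
          using g0 x0 by (intro v_add_ge v_mult_nonneg) auto
        assume k: "k < Suc m"
        have "ereal (\<epsilon> + real (m - k) * \<epsilon>) \<le> v (- x * coeff g k)"
          using True gk'[of k] k by (intro v_mult_ge) auto
        moreover have "ereal (real (Suc m - k) * \<epsilon>) \<le> v (coeff g (k - 1))" if "k \<noteq> 0"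
          using gk[of "k - 1"] k that by simp
        ultimately show "ereal (real (Suc m - k) * \<epsilon>) \<le> v (- x * coeff g k + (if k = 0 then 0 else coeff g (k - 1)))"
          using k by (intro v_add_ge) (auto simp: Suc_diff_le algebra_simps)
      next
        have "0 < v (- x * coeff g (Suc m))" using x0 g0[of "Suc m"] by (simp add: v_mult add_pos_nonneg)
        then show "v ((- x) * coeff g (Suc m) + (if Suc m = 0 then 0 else coeff g (Suc m - 1))) = 0"
          using v_add_eq_0[OF gm, of "- x * coeff g (Suc m)"] by (simp add: add.commute)
      qed
      moreover have "size (pos (add_mset x B)) = Suc m" using True by (simp add: pos_def m_def)
      moreover have "(\<Prod>x\<in>#add_mset x B. [:- x, 1:]) = Polynomial.smult c ?h" using c by simp
      ultimately show ?thesis by metis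
    next
      case False
      then have x: "v x \<le> 0" "x \<noteq> 0" using dich[OF xA] by auto
      define s where "s = - inverse x"
      have s: "0 \<le> v s" using v_inverse[OF x(2)] x(1) by (simp add: s_def ereal_0_le_uminus_iff)
      let ?h = "[:1, s:] * g"
      have h: "coeff ?h k = coeff g k + (if k = 0 then 0 else s * coeff g (k - 1))" for k
        by (simp only: coeff_linear_mult) simp
      have ge: "ereal (real (m - (k - 1)) * \<epsilon>) \<le> v (s * coeff g (k - 1))" if "k \<noteq> 0" "k \<le> m" for k
        using s gk[of "k - 1"] that by (intro v_mult_ge_right) auto
      have "good m ?h" unfolding good_def h
      proof (intro conjI allI impI)
        fix k
        show "0 \<le> v (coeff g k + (if k = 0 then 0 else s * coeff g (k - 1)))"
          using g0 s by (intro v_add_ge) (auto intro: v_mult_nonneg)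
        assume k: "k < m"
        have "ereal (real (m - k) * \<epsilon>) \<le> v (s * coeff g (k - 1))" if "k \<noteq> 0"
          by (rule order_trans[OF _ ge[OF that]]) (use k eps_pos in \<open>auto intro!: mult_right_mono\<close>)
        then show "ereal (real (m - k) * \<epsilon>) \<le> v (coeff g k + (if k = 0 then 0 else s * coeff g (k - 1)))"
          using gk[OF k] by (intro v_add_ge) auto
      next
        have "0 < v (s * coeff g (m - 1))" if "m \<noteq> 0"
          by (rule less_le_trans[OF _ ge[OF that]]) (use that eps_pos in auto)
        then show "v (coeff g m + (if m = 0 then 0 else s * coeff g (m - 1))) = 0"
          using v_add_eq_0[OF gm] gm by auto
      qed
      moreover have "size (pos (add_mset x B)) = m" using False by (simp add: pos_def m_def)
      moreover have "[:- x, 1:] = Polynomial.smult (- x) [:1, s:]" using x(2) by (simp add: s_def)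
      then have "[:- x, 1:] * Polynomial.smult c g = Polynomial.smult (- x * c) ?h"
        by (metis mult_smult_left mult_smult_right smult_smult)
      then have "(\<Prod>x\<in>#add_mset x B. [:- x, 1:]) = Polynomial.smult (- x * c) ?h"
        using c by (simp only: image_mset_add_mset prod_mset.add_mset)
      ultimately show ?thesis by metis
    qed
  qed
  from this[of A] obtain c g where c: "(\<Prod>x\<in>#A. [:- x, 1:]) = Polynomial.smult c g" and g: "good (size (pos A)) g"
    by blast
  define m d where "m = size (pos A)" and "d = lead_coeff P * c"
  have "coeff P k = d * coeff g k" for k by (subst A) (simp add: c d_def)
  then have vP: "v (coeff P k) = v d + v (coeff g k)" for k by (simp add: v_mult)
  have g0: "0 \<le> v (coeff g k)" and gm: "v (coeff g m) = 0"
    and gk: "k < m \<Longrightarrow> ereal (real (m - k) * \<epsilon>) \<le> v (coeff g k)" for k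
    using g by (auto simp: good_def m_def)
  have PQ: "v (coeff P Q) = 0" using coeff_P M f_Q by simp
  have P_nonneg: "0 \<le> v (coeff P k)" for k using coeff_P int_f_nth by simp
  have d0: "v d = 0"
  proof (rule antisym)
    show "0 \<le> v d" using P_nonneg[of m] vP[of m] gm by simp
    show "v d \<le> 0" using PQ vP[of Q] g0[of Q] by (metis add_0 add.commute add_right_mono)
  qed
  \<comment> \<open>Both numbers are the order of the reduction of \<open>P\<close>:
    \<open>Q\<close> by hypothesis, \<open>m\<close> by the factorization.\<close>
  have mQ: "m = Q"
  proof (rule antisym)
    show "Q \<le> m"
    proof (rule ccontr)
      assume "\<not> Q \<le> m"
      then show False using f_less[of m] vP[of m] coeff_P[of m] gm d0 M by simp
    qed
    show "m \<le> Q"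
    proof (rule ccontr)
      assume "\<not> m \<le> Q"
      then have "0 < ereal (real (m - Q) * \<epsilon>)" using eps_pos by simp
      also have "\<dots> \<le> v (coeff g Q)" using gk[of Q] \<open>\<not> m \<le> Q\<close> by simp
      finally show False using vP[of Q] PQ d0 by simp
    qed
  qed
  show "ereal (real (Q - i) * \<epsilon>) \<le> v (f $ i)" if "i \<le> Q" for i
    using gk[of i] vP[of i] d0 mQ coeff_P[of i] that M f_Q
    by (cases "i = Q") (auto simp flip: zero_ereal_def)
  have sub: "{z. 0 < v z \<and> (\<Sum>i<M. f $ i * z ^ i) = 0} \<subseteq> set_mset (pos A)"
    using root trunc_zero_ge[OF _ _ M] by (auto simp: pos_def P_def poly_trunc_poly)
  show "finite {z. 0 < v z \<and> (\<Sum>i<M. f $ i * z ^ i) = 0}" using sub finite_subset finite_set_mset by blast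
  have "card {z. 0 < v z \<and> (\<Sum>i<M. f $ i * z ^ i) = 0} \<le> card (set_mset (pos A))"
    using sub by (intro card_mono) auto
  also have "\<dots> \<le> size (pos A)" unfolding size_multiset_overloaded_eq card_eq_sum
    by (intro sum_mono) (simp add: Suc_le_eq)
  finally show "card {z. 0 < v z \<and> (\<Sum>i<M. f $ i * z ^ i) = 0} \<le> Q" using mQ m_def by simp
qed

lemma coeff_ge: "i \<le> Q \<Longrightarrow> ereal (real (Q - i) * \<epsilon>) \<le> v (f $ i)"
  using trunc_factor(1)[of "Suc Q"] by simp

text \<open>Finitely many zeros of the series are approximated by zeros of one truncation more
  closely than they approximate each other. The approximation is then injective, and a truncation
  has at most \<open>Q\<close> zeros of positive valuation.\<close>

lemma finite_zeros: "finite {z. 0 < v z \<and> ev f z = 0}"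
proof (rule finite_if_finite_subsets_card_bdd[of _ Q, THEN conjunct1])
  fix S assume "S \<subseteq> {z. 0 < v z \<and> ev f z = 0}" "finite S"
  then have S: "0 < v z" "ev f z = 0" if "z \<in> S" for z using that by auto
  have "\<exists>D>0. \<forall>z\<in>S. \<forall>w\<in>S. z \<noteq> w \<longrightarrow> v (z - w) < ereal D"
  proof -
    let ?X = "(\<lambda>(z, w). real_of_ereal (v (z - w))) ` {(z, w) \<in> S \<times> S. z \<noteq> w}"
    have fin: "finite ?X"
      using \<open>finite S\<close> by (intro finite_imageI finite_subset[OF _ finite_cartesian_product]) auto
    define D where "D = Max (insert 0 ?X) + 1"
    have D0: "0 < D" using fin by (simp add: D_def add_nonneg_pos)
    have "v (z - w) < ereal D" if zw: "z \<in> S" "w \<in> S" "z \<noteq> w" for z w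
    proof -
      obtain r where r: "v (z - w) = ereal r" using v_real[of "z - w"] zw(3) by auto
      have "r \<in> ?X" using zw r by force
      then have "r \<le> Max (insert 0 ?X)" using fin by simp
      then show ?thesis using r by (simp add: D_def)
    qed
    with D0 show ?thesis by blast
  qed
  then obtain D where D: "0 < D" "\<And>z w. z \<in> S \<Longrightarrow> w \<in> S \<Longrightarrow> z \<noteq> w \<Longrightarrow> v (z - w) < ereal D" by blast
  have "ereal \<epsilon> \<le> v z" if "z \<in> S" for z using zero_ge S[OF that] by blast
  note e = eps_pos this
  obtain N where N: "\<And>n. N \<le> n \<Longrightarrow> real Q * D \<le> real n * \<epsilon>" using archimedean_bound[OF eps_pos] by blast
  define M where "M = max N (Suc Q)"
  have M: "Q < M" "real Q * D \<le> real M * \<epsilon>" using N[of M] by (auto simp: M_def)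
  have "\<exists>z'. (\<Sum>i<M. f $ i * z' ^ i) = 0 \<and> ereal D \<le> v (z' - z)" if z: "z \<in> S" for z
  proof -
    have "ereal (real M * \<epsilon>) \<le> v ((\<Sum>i<M. f $ i * z ^ i) - 0)"
      using ev_approx[OF int_f e(1) e(2)[OF z], of M] S[OF z] by simp
    then obtain z' where z': "(\<Sum>i<M. f $ i * z' ^ i) = 0" "ereal (real M * \<epsilon> / real Q) \<le> v (z' - z)"
      using trunc_near_root[OF S(1)[OF z] _ M(1), of 0 "real M * \<epsilon>"] by auto
    have "ereal D \<le> ereal (real M * \<epsilon> / real Q)" using M(2) Q_pos by (simp add: field_simps)
    then show ?thesis using z' order_trans by blast
  qed
  then obtain h where h: "\<And>z. z \<in> S \<Longrightarrow> (\<Sum>i<M. f $ i * h z ^ i) = 0"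
    "\<And>z. z \<in> S \<Longrightarrow> ereal D \<le> v (h z - z)" by metis
  have inj: "inj_on h S"
  proof (rule inj_onI, rule ccontr)
    fix z w assume zw: "z \<in> S" "w \<in> S" "h z = h w" "z \<noteq> w"
    have "ereal D \<le> v ((h w - w) - (h z - z))" by (rule v_diff_ge[OF h(2) h(2)]) (use zw in auto)
    then show False using D(2)[OF zw(1,2,4)] zw(3) by simp
  qed
  have "h ` S \<subseteq> {z. 0 < v z \<and> (\<Sum>i<M. f $ i * z ^ i) = 0}"
  proof
    fix u assume "u \<in> h ` S"
    then obtain z where z: "z \<in> S" "u = h z" by blast
    have "0 < v (h z - z)" using h(2)[OF z(1)] D(1) by (meson ereal_less(2) less_le_trans)
    then have "0 < v u" using v_add_gt[of 0 "h z - z" z] S(1)[OF z(1)] z(2) by simp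
    then show "u \<in> {z. 0 < v z \<and> (\<Sum>i<M. f $ i * z ^ i) = 0}" using h(1)[OF z(1)] z(2) by simp
  qed
  then have "card (h ` S) \<le> Q"
    using card_mono[OF trunc_factor(3)[OF M(1)]] trunc_factor(2)[OF M(1)] order_trans by blast
  then show "card S \<le> Q" using card_image[OF inj] by simp
qed

end

section \<open>The discretely valued field\<close>

locale dv_subfield = valued_field v for v :: "'k::field_char_0 \<Rightarrow> ereal" +
  fixes F :: "'k set" and \<pi> :: 'k
  assumes F_0 [simp]: "0 \<in> F" and F_1 [simp]: "1 \<in> F"
    and F_add: "a \<in> F \<Longrightarrow> b \<in> F \<Longrightarrow> a + b \<in> F" and F_mult: "a \<in> F \<Longrightarrow> b \<in> F \<Longrightarrow> a * b \<in> F"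
    and F_uminus: "a \<in> F \<Longrightarrow> - a \<in> F" and F_inverse: "a \<in> F \<Longrightarrow> inverse a \<in> F"
    and F_val: "a \<in> F \<Longrightarrow> a \<noteq> 0 \<Longrightarrow> \<exists>k::int. v a = ereal (of_int k)"
    and pi_F [simp]: "\<pi> \<in> F" and v_pi: "v \<pi> = 1"
    and F_closed: "(\<And>n. s n \<in> F) \<Longrightarrow> vtendsto v s l \<Longrightarrow> l \<in> F"
begin

lemma F_diff: "a \<in> F \<Longrightarrow> b \<in> F \<Longrightarrow> a - b \<in> F"
  using F_add[of a "- b"] F_uminus[of b] by simp

lemma F_sum: "(\<And>i. i \<in> A \<Longrightarrow> f i \<in> F) \<Longrightarrow> sum f A \<in> F"
  by (induction A rule: infinite_finite_induct) (auto intro: F_add)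

lemma F_power: "a \<in> F \<Longrightarrow> a ^ n \<in> F"
  by (induction n) (auto intro: F_mult)

lemma F_powi: "a \<in> F \<Longrightarrow> a powi k \<in> F"
  by (simp add: power_int_def F_power F_inverse)

lemma pi_nz [simp]: "\<pi> \<noteq> 0"
  using v_pi by auto

lemma v_pi_power: "v (\<pi> ^ n) = ereal (real n)"
  by (simp add: v_power v_pi)

lemma v_pi_powi: "v (\<pi> powi k) = ereal (of_int k)"
  by (cases "0 \<le> k") (auto simp: power_int_def v_pi_power v_inverse power_inverse)

abbreviation "\<O> \<equiv> int_ring v F"

lemma O_iff: "a \<in> \<O> \<longleftrightarrow> a \<in> F \<and> 0 \<le> v a"
  by (simp add: int_ring_def)

lemma O_F: "a \<in> \<O> \<Longrightarrow> a \<in> F"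
  by (simp add: O_iff)

lemma O_0 [simp]: "0 \<in> \<O>" and O_1 [simp]: "1 \<in> \<O>" and O_pi [simp]: "\<pi> \<in> \<O>"
  by (simp_all add: O_iff v_pi)

lemma O_add: "a \<in> \<O> \<Longrightarrow> b \<in> \<O> \<Longrightarrow> a + b \<in> \<O>" and O_mult: "a \<in> \<O> \<Longrightarrow> b \<in> \<O> \<Longrightarrow> a * b \<in> \<O>"
  and O_uminus: "a \<in> \<O> \<Longrightarrow> - a \<in> \<O>"
  by (auto simp: O_iff F_add F_mult F_uminus intro: v_add_ge v_mult_nonneg)

lemma O_power: "a \<in> \<O> \<Longrightarrow> a ^ n \<in> \<O>"
  by (auto simp: O_iff F_power intro: v_power_nonneg)

lemma O_sum: "(\<And>i. i \<in> A \<Longrightarrow> f i \<in> \<O>) \<Longrightarrow> sum f A \<in> \<O>"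
  by (auto simp: O_iff intro: F_sum v_sum_ge)

lemma pi_powi_mult_O: "a \<in> F \<Longrightarrow> ereal (of_int k) \<le> v a \<Longrightarrow> \<pi> powi (- k) * a \<in> \<O>"
  using v_mult_ge[of "- of_int k" "\<pi> powi (- k)" "of_int k" a]
  by (simp add: O_iff F_mult F_powi v_pi_powi zero_ereal_def)

lemma unit_decomp:
  assumes "a \<in> F" "a \<noteq> 0"
  obtains k u where "a = \<pi> powi k * u" "u \<in> F" "v u = 0" "v a = ereal (of_int k)"
proof -
  obtain k :: int where k: "v a = ereal (of_int k)" using F_val assms by blast
  have "v (\<pi> powi (- k) * a) = 0" using k by (simp add: v_mult v_pi_powi zero_ereal_def)
  moreover have "a = \<pi> powi k * (\<pi> powi (- k) * a)" by (simp add: power_int_minus)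
  ultimately show ?thesis using that k assms(1) F_mult F_powi pi_F by blast
qed

text \<open>Completeness of \<open>F\<close> makes digit expansions converge. The remainder is
  stated as an exact multiple of \<open>\<pi> ^ m\<close>, the form needed for congruences between
  lattice vectors.\<close>

lemma O_series:
  assumes b: "\<And>k::nat. b k \<in> \<O>"
  obtains c where "c \<in> \<O>" "\<And>m. \<exists>r\<in>\<O>. c = (\<Sum>k<m. \<pi> ^ k * b k) + \<pi> ^ m * r"
proof -
  define s where "s m = (\<Sum>k<m. \<pi> ^ k * b k)" for m
  have sO: "s m \<in> \<O>" for m unfolding s_def using b by (intro O_sum O_mult O_power) auto
  have step: "ereal (real m * 1 + 0) \<le> v (s (Suc m) - s m)" for m
    using v_mult_ge[of "real m" "\<pi> ^ m" 0 "b m"] b[of m] by (simp add: s_def v_pi_power O_iff zero_ereal_def)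
  obtain c where c: "\<And>m. ereal (real m * 1 + 0) \<le> v (s m - c)" "vtendsto v s c"
    using vlim_exists_linear[of 1 0 s] step by auto
  have cF: "c \<in> F" using F_closed[OF _ c(2)] sO O_F by blast
  have ex: "\<exists>r\<in>\<O>. c = (\<Sum>k<m. \<pi> ^ k * b k) + \<pi> ^ m * r" for m
  proof
    have "ereal (of_int (int m)) \<le> v (c - s m)" using c(1)[of m] by (simp add: v_diff_commute)
    then show "\<pi> powi (- int m) * (c - s m) \<in> \<O>"
      using cF sO O_F by (intro pi_powi_mult_O F_diff) auto
    show "c = (\<Sum>k<m. \<pi> ^ k * b k) + \<pi> ^ m * (\<pi> powi (- int m) * (c - s m))"
      by (simp add: power_int_minus s_def mult.assoc[symmetric])
  qed
  then have "c \<in> \<O>" using ex[of 0] by auto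
  then show ?thesis using that ex by blast
qed

end

text \<open>Completeness of \<open>F\<close>: the closure of the \<open>\<rat>\<close>-span of a finite subset of \<open>F\<close> stays in \<open>F\<close>,
  by induction on the subset. If \<open>b\<close> is not in the closure of the span \<open>W\<close>, then its distance to \<open>W\<close>
  is positive, so Cauchy sequences in \<open>W + \<rat> b\<close> have Cauchy coefficients of \<open>b\<close>.\<close>

context valued_field
begin

definition vclosure :: "'k set \<Rightarrow> 'k set" where
  "vclosure W = {x. \<forall>C::real. \<exists>w\<in>W. ereal C \<le> v (x - w)}"

definition rat_span :: "'k set \<Rightarrow> 'k set" where
  "rat_span B = {\<Sum>b\<in>B. of_rat (c b) * b |c. True}"

lemma rat_spanI: "(\<Sum>b\<in>B. of_rat (c b) * b) \<in> rat_span B"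
  by (auto simp: rat_span_def)

lemma rat_span_diff: assumes "x \<in> rat_span B" "y \<in> rat_span B" shows "x - y \<in> rat_span B"
proof -
  obtain c d where "x = (\<Sum>b\<in>B. of_rat (c b) * b)" "y = (\<Sum>b\<in>B. of_rat (d b) * b)"
    using assms by (auto simp: rat_span_def)
  then have "x - y = (\<Sum>b\<in>B. of_rat (c b - d b) * b)"
    by (simp add: of_rat_diff left_diff_distrib sum_subtractf)
  then show ?thesis using rat_spanI[of "\<lambda>b. c b - d b"] by simp
qed

lemma rat_span_scale: assumes "x \<in> rat_span B" shows "of_rat r * x \<in> rat_span B"
proof -
  obtain c where "x = (\<Sum>b\<in>B. of_rat (c b) * b)" using assms by (auto simp: rat_span_def)
  then have "of_rat r * x = (\<Sum>b\<in>B. of_rat (r * c b) * b)"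
    by (simp add: of_rat_mult sum_distrib_left mult.assoc)
  then show ?thesis using rat_spanI[of "\<lambda>b. r * c b"] by simp
qed

lemma rat_span_insert:
  assumes "finite B" "b \<notin> B" "x \<in> rat_span (insert b B)"
  obtains r w where "w \<in> rat_span B" "x = of_rat r * b + w"
  using assms rat_spanI by (auto simp: rat_span_def)

lemma vclosure_approx:
  assumes "x \<in> vclosure W" "\<And>w. w \<in> W \<Longrightarrow> \<exists>u\<in>W'. ereal C \<le> v (w - u)"
  shows "\<exists>u\<in>W'. ereal C \<le> v (x - u)"
proof -
  obtain w where w: "w \<in> W" "ereal C \<le> v (x - w)" using assms(1) by (auto simp: vclosure_def)
  obtain u where u: "u \<in> W'" "ereal C \<le> v (w - u)" using assms(2) w(1) by blast
  show ?thesis using v_add_ge[OF w(2) u(2)] u(1) by auto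
qed

lemma vclosure_rat_span:
  assumes "finite B" "B \<subseteq> F" "Qp_in v \<subseteq> F"
    and add: "\<And>a b. a \<in> F \<Longrightarrow> b \<in> F \<Longrightarrow> a + b \<in> F" and mult: "\<And>a b. a \<in> F \<Longrightarrow> b \<in> F \<Longrightarrow> a * b \<in> F"
    and "0 \<in> F"
  shows "vclosure (rat_span B) \<subseteq> F"
  using assms(1,2)
proof (induction B)
  case empty
  have "x = 0" if "x \<in> vclosure (rat_span {})" for x
    using that v_eqI[of x 0] by (auto simp: vclosure_def rat_span_def)
  then show ?case using \<open>0 \<in> F\<close> by blast
next
  case (insert b B)
  define W where "W = rat_span B"
  have IH: "vclosure W \<subseteq> F" and bF: "b \<in> F" using insert by (auto simp: W_def)
  show ?case
  proof (cases "b \<in> vclosure W")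
    case True
    have "vclosure (rat_span (insert b B)) \<subseteq> vclosure W"
    proof
      fix x assume x: "x \<in> vclosure (rat_span (insert b B))"
      have "\<exists>u\<in>W. ereal C \<le> v (w - u)" if w: "w \<in> rat_span (insert b B)" for w C
      proof -
        obtain r u where u: "u \<in> W" "w = of_rat r * b + u"
          using rat_span_insert[OF insert(1,2) w] W_def by blast
        show ?thesis
        proof (cases "r = 0")
          case False
          then obtain D where D: "v (of_rat r) = ereal D" using v_real[of "of_rat r"] by auto
          obtain t where t: "t \<in> W" "ereal (C - D) \<le> v (b - t)" using True by (auto simp: vclosure_def)
          have "ereal (D + (C - D)) \<le> v (of_rat r * (b - t))" using D t(2) by (intro v_mult_ge) auto
          moreover have "w - (u - of_rat (- r) * t) = of_rat r * (b - t)"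
            by (simp add: u(2) algebra_simps of_rat_minus)
          moreover have "u - of_rat (- r) * t \<in> W"
            using rat_span_diff rat_span_scale u(1) t(1) unfolding W_def by blast
          ultimately show ?thesis by (intro bexI[of _ "u - of_rat (- r) * t"]) simp_all
        qed (use u in \<open>auto intro!: bexI[of _ u]\<close>)
      qed
      then show "x \<in> vclosure W" using vclosure_approx[OF x] unfolding vclosure_def by blast
    qed
    then show ?thesis using IH by blast
  next
    case False
    then obtain D where D: "\<And>w. w \<in> W \<Longrightarrow> v (b - w) < ereal D" by (auto simp: vclosure_def not_le)
    \<comment> \<open>After division by \<open>r\<close> this is the separation of \<open>b\<close>
      from \<open>W\<close>: the valuation of a vector exceeds that of its coefficient at
      \<open>b\<close> by at most \<open>D\<close>. This makes the coefficients of a Cauchy sequence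
      Cauchy.\<close>
    have sep: "v (of_rat r * b + w) \<le> v (of_rat r) + ereal D" if w: "w \<in> W" for r w
    proof (cases "r = 0")
      case False
      have "of_rat (- inverse r) * w \<in> W" using rat_span_scale w unfolding W_def by blast
      then have "v (b - of_rat (- inverse r) * w) \<le> ereal D" using D less_imp_le by blast
      moreover have "of_rat r * b + w = of_rat r * (b - of_rat (- inverse r) * w)"
        using False by (simp add: algebra_simps of_rat_minus of_rat_inverse)
      ultimately show ?thesis by (simp add: v_mult add_left_mono)
    qed simp
    show ?thesis
    proof
      fix x assume x: "x \<in> vclosure (rat_span (insert b B))"
      have "\<exists>r w. w \<in> W \<and> ereal (real n) \<le> v (x - (of_rat r * b + w))" for n :: nat
      proof -
        obtain u where "u \<in> rat_span (insert b B)" "ereal (real n) \<le> v (x - u)"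
          using x by (auto simp: vclosure_def)
        then show ?thesis using rat_span_insert[OF insert(1,2)] unfolding W_def by metis
      qed
      then obtain r w where w: "\<And>n. w n \<in> W"
        and rw: "\<And>n::nat. ereal (real n) \<le> v (x - (of_rat (r n) * b + w n))" by metis
      have "ereal (real n * 1 + (- D)) \<le> v (of_rat (r (Suc n)) - of_rat (r n))" for n
      proof -
        have "ereal (real n) \<le> v (x - (of_rat (r (Suc n)) * b + w (Suc n)))"
          by (rule order_trans[OF _ rw]) simp
        from v_diff_ge[OF rw[of n] this]
        have "ereal (real n) \<le> v (of_rat (r (Suc n) - r n) * b + (w (Suc n) - w n))"
          by (simp add: algebra_simps of_rat_diff)
        also have "\<dots> \<le> v (of_rat (r (Suc n) - r n)) + ereal D"
          using rat_span_diff w unfolding W_def by (intro sep[unfolded W_def]) blast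
        finally show ?thesis
          by (cases "v (of_rat (r (Suc n) - r n))") (auto simp: of_rat_diff)
      qed
      then obtain g where g: "\<And>n. ereal (real n * 1 + (- D)) \<le> v (of_rat (r n) - g)"
        "vtendsto v (\<lambda>n. of_rat (r n)) g"
        using vlim_exists_linear[of 1 "- D" "\<lambda>n. of_rat (r n)"] by auto
      have gF: "g \<in> F" using g(2) assms(3) by (auto simp: Qp_in_def)
      have "x - g * b \<in> vclosure W" unfolding vclosure_def
      proof (intro CollectI allI)
        fix C :: real
        show "\<exists>u\<in>W. ereal C \<le> v (x - g * b - u)"
        proof (cases "b = 0")
          case True
          obtain n :: nat where "C \<le> real n" using real_arch_simple by blast
          then have "ereal C \<le> v (x - (of_rat (r n) * b + w n))"
            by (intro order_trans[OF _ rw]) simp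
          then have "ereal C \<le> v (x - g * b - w n)" using True by simp
          then show ?thesis using w by blast
        next
          case False
          obtain B0 where B0: "v b = ereal B0" using v_real[OF False] by blast
          obtain n :: nat where n: "max C (C + D - B0) \<le> real n" using real_arch_simple by blast
          have 1: "ereal C \<le> v (x - (of_rat (r n) * b + w n))"
            by (rule order_trans[OF _ rw]) (use n in simp)
          have "ereal ((real n * 1 + (- D)) + B0) \<le> v ((of_rat (r n) - g) * b)"
            using g(1) B0 by (intro v_mult_ge) auto
          then have 2: "ereal C \<le> v ((of_rat (r n) - g) * b)"
            by (rule order_trans[rotated]) (use n in simp)
          from v_add_ge[OF 1 2] have "ereal C \<le> v (x - g * b - w n)" by (simp add: algebra_simps)
          then show ?thesis using w by blast
        qed
      qed
      then have "x - g * b \<in> F" using IH by blast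
      then have "(x - g * b) + g * b \<in> F" using add mult gF bF by blast
      then show "x \<in> F" by simp
    qed
  qed
qed

text \<open>Approximating coefficients in \<open>Qp_in v\<close> by rationals puts \<open>F\<close>,
  and then every limit of elements of \<open>F\<close>, into the closure of the rational span of
  \<open>B\<close>.\<close>

lemma finite_ext_closed:
  assumes B: "finite B" "B \<subseteq> F" and Qp: "Qp_in v \<subseteq> F"
    and span: "\<And>x. x \<in> F \<Longrightarrow> \<exists>c. (\<forall>b\<in>B. c b \<in> Qp_in v) \<and> x = (\<Sum>b\<in>B. c b * b)"
    and add: "\<And>a b. a \<in> F \<Longrightarrow> b \<in> F \<Longrightarrow> a + b \<in> F" and mult: "\<And>a b. a \<in> F \<Longrightarrow> b \<in> F \<Longrightarrow> a * b \<in> F"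
    and "0 \<in> F" and s: "\<And>n. s n \<in> F" "vtendsto v s l"
  shows "l \<in> F"
proof -
  have F: "\<exists>u\<in>rat_span B. ereal C \<le> v (x - u)" if x: "x \<in> F" for x C
  proof -
    obtain c where c: "\<And>b. b \<in> B \<Longrightarrow> c b \<in> Qp_in v" "x = (\<Sum>b\<in>B. c b * b)" using span[OF x] by blast
    have "\<exists>r::rat. ereal C \<le> v ((c b - of_rat r) * b)" if b: "b \<in> B" for b
    proof (cases "b = 0")
      case False
      obtain B0 where B0: "v b = ereal B0" using v_real[OF False] by blast
      obtain q :: "nat \<Rightarrow> rat" where "vtendsto v (\<lambda>n. of_rat (q n)) (c b)"
        using c(1)[OF b] by (auto simp: Qp_in_def)
      then obtain n where "ereal (C - B0) \<le> v (of_rat (q n) - c b)" unfolding vtendsto_iff by blast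
      then have "ereal (C - B0) \<le> v (c b - of_rat (q n))" by (simp add: v_diff_commute)
      from v_mult_ge[OF this, of B0 b] show ?thesis using B0 by auto
    qed simp
    then obtain q where q: "\<And>b. b \<in> B \<Longrightarrow> ereal C \<le> v ((c b - of_rat (q b)) * b)" by metis
    have eq: "x - (\<Sum>b\<in>B. of_rat (q b) * b) = (\<Sum>b\<in>B. (c b - of_rat (q b)) * b)"
      by (simp add: c(2) left_diff_distrib sum_subtractf)
    have "ereal C \<le> v (x - (\<Sum>b\<in>B. of_rat (q b) * b))" unfolding eq using q by (rule v_sum_ge)
    then show ?thesis using rat_spanI by blast
  qed
  have "l \<in> vclosure F" unfolding vclosure_def
  proof (intro CollectI allI)
    fix C :: real
    obtain n where "ereal C \<le> v (s n - l)" using s(2) unfolding vtendsto_iff by blast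
    then show "\<exists>w\<in>F. ereal C \<le> v (l - w)" using s(1) by (auto simp: v_diff_commute)
  qed
  then have "l \<in> vclosure (rat_span B)" using vclosure_approx[of l F] F unfolding vclosure_def by blast
  then show ?thesis using vclosure_rat_span[OF B Qp add mult \<open>0 \<in> F\<close>] by blast
qed

end

lemma padic_setting_dv_subfield:
  assumes "padic_setting p v F \<pi>" shows "dv_subfield v F \<pi>"
proof -
  let ?R = "ring_of_type_algebra :: 'a ring"
  interpret R: field ?R by (rule field_from_type_algebra)
  have ps: "complete_valuation v" "subfield F ?R" "Qp_in v \<subseteq> F" "\<pi> \<in> F" "v \<pi> = 1"
    "\<And>x. x \<in> F \<Longrightarrow> x \<noteq> 0 \<Longrightarrow> \<exists>k::int. v x = ereal (of_int k)"
    using assms by (auto simp: padic_setting_def)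
  have "\<exists>B. finite B \<and> B \<subseteq> F \<and> (\<forall>x\<in>F. \<exists>c. (\<forall>b\<in>B. c b \<in> Qp_in v) \<and> x = (\<Sum>b\<in>B. c b * b))"
    using assms unfolding padic_setting_def by (elim conjE)
  then obtain B where B: "finite B" "B \<subseteq> F"
      "\<forall>x\<in>F. \<exists>c. (\<forall>b\<in>B. c b \<in> Qp_in v) \<and> x = (\<Sum>b\<in>B. c b * b)"
    by (elim exE conjE)
  interpret valued_field v by unfold_locales (rule ps(1))
  note sr = subringE[OF subfieldE(1)[OF ps(2)]]
  have ops: "monoid.mult ?R = (*)" "add ?R = (+)" "one ?R = 1" "zero ?R = 0" "carrier ?R = UNIV"
    by (simp_all add: ring_of_type_algebra_def)
  have F0: "0 \<in> F" and F1: "1 \<in> F" using sr(2,3) by (simp_all add: ops)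
  have add: "a + b \<in> F" and mult: "a * b \<in> F" if "a \<in> F" "b \<in> F" for a b
    using sr(6,7)[of a b] that by (simp_all add: ops)
  have minus: "- a \<in> F" if "a \<in> F" for a
  proof -
    have "a + (\<ominus>\<^bsub>?R\<^esub> a) = 0" using R.r_neg[of a] by (simp add: ops)
    then have "\<ominus>\<^bsub>?R\<^esub> a = - a" by (simp add: eq_neg_iff_add_eq_0 add.commute)
    then show ?thesis using sr(5)[OF that] by simp
  qed
  have inv: "inverse a \<in> F" if "a \<in> F" for a
  proof (cases "a = 0")
    case False
    then have a: "a \<in> F - {zero ?R}" using that by (simp add: ops)
    have "a * m_inv ?R a = 1" using R.subfield_m_inv(2)[OF ps(2) a] by (simp add: ops)
    then have "m_inv ?R a = inverse a" using False by (metis inverse_unique)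
    then show ?thesis using R.subfield_m_inv(1)[OF ps(2) a] by simp
  qed (simp add: F0)
  show ?thesis
  proof unfold_locales
    fix s l assume "\<And>n::nat. s n \<in> F" "vtendsto v s l"
    then show "l \<in> F"
      using finite_ext_closed[OF B(1,2) ps(3) B(3)[rule_format] add mult F0, of s l] by blast
  qed (use F0 F1 add mult minus inv ps(4-6) in auto)
qed

section \<open>Vector spaces over the discretely valued field\<close>

locale dv_vector_space = dv_subfield v F \<pi> + abelian_group M
  for v :: "'k::field_char_0 \<Rightarrow> ereal" and F :: "'k set" and \<pi> :: 'k
    and M :: "('k, 'a) module" (structure) +
  assumes smult_closed [simp]: "c \<in> F \<Longrightarrow> x \<in> carrier M \<Longrightarrow> c \<odot> x \<in> carrier M"
    and smult_add_right: "c \<in> F \<Longrightarrow> x \<in> carrier M \<Longrightarrow> y \<in> carrier M \<Longrightarrow> c \<odot> (x \<oplus> y) = c \<odot> x \<oplus> c \<odot> y"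
    and smult_add_left: "c \<in> F \<Longrightarrow> d \<in> F \<Longrightarrow> x \<in> carrier M \<Longrightarrow> (c + d) \<odot> x = c \<odot> x \<oplus> d \<odot> x"
    and smult_assoc: "c \<in> F \<Longrightarrow> d \<in> F \<Longrightarrow> x \<in> carrier M \<Longrightarrow> (c * d) \<odot> x = c \<odot> (d \<odot> x)"
    and smult_one [simp]: "x \<in> carrier M \<Longrightarrow> 1 \<odot> x = x"
begin

lemma smult_zero_left [simp]: assumes "x \<in> carrier M" shows "0 \<odot> x = \<zero>"
proof -
  have "0 \<odot> x \<oplus> 0 \<odot> x = 0 \<odot> x \<oplus> \<zero>" using smult_add_left[of 0 0 x] assms by simp
  then show ?thesis using assms by (subst (asm) add.l_cancel) auto
qed

lemma smult_zero_right [simp]: assumes "c \<in> F" shows "c \<odot> \<zero> = \<zero>"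
proof -
  have "c \<odot> \<zero> \<oplus> c \<odot> \<zero> = c \<odot> \<zero> \<oplus> \<zero>" using smult_add_right[of c \<zero> \<zero>] assms by simp
  then show ?thesis using assms by (subst (asm) add.l_cancel) auto
qed

lemma smult_uminus_left: assumes "c \<in> F" "x \<in> carrier M" shows "(- c) \<odot> x = \<ominus> (c \<odot> x)"
proof -
  have "(- c) \<odot> x \<oplus> c \<odot> x = \<zero>" using smult_add_left[of "- c" c x] assms F_uminus by simp
  then show ?thesis using minus_equality assms F_uminus by (metis smult_closed)
qed

lemma smult_cancel:
  assumes "c \<in> F" "c \<noteq> 0" "x \<in> carrier M" shows "inverse c \<odot> (c \<odot> x) = x" "c \<odot> (inverse c \<odot> x) = x"
  using assms smult_assoc[of "inverse c" c x] smult_assoc[of c "inverse c" x] F_inverse by auto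

abbreviation "lc d e c \<equiv> lin_comb M d e c"

lemma lc_0 [simp]: "lc 0 e c = \<zero>"
  by (simp add: lin_comb_def)

lemma lc_cong:
  assumes "\<And>i. i < d \<Longrightarrow> c i \<odot> e i = c' i \<odot> e' i" "\<And>i. i < d \<Longrightarrow> c i \<in> F" "\<And>i. i < d \<Longrightarrow> e i \<in> carrier M"
  shows "lc d e c = lc d e' c'"
  unfolding lin_comb_def using assms by (intro finsum_cong') (auto simp flip: assms(1))

lemma lc_closed [simp]:
  "\<forall>i<d. e i \<in> carrier M \<Longrightarrow> \<forall>i<d. c i \<in> F \<Longrightarrow> lc d e c \<in> carrier M"
  by (auto simp: lin_comb_def intro!: finsum_closed)

lemma lc_Suc [simp]:
  assumes "\<forall>i<Suc d. e i \<in> carrier M" "\<forall>i<Suc d. c i \<in> F"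
  shows "lc (Suc d) e c = lc d e c \<oplus> c d \<odot> e d"
proof -
  have "lc (Suc d) e c = c d \<odot> e d \<oplus> lc d e c"
    unfolding lin_comb_def lessThan_Suc using assms by (intro finsum_insert) auto
  then show ?thesis using assms a_comm by simp
qed

lemma lc_add:
  assumes "\<forall>i<d. e i \<in> carrier M" "\<forall>i<d. a i \<in> F" "\<forall>i<d. b i \<in> F"
  shows "lc d e (\<lambda>i. a i + b i) = lc d e a \<oplus> lc d e b"
proof -
  have "lc d e (\<lambda>i. a i + b i) = (\<Oplus>i\<in>{..<d}. a i \<odot> e i \<oplus> b i \<odot> e i)"
    unfolding lin_comb_def using assms by (intro finsum_cong') (auto simp: smult_add_left)
  also have "\<dots> = lc d e a \<oplus> lc d e b"
    unfolding lin_comb_def using assms by (intro finsum_addf) auto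
  finally show ?thesis .
qed

lemma lc_smult:
  assumes "k \<in> F" "\<forall>i<d. e i \<in> carrier M" "\<forall>i<d. c i \<in> F"
  shows "lc d e (\<lambda>i. k * c i) = k \<odot> lc d e c"
  using assms(2,3)
proof (induction d)
  case (Suc d)
  then have "lc (Suc d) e (\<lambda>i. k * c i) = lc d e (\<lambda>i. k * c i) \<oplus> (k * c d) \<odot> e d"
    using assms(1) F_mult by (intro lc_Suc) auto
  also have "\<dots> = k \<odot> lc d e c \<oplus> k \<odot> (c d \<odot> e d)" using Suc assms(1) by (simp add: smult_assoc)
  also have "\<dots> = k \<odot> (lc d e c \<oplus> c d \<odot> e d)"
    using Suc.prems assms(1) by (subst smult_add_right) auto
  finally show ?case using Suc.prems by simp
qed (use assms(1) in simp)

lemma lc_scaled: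
  assumes "\<forall>i<d. e i \<in> carrier M" "\<forall>i<d. c i \<in> F" "\<forall>i<d. s i \<in> F"
  shows "lc d (\<lambda>i. s i \<odot> e i) c = lc d e (\<lambda>i. c i * s i)"
  using assms by (intro lc_cong) (auto simp: smult_assoc)

lemma lc_zero: assumes "\<forall>i<d. e i \<in> carrier M" shows "lc d e (\<lambda>i. 0) = \<zero>"
  using assms by (induction d) auto

lemma lc_single:
  assumes "\<forall>i<d. e i \<in> carrier M" "c \<in> F" "j < d"
  shows "lc d e (\<lambda>i. if i = j then c else 0) = c \<odot> e j"
  using assms(1,3)
proof (induction d)
  case (Suc d)
  show ?case
  proof (cases "j = d")
    case True
    then have "lc d e (\<lambda>i. if i = j then c else 0) = lc d e (\<lambda>i. 0)"
      using Suc.prems assms(2) by (intro lc_cong) auto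
    then show ?thesis using Suc.prems assms(2) lc_zero[of d e] True by simp
  next
    case False
    then show ?thesis using Suc assms(2) by simp
  qed
qed simp

lemma lc_split:
  assumes "\<forall>i<d. e i \<in> carrier M" "\<forall>i<d. c i \<in> F"
  shows "lc d e c = lc d e (\<lambda>i. if P i then c i else 0) \<oplus> lc d e (\<lambda>i. if P i then 0 else c i)"
proof -
  have "lc d e c = lc d e (\<lambda>i. (if P i then c i else 0) + (if P i then 0 else c i))"
    using assms by (intro lc_cong) auto
  then show ?thesis using assms by (subst (asm) lc_add) auto
qed

subsection \<open>Lattices and homothety classes\<close>

definition submod :: "'a set \<Rightarrow> bool" where
  "submod L \<longleftrightarrow> L \<subseteq> carrier M \<and> \<zero> \<in> L \<and> (\<forall>x\<in>L. \<forall>y\<in>L. x \<oplus> y \<in> L) \<and> (\<forall>c\<in>\<O>. \<forall>x\<in>L. c \<odot> x \<in> L)"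

lemma submodD:
  assumes "submod L"
  shows "L \<subseteq> carrier M" "x \<in> L \<Longrightarrow> x \<in> carrier M" "\<zero> \<in> L" "x \<in> L \<Longrightarrow> y \<in> L \<Longrightarrow> x \<oplus> y \<in> L"
    "c \<in> \<O> \<Longrightarrow> x \<in> L \<Longrightarrow> c \<odot> x \<in> L"
  using assms by (auto simp: submod_def)

lemma submod_minus: assumes "submod L" "x \<in> L" "y \<in> L" shows "x \<ominus> y \<in> L"
proof -
  have "(- 1) \<odot> y \<in> L" using assms submodD(5) O_uminus by auto
  then have "\<ominus> y \<in> L" using smult_uminus_left[of 1 y] submodD(2)[OF assms(1,3)] by simp
  then show ?thesis unfolding a_minus_def using assms submodD(4) by blast
qed

abbreviation "hc \<Lambda> \<equiv> homothety_class F M \<Lambda>"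

abbreviation scale :: "'k \<Rightarrow> 'a set \<Rightarrow> 'a set" where "scale c \<Lambda> \<equiv> (\<lambda>x. c \<odot> x) ` \<Lambda>"

lemma scale_scale:
  "c \<in> F \<Longrightarrow> d \<in> F \<Longrightarrow> \<Lambda> \<subseteq> carrier M \<Longrightarrow> scale c (scale d \<Lambda>) = scale (c * d) \<Lambda>"
  unfolding image_image by (rule image_cong[OF refl]) (auto simp: smult_assoc subset_iff)

lemma scale_closed: "c \<in> F \<Longrightarrow> \<Lambda> \<subseteq> carrier M \<Longrightarrow> scale c \<Lambda> \<subseteq> carrier M"
  by auto

lemma scale_1: "\<Lambda> \<subseteq> carrier M \<Longrightarrow> scale 1 \<Lambda> = \<Lambda>"
  using image_cong[of \<Lambda> \<Lambda> "\<lambda>x. 1 \<odot> x" "\<lambda>x. x"] by (auto simp: subset_iff)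

lemma mem_hc: "\<Lambda> \<subseteq> carrier M \<Longrightarrow> \<Lambda> \<in> hc \<Lambda>"
  unfolding homothety_class_def by (intro CollectI exI[of _ 1]) (simp add: scale_1)

lemma hc_scale: assumes c: "c \<in> F" "c \<noteq> 0" and L: "\<Lambda> \<subseteq> carrier M" shows "hc (scale c \<Lambda>) = hc \<Lambda>"
proof (intro equalityI subsetI)
  fix Y :: "'a set"
  {
    assume "Y \<in> hc (scale c \<Lambda>)"
    then obtain d where d: "d \<in> F" "d \<noteq> 0" "Y = scale d (scale c \<Lambda>)" by (auto simp: homothety_class_def)
    then have "Y = scale (d * c) \<Lambda>" "d * c \<in> F - {0}" using c L scale_scale F_mult by auto
    then show "Y \<in> hc \<Lambda>" unfolding homothety_class_def by blast
  next
    assume "Y \<in> hc \<Lambda>"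
    then obtain d where d: "d \<in> F" "d \<noteq> 0" "Y = scale d \<Lambda>" by (auto simp: homothety_class_def)
    then have "Y = scale (d * inverse c) (scale c \<Lambda>)" "d * inverse c \<in> F - {0}"
      using c L scale_scale[of "d * inverse c" c \<Lambda>] F_mult F_inverse by (auto simp: mult.assoc)
    then show "Y \<in> hc (scale c \<Lambda>)" unfolding homothety_class_def by blast
  }
qed

lemma hc_eqD:
  assumes "hc \<Lambda> = hc \<Lambda>'" "\<Lambda> \<subseteq> carrier M" obtains c where "c \<in> F" "c \<noteq> 0" "\<Lambda> = scale c \<Lambda>'"
proof -
  have "\<Lambda> \<in> hc \<Lambda>'" using mem_hc[OF assms(2)] unfolding assms(1) .
  then show ?thesis using that unfolding homothety_class_def by blast
qed

lemma set_sum_iff: "x \<in> \<Lambda> <+>\<^bsub>M\<^esub> \<Lambda>' \<longleftrightarrow> (\<exists>a\<in>\<Lambda>. \<exists>b\<in>\<Lambda>'. x = a \<oplus> b)"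
  by (auto simp: set_add_defs)

lemma set_sum_closed: "\<Lambda> \<subseteq> carrier M \<Longrightarrow> \<Lambda>' \<subseteq> carrier M \<Longrightarrow> \<Lambda> <+>\<^bsub>M\<^esub> \<Lambda>' \<subseteq> carrier M"
  by (auto simp: set_sum_iff subset_iff)

lemma scale_set_sum:
  assumes "c \<in> F" "\<Lambda> \<subseteq> carrier M" "\<Lambda>' \<subseteq> carrier M"
  shows "scale c (\<Lambda> <+>\<^bsub>M\<^esub> \<Lambda>') = scale c \<Lambda> <+>\<^bsub>M\<^esub> scale c \<Lambda>'"
proof (intro equalityI subsetI)
  have sm: "c \<odot> (a \<oplus> b) = c \<odot> a \<oplus> c \<odot> b" if "a \<in> \<Lambda>" "b \<in> \<Lambda>'" for a b
    using assms that by (intro smult_add_right) auto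
  fix x
  {
    assume "x \<in> scale c (\<Lambda> <+>\<^bsub>M\<^esub> \<Lambda>')"
    then obtain a b where "a \<in> \<Lambda>" "b \<in> \<Lambda>'" "x = c \<odot> (a \<oplus> b)" by (auto simp: set_sum_iff)
    then show "x \<in> scale c \<Lambda> <+>\<^bsub>M\<^esub> scale c \<Lambda>'" using sm set_sum_iff by blast
  next
    assume "x \<in> scale c \<Lambda> <+>\<^bsub>M\<^esub> scale c \<Lambda>'"
    then obtain a b where ab: "a \<in> \<Lambda>" "b \<in> \<Lambda>'" "x = c \<odot> a \<oplus> c \<odot> b" by (auto simp: set_sum_iff)
    then have "a \<oplus> b \<in> \<Lambda> <+>\<^bsub>M\<^esub> \<Lambda>'" using set_sum_iff by blast
    then show "x \<in> scale c (\<Lambda> <+>\<^bsub>M\<^esub> \<Lambda>')" using sm[OF ab(1,2)] ab(3) by (metis imageI)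
  }
qed

lemma scale_unit:
  assumes L: "submod L" and u: "u \<in> F" "v u = 0" shows "scale u L = L"
proof -
  have u0: "u \<noteq> 0" using u by auto
  have uO: "u \<in> \<O>" "inverse u \<in> \<O>" using u u0 v_inverse[of u] F_inverse by (auto simp: O_iff)
  show ?thesis
  proof (intro equalityI subsetI)
    fix x assume "x \<in> L"
    then have "x = u \<odot> (inverse u \<odot> x)" "inverse u \<odot> x \<in> L"
      using smult_cancel(2)[of u x] u u0 submodD[OF L] uO by auto
    then show "x \<in> scale u L" by blast
  qed (use submodD[OF L] uO in auto)
qed

lemma submod_scale: assumes L: "submod L" and c: "c \<in> F" shows "submod (scale c L)"
  unfolding submod_def
proof (intro conjI ballI)
  note LD = submodD[OF L]
  show "scale c L \<subseteq> carrier M" using LD c by auto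
  show "\<zero> \<in> scale c L" using LD(3) c by (intro image_eqI[of _ _ \<zero>]) auto
  fix x assume "x \<in> scale c L"
  then obtain a where a: "a \<in> L" "x = c \<odot> a" by auto
  show "x \<oplus> y \<in> scale c L" if "y \<in> scale c L" for y
  proof -
    obtain b where "b \<in> L" "y = c \<odot> b" using \<open>y \<in> scale c L\<close> by auto
    then show ?thesis using a LD c by (intro image_eqI[of _ _ "a \<oplus> b"]) (auto simp: smult_add_right)
  qed
  fix d assume d: "d \<in> \<O>"
  have "d \<odot> x = c \<odot> (d \<odot> a)" using a c d LD O_F smult_assoc[of c d a] smult_assoc[of d c a]
    by (metis mult.commute)
  then show "d \<odot> x \<in> scale c L" using a d LD by blast
qed

lemma scale_powi:
  assumes L: "submod L" and c: "c \<in> F" "c \<noteq> 0"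
  obtains k where "scale c L = scale (\<pi> powi k) L"
proof -
  obtain k u where u: "c = \<pi> powi k * u" "u \<in> F" "v u = 0" using unit_decomp c by metis
  have "scale c L = scale (\<pi> powi k) (scale u L)"
    using scale_scale[of "\<pi> powi k" u L] u F_powi submodD(1)[OF L] by simp
  then show ?thesis using that scale_unit[OF L u(2,3)] by simp
qed

subsection \<open>Apartments\<close>

text \<open>The diagonal lattices of the apartment of \<open>e\<close>. On them homothety shifts the
  exponents \<open>a\<close>, and the sum of lattices is a minimum of exponents.\<close>

definition sp :: "nat \<Rightarrow> (nat \<Rightarrow> 'a) \<Rightarrow> (nat \<Rightarrow> int) \<Rightarrow> 'a set" where
  "sp d e a = O_span v F M d (\<lambda>i. (\<pi> powi a i) \<odot> e i)"

lemma mem_sp_iff: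
  assumes e: "\<forall>i<d. e i \<in> carrier M"
  shows "x \<in> sp d e a \<longleftrightarrow> (\<exists>c. (\<forall>i<d. c i \<in> F \<and> ereal (of_int (a i)) \<le> v (c i)) \<and> x = lc d e c)"
proof
  assume "x \<in> sp d e a"
  then obtain c where c: "\<forall>i<d. c i \<in> \<O>" "x = lc d (\<lambda>i. \<pi> powi a i \<odot> e i) c"
    by (auto simp: sp_def O_span_def PiE_iff)
  have "x = lc d e (\<lambda>i. c i * \<pi> powi a i)"
    unfolding c(2) using e c(1) O_F by (intro lc_scaled) (auto intro: F_powi)
  moreover have "c i * \<pi> powi a i \<in> F \<and> ereal (of_int (a i)) \<le> v (c i * \<pi> powi a i)" if "i < d" for i
    using c(1) that O_F F_mult F_powi v_mult_ge_right[of "c i"] v_pi_powi by (auto simp: O_iff)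
  ultimately show "\<exists>c. (\<forall>i<d. c i \<in> F \<and> ereal (of_int (a i)) \<le> v (c i)) \<and> x = lc d e c"
    by (intro exI[of _ "\<lambda>i. c i * \<pi> powi a i"]) auto
next
  assume "\<exists>c. (\<forall>i<d. c i \<in> F \<and> ereal (of_int (a i)) \<le> v (c i)) \<and> x = lc d e c"
  then obtain c where c: "\<forall>i<d. c i \<in> F" "\<forall>i<d. ereal (of_int (a i)) \<le> v (c i)" "x = lc d e c" by blast
  define c' where "c' = restrict (\<lambda>i. \<pi> powi (- a i) * c i) {..<d}"
  have c': "\<forall>i<d. c' i \<in> \<O>" using c pi_powi_mult_O by (auto simp: c'_def)
  have "lc d (\<lambda>i. \<pi> powi a i \<odot> e i) c' = lc d e (\<lambda>i. c' i * \<pi> powi a i)"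
    using c' O_F e by (intro lc_scaled) (auto intro: F_powi)
  also have "\<dots> = x"
  proof -
    have "c' i * \<pi> powi a i = c i" if "i < d" for i
      using that by (simp add: c'_def power_int_minus mult.commute mult.left_commute)
    then show ?thesis unfolding c(3) using c e by (intro lc_cong) auto
  qed
  finally show "x \<in> sp d e a" using c' unfolding sp_def O_span_def c'_def by (auto simp: PiE_iff)
qed

lemma sp_closed: assumes "\<forall>i<d. e i \<in> carrier M" shows "sp d e a \<subseteq> carrier M"
  using mem_sp_iff[OF assms] assms by auto

lemma O_span_eq_sp: assumes "\<forall>i<d. e i \<in> carrier M" shows "O_span v F M d e = sp d e (\<lambda>_. 0)"
proof -
  have "lc d e c = lc d (\<lambda>i. \<pi> powi 0 \<odot> e i) c" if "c \<in> {..<d} \<rightarrow>\<^sub>E \<O>" for c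
    using assms that O_F by (intro lc_cong) (auto simp: PiE_iff)
  then show ?thesis unfolding sp_def O_span_def by (auto simp: image_iff)
qed

lemma scale_sp:
  assumes e: "\<forall>i<d. e i \<in> carrier M" and c: "c \<in> F" "v c = ereal (of_int k)"
  shows "scale c (sp d e a) = sp d e (\<lambda>i. a i + k)"
proof (intro equalityI subsetI)
  have c0: "c \<noteq> 0" using c(2) by auto
  fix x
  {
    assume "x \<in> scale c (sp d e a)"
    then obtain b where b: "\<forall>i<d. b i \<in> F \<and> ereal (of_int (a i)) \<le> v (b i)" "x = c \<odot> lc d e b"
      using mem_sp_iff[OF e] by auto
    have "x = lc d e (\<lambda>i. c * b i)" using b e c lc_smult[of c d e b] by simp
    moreover have "c * b i \<in> F \<and> ereal (of_int (a i + k)) \<le> v (c * b i)" if "i < d" for i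
      using b(1) that c v_mult_ge[of k c "a i" "b i"] F_mult by (auto simp: add.commute)
    ultimately show "x \<in> sp d e (\<lambda>i. a i + k)"
      unfolding mem_sp_iff[OF e] by (intro exI[of _ "\<lambda>i. c * b i"]) auto
  next
    assume "x \<in> sp d e (\<lambda>i. a i + k)"
    then obtain b where b: "\<forall>i<d. b i \<in> F \<and> ereal (of_int (a i + k)) \<le> v (b i)" "x = lc d e b"
      using mem_sp_iff[OF e] by auto
    have ic: "inverse c \<in> F" "v (inverse c) = ereal (of_int (- k))"
      using c c0 F_inverse v_inverse by auto
    have "inverse c * b i \<in> F \<and> ereal (of_int (a i)) \<le> v (inverse c * b i)" if "i < d" for i
      using b(1) that ic v_mult_ge[of "- k" "inverse c" "a i + k" "b i"] F_mult by auto
    then have "lc d e (\<lambda>i. inverse c * b i) \<in> sp d e a"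
      unfolding mem_sp_iff[OF e] by (intro exI[of _ "\<lambda>i. inverse c * b i"]) auto
    moreover have "lc d e (\<lambda>i. inverse c * b i) = inverse c \<odot> x"
      using b e ic lc_smult[of "inverse c" d e b] by simp
    moreover have "x = c \<odot> (inverse c \<odot> x)" using b e c c0 smult_cancel(2) by simp
    ultimately show "x \<in> scale c (sp d e a)" by (metis image_eqI)
  }
qed

text \<open>For the harder inclusion each coordinate is given entirely to the summand with the
  smaller exponent.\<close>

lemma sp_sum:
  assumes e: "\<forall>i<d. e i \<in> carrier M"
  shows "sp d e a <+>\<^bsub>M\<^esub> sp d e b = sp d e (\<lambda>i. min (a i) (b i))"
proof (intro equalityI subsetI)
  fix x assume "x \<in> sp d e a <+>\<^bsub>M\<^esub> sp d e b"
  then obtain y z where "y \<in> sp d e a" "z \<in> sp d e b" "x = y \<oplus> z" by (auto simp: set_sum_iff)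
  then obtain f g where fg: "\<forall>i<d. f i \<in> F \<and> ereal (of_int (a i)) \<le> v (f i)"
    "\<forall>i<d. g i \<in> F \<and> ereal (of_int (b i)) \<le> v (g i)" "x = lc d e f \<oplus> lc d e g"
    using mem_sp_iff[OF e] by metis
  have "x = lc d e (\<lambda>i. f i + g i)" using fg e lc_add[of d e f g] by simp
  moreover have "f i + g i \<in> F \<and> ereal (of_int (min (a i) (b i))) \<le> v (f i + g i)" if "i < d" for i
  proof
    show "f i + g i \<in> F" using fg that F_add by blast
    have "ereal (of_int (min (a i) (b i))) \<le> v (f i)"
      by (rule order_trans[of _ "ereal (of_int (a i))"]) (use fg that in auto)
    moreover have "ereal (of_int (min (a i) (b i))) \<le> v (g i)"
      by (rule order_trans[of _ "ereal (of_int (b i))"]) (use fg that in auto)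
    ultimately show "ereal (of_int (min (a i) (b i))) \<le> v (f i + g i)" by (rule v_add_ge)
  qed
  ultimately show "x \<in> sp d e (\<lambda>i. min (a i) (b i))"
    unfolding mem_sp_iff[OF e] by (intro exI[of _ "\<lambda>i. f i + g i"]) auto
next
  fix x assume "x \<in> sp d e (\<lambda>i. min (a i) (b i))"
  then obtain c where c: "\<forall>i<d. c i \<in> F \<and> ereal (of_int (min (a i) (b i))) \<le> v (c i)" "x = lc d e c"
    using mem_sp_iff[OF e] by auto
  let ?P = "\<lambda>i. a i \<le> b i"
  have "x = lc d e (\<lambda>i. if ?P i then c i else 0) \<oplus> lc d e (\<lambda>i. if ?P i then 0 else c i)"
    unfolding c(2) using c(1) e by (intro lc_split) auto
  moreover have "lc d e (\<lambda>i. if ?P i then c i else 0) \<in> sp d e a"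
    unfolding mem_sp_iff[OF e] using c(1)
    by (intro exI[of _ "\<lambda>i. if ?P i then c i else 0"]) (auto simp: min_def)
  moreover have "lc d e (\<lambda>i. if ?P i then 0 else c i) \<in> sp d e b"
    unfolding mem_sp_iff[OF e] using c(1)
    by (intro exI[of _ "\<lambda>i. if ?P i then 0 else c i"]) (auto simp: min_def)
  ultimately show "x \<in> sp d e a <+>\<^bsub>M\<^esub> sp d e b" by (auto simp: set_sum_iff)
qed

lemma apartment_vertex_eq: "apartment_vertex v F \<pi> M d e a = hc (sp d e a)"
  by (simp add: apartment_vertex_def sp_def)

text \<open>A representative of the class of \<open>sp d e a\<close> is again diagonal, with
  \<open>a\<close> shifted by a constant, so arbitrary representatives of the two classes are
  diagonal in the same basis.\<close>

lemma join_in_apartment: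
  assumes e: "\<forall>i<d. e i \<in> carrier M" and L: "L1 \<subseteq> carrier M" "L2 \<subseteq> carrier M"
    and "hc L1 = apartment_vertex v F \<pi> M d e a" "hc L2 = apartment_vertex v F \<pi> M d e b"
  obtains k l where "hc (L1 <+>\<^bsub>M\<^esub> L2) = apartment_vertex v F \<pi> M d e (\<lambda>i. min (a i + k) (b i + l))"
proof -
  have conj: "\<exists>k. L = sp d e (\<lambda>i. a i + k)" if "hc L = apartment_vertex v F \<pi> M d e a" "L \<subseteq> carrier M" for L a
  proof -
    obtain c where c: "c \<in> F" "c \<noteq> 0" "L = scale c (sp d e a)"
      using hc_eqD[of L "sp d e a"] \<open>hc L = _\<close> \<open>L \<subseteq> _\<close> unfolding apartment_vertex_eq by blast
    then show ?thesis using scale_sp[OF e] F_val[of c] by metis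
  qed
  obtain k where k: "L1 = sp d e (\<lambda>i. a i + k)" using conj assms by blast
  obtain l where l: "L2 = sp d e (\<lambda>i. b i + l)" using conj assms by blast
  show ?thesis using that[of k l] unfolding k l sp_sum[OF e] apartment_vertex_eq by simp
qed

text \<open>Exponent vectors are picked anew for each half-apartment, out of membership in
  it.\<close>

lemma join_in_enclosure:
  assumes e: "\<forall>i<d. e i \<in> carrier M" and Xs: "Xs \<subseteq> apartment v F \<pi> M d e"
    and L: "L1 \<subseteq> carrier M" "L2 \<subseteq> carrier M" and X: "hc L1 \<in> Xs" "hc L2 \<in> Xs"
  shows "hc (L1 <+>\<^bsub>M\<^esub> L2) \<in> enclosure_in v F \<pi> M d e Xs"
proof -
  have "hc (L1 <+>\<^bsub>M\<^esub> L2) \<in> D"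
    if D: "Xs \<subseteq> D" "D = half_apartment v F \<pi> M d e i j t" for D i j t
  proof -
    have X': "hc L1 \<in> half_apartment v F \<pi> M d e i j t" "hc L2 \<in> half_apartment v F \<pi> M d e i j t"
      using X D by blast+
    obtain a where a: "hc L1 = apartment_vertex v F \<pi> M d e a" "t \<le> a j - a i"
      using X'(1) unfolding half_apartment_def by blast
    obtain b where b: "hc L2 = apartment_vertex v F \<pi> M d e b" "t \<le> b j - b i"
      using X'(2) unfolding half_apartment_def by blast
    note ab = a b
    obtain k l where kl: "hc (L1 <+>\<^bsub>M\<^esub> L2) = apartment_vertex v F \<pi> M d e (\<lambda>i. min (a i + k) (b i + l))"
      using join_in_apartment[OF e L ab(1,3)] by blast
    \<comment> \<open>The shifts \<open>k\<close> and \<open>l\<close> leave the differences between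
      coordinates alone, and an inequality \<open>x\<^sub>i + t \<le> x\<^sub>j\<close>, written
      \<open>x i + t \<le> x j\<close> here, passes to minima.\<close>
    have "t \<le> min (a j + k) (b j + l) - min (a i + k) (b i + l)" using ab(2,4) by (auto simp: min_def)
    then show ?thesis unfolding D(2) half_apartment_def kl
      by (intro CollectI exI[of _ "\<lambda>i. min (a i + k) (b i + l)"]) auto
  qed
  moreover have "hc (L1 <+>\<^bsub>M\<^esub> L2) \<in> apartment v F \<pi> M d e"
  proof -
    have X': "hc L1 \<in> apartment v F \<pi> M d e" "hc L2 \<in> apartment v F \<pi> M d e" using X Xs by blast+
    obtain a where a: "hc L1 = apartment_vertex v F \<pi> M d e a" using X'(1) unfolding apartment_def by blast
    obtain b where b: "hc L2 = apartment_vertex v F \<pi> M d e b" using X'(2) unfolding apartment_def by blast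
    obtain k l where "hc (L1 <+>\<^bsub>M\<^esub> L2) = apartment_vertex v F \<pi> M d e (\<lambda>i. min (a i + k) (b i + l))"
      using join_in_apartment[OF e L a b] by blast
    then show ?thesis unfolding apartment_def by blast
  qed
  ultimately show ?thesis unfolding enclosure_in_def by blast
qed

lemma is_basisI:
  assumes e: "\<forall>i<d. e i \<in> carrier M"
    and span: "\<And>x. x \<in> carrier M \<Longrightarrow> \<exists>c. (\<forall>i<d. c i \<in> F) \<and> x = lc d e c"
    and indep: "\<And>c. \<forall>i<d. c i \<in> F \<Longrightarrow> lc d e c = \<zero> \<Longrightarrow> \<forall>i<d. c i = 0"
  shows "is_basis F M d e"
  unfolding is_basis_def
proof (rule conjI[OF e], rule ballI)
  fix x assume "x \<in> carrier M"
  from span[OF this] obtain c where c: "\<forall>i<d. c i \<in> F" "x = lc d e c" by (elim exE conjE)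
  show "\<exists>!c. c \<in> {..<d} \<rightarrow>\<^sub>E F \<and> x = lc d e c"
  proof (rule ex1I)
    have "lc d e (restrict c {..<d}) = lc d e c" using c e by (intro lc_cong) auto
    then show "restrict c {..<d} \<in> {..<d} \<rightarrow>\<^sub>E F \<and> x = lc d e (restrict c {..<d})" using c by auto
    fix b assume b: "b \<in> {..<d} \<rightarrow>\<^sub>E F \<and> x = lc d e b"
    then have bF: "\<forall>i<d. b i \<in> F" by (auto simp: PiE_iff)
    have "lc d e (\<lambda>i. b i + (-1) * c i) = lc d e b \<oplus> lc d e (\<lambda>i. (-1) * c i)"
      using bF c(1) e F_mult F_uminus by (intro lc_add) auto
    also have "lc d e (\<lambda>i. (-1) * c i) = (-1) \<odot> lc d e c"
      using c(1) e F_uminus[of 1] by (intro lc_smult) auto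
    also have "\<dots> = \<ominus> x" using smult_uminus_left[of 1 x] c e by simp
    also have "lc d e b \<oplus> \<ominus> x = \<zero>" using b bF e r_neg by simp
    finally have "\<forall>i<d. b i + (-1) * c i = 0"
      using bF c(1) by (intro indep) (auto intro: F_diff)
    then show "b = restrict c {..<d}" using b by (auto simp: PiE_iff extensional_def fun_eq_iff)
  qed
qed

lemma is_basis_scaled:
  assumes b: "is_basis F M d e" and s: "\<forall>i<d. s i \<in> F \<and> s i \<noteq> 0"
  shows "is_basis F M d (\<lambda>i. s i \<odot> e i)"
proof (rule is_basisI)
  have e: "\<forall>i<d. e i \<in> carrier M" using b by (simp add: is_basis_def)
  show "\<forall>i<d. s i \<odot> e i \<in> carrier M" using e s by auto
  have sc: "lc d (\<lambda>i. s i \<odot> e i) c = lc d e (\<lambda>i. c i * s i)" if "\<forall>i<d. c i \<in> F" for c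
    using that e s by (intro lc_scaled) auto
  show "\<exists>c. (\<forall>i<d. c i \<in> F) \<and> x = lc d (\<lambda>i. s i \<odot> e i) c" if x: "x \<in> carrier M" for x
  proof -
    have "\<exists>c. c \<in> {..<d} \<rightarrow>\<^sub>E F \<and> x = lc d e c" using b x unfolding is_basis_def by blast
    then obtain c where c: "\<forall>i<d. c i \<in> F" "x = lc d e c" by (auto simp: PiE_iff)
    have 1: "lc d e c = lc d e (\<lambda>i. c i * inverse (s i) * s i)"
    proof (rule lc_cong)
      fix i assume "i < d"
      then have "c i * inverse (s i) * s i = c i" using s by simp
      then show "c i \<odot> e i = (c i * inverse (s i) * s i) \<odot> e i" by (rule arg_cong[OF sym])
    qed (use c e in auto)
    have 2: "\<forall>i<d. c i * inverse (s i) \<in> F" using c s by (auto intro: F_mult F_inverse)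
    show ?thesis using 1 2 sc[OF 2] c(2) by (intro exI[of _ "\<lambda>i. c i * inverse (s i)"]) simp
  qed
  fix c assume c: "\<forall>i<d. c i \<in> F" "lc d (\<lambda>i. s i \<odot> e i) c = \<zero>"
  have ex1: "\<exists>!c. c \<in> {..<d} \<rightarrow>\<^sub>E F \<and> \<zero> = lc d e c" using b unfolding is_basis_def by blast
  let ?a = "restrict (\<lambda>i. c i * s i) {..<d}" and ?z = "restrict (\<lambda>i. 0) {..<d}"
  have "lc d e ?a = lc d e (\<lambda>i. c i * s i)" using c e s F_mult by (intro lc_cong) auto
  then have 1: "?a \<in> {..<d} \<rightarrow>\<^sub>E F \<and> \<zero> = lc d e ?a" using c sc s F_mult by auto
  have "lc d e ?z = lc d e (\<lambda>i. 0)" using e by (intro lc_cong) auto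
  then have "?z \<in> {..<d} \<rightarrow>\<^sub>E F \<and> \<zero> = lc d e ?z" using lc_zero[OF e] by auto
  then have eq: "?a = ?z" using ex1 1 by blast
  have "c i * s i = 0" if "i < d" for i using fun_cong[OF eq, of i] that by simp
  then show "\<forall>i<d. c i = 0" using s by auto
qed

lemma is_lattice_sp: assumes "is_basis F M d e" shows "is_lattice v F M (sp d e a)"
proof -
  have "is_basis F M d (\<lambda>i. \<pi> powi a i \<odot> e i)"
    by (rule is_basis_scaled[OF assms]) (simp add: F_powi)
  then show ?thesis unfolding is_lattice_def sp_def
    by (rule_tac exI[of _ d], rule_tac exI[of _ "\<lambda>i. \<pi> powi a i \<odot> e i"]) simp
qed

end

context dv_vector_space
begin

lemma add_minus_cancel: "x \<in> carrier M \<Longrightarrow> y \<in> carrier M \<Longrightarrow> x \<oplus> y \<ominus> y = x"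
  by (simp add: a_minus_def a_assoc r_neg)

lemma submod_sp: assumes e: "\<forall>i<d. e i \<in> carrier M" shows "submod (sp d e a)"
  unfolding submod_def
proof (intro conjI ballI)
  show "sp d e a \<subseteq> carrier M" by (rule sp_closed[OF e])
  show "\<zero> \<in> sp d e a" unfolding mem_sp_iff[OF e]
    by (intro exI[of _ "\<lambda>i. 0"]) (simp add: lc_zero[OF e])
  fix x assume "x \<in> sp d e a"
  then obtain f where f: "\<forall>i<d. f i \<in> F \<and> ereal (of_int (a i)) \<le> v (f i)" "x = lc d e f"
    using mem_sp_iff[OF e] by auto
  {
    fix y assume "y \<in> sp d e a"
    then have "x \<oplus> y \<in> sp d e a <+>\<^bsub>M\<^esub> sp d e a" using \<open>x \<in> sp d e a\<close> set_sum_iff by blast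
    then show "x \<oplus> y \<in> sp d e a" unfolding sp_sum[OF e] by simp
  next
    fix c assume c: "c \<in> \<O>"
    have "c \<odot> x = lc d e (\<lambda>i. c * f i)" using f e c O_F lc_smult[of c d e f] by simp
    moreover have "c * f i \<in> F \<and> ereal (of_int (a i)) \<le> v (c * f i)" if "i < d" for i
      using f(1) that c v_mult_ge_right[of c _ "f i"] F_mult by (auto simp: O_iff)
    ultimately show "c \<odot> x \<in> sp d e a"
      unfolding mem_sp_iff[OF e] by (intro exI[of _ "\<lambda>i. c * f i"]) auto
  }
qed

lemma submod_set_sum: assumes A: "submod A" and B: "submod B" shows "submod (A <+>\<^bsub>M\<^esub> B)"
  unfolding submod_def
proof (intro conjI ballI)
  show "A <+>\<^bsub>M\<^esub> B \<subseteq> carrier M" using set_sum_closed submodD(1) A B by blast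
  have "\<zero> = \<zero> \<oplus> \<zero>" by simp
  then show "\<zero> \<in> A <+>\<^bsub>M\<^esub> B" unfolding set_sum_iff using submodD(3)[OF A] submodD(3)[OF B] by blast
  fix x assume "x \<in> A <+>\<^bsub>M\<^esub> B"
  then obtain a b where ab: "a \<in> A" "b \<in> B" "x = a \<oplus> b" unfolding set_sum_iff by blast
  note cl = submodD(2)[OF A] submodD(2)[OF B]
  {
    fix y assume "y \<in> A <+>\<^bsub>M\<^esub> B"
    then obtain a' b' where ab': "a' \<in> A" "b' \<in> B" "y = a' \<oplus> b'" unfolding set_sum_iff by blast
    have "x \<oplus> y = (a \<oplus> a') \<oplus> (b \<oplus> b')" using ab ab' cl by (simp add: a_ac)
    then show "x \<oplus> y \<in> A <+>\<^bsub>M\<^esub> B"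
      unfolding set_sum_iff using submodD(4)[OF A ab(1) ab'(1)] submodD(4)[OF B ab(2) ab'(2)] by blast
  next
    fix c assume c: "c \<in> \<O>"
    have "c \<odot> x = c \<odot> a \<oplus> c \<odot> b" using ab cl c O_F by (simp add: smult_add_right)
    then show "c \<odot> x \<in> A <+>\<^bsub>M\<^esub> B"
      unfolding set_sum_iff using submodD(5)[OF A c ab(1)] submodD(5)[OF B c ab(2)] by blast
  }
qed

lemma lc_mem_submod:
  assumes L: "submod L" and "\<forall>i<d. e i \<in> L" "\<forall>i<d. c i \<in> \<O>"
  shows "lc d e c \<in> L"
  using assms(2,3)
proof (induction d)
  case (Suc d)
  have "\<forall>i<Suc d. e i \<in> carrier M" "\<forall>i<Suc d. c i \<in> F" using Suc.prems submodD(2)[OF L] O_F by blast+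
  then have "lc (Suc d) e c = lc d e c \<oplus> c d \<odot> e d" by (rule lc_Suc)
  then show ?case using Suc submodD(4,5)[OF L] by simp
qed (use submodD(3)[OF L] in simp)

text \<open>Here \<open>k\<close> is the smallest valuation, and \<open>j\<close> the last index at which it is attained.\<close>

lemma normalize_coeffs:
  fixes c :: "nat \<Rightarrow> 'k" and d :: nat
  assumes c: "\<forall>i<d. c i \<in> F" and nz: "\<exists>i<d. c i \<noteq> 0"
  obtains k :: int and j where "j < d" "c j \<noteq> 0" "\<And>i. i < d \<Longrightarrow> \<pi> powi (- k) * c i \<in> \<O>"
    "v (\<pi> powi (- k) * c j) = 0" "\<And>i. j < i \<Longrightarrow> i < d \<Longrightarrow> 1 \<le> v (\<pi> powi (- k) * c i)"
proof -
  have "\<exists>w::int. c i \<noteq> 0 \<longrightarrow> v (c i) = ereal (of_int w)" if "i < d" for i using c F_val that by blast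
  then obtain w :: "nat \<Rightarrow> int" where w: "\<And>i. i < d \<Longrightarrow> c i \<noteq> 0 \<Longrightarrow> v (c i) = ereal (of_int (w i))" by metis
  define S where "S = {i. i < d \<and> c i \<noteq> 0}"
  have S: "finite S" "S \<noteq> {}" using nz by (auto simp: S_def)
  define k where "k = Min (w ` S)"
  have kS: "k \<in> w ` S" and kle: "\<And>i. i \<in> S \<Longrightarrow> k \<le> w i" using S by (auto simp: k_def)
  define T where "T = {i \<in> S. w i = k}"
  have T: "finite T" "T \<noteq> {}" using S kS by (auto simp: T_def)
  define j where "j = Max T"
  have jT: "j \<in> T" and jmax: "\<And>i. i \<in> T \<Longrightarrow> i \<le> j" using T by (auto simp: j_def)
  have vw: "v (\<pi> powi (- k) * c i) = ereal (of_int (w i - k))" if "i \<in> S" for i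
    using that w[of i] by (simp add: S_def v_mult v_pi_powi)
  show ?thesis
  proof (rule that[of j k])
    show "j < d" "c j \<noteq> 0" using jT by (auto simp: T_def S_def)
    show "v (\<pi> powi (- k) * c j) = 0" using vw[of j] jT by (simp add: T_def zero_ereal_def)
    show "\<pi> powi (- k) * c i \<in> \<O>" if i: "i < d" for i
    proof (rule pi_powi_mult_O)
      show "c i \<in> F" using c i by blast
      show "ereal (of_int k) \<le> v (c i)"
        using w[OF i] kle[of i] i by (cases "c i = 0") (auto simp: S_def)
    qed
    show "1 \<le> v (\<pi> powi (- k) * c i)" if i: "j < i" "i < d" for i
    proof (cases "c i = 0")
      case False
      then have iS: "i \<in> S" using i by (simp add: S_def)
      then have "w i \<noteq> k" using jmax[of i] i by (auto simp: T_def)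
      then have "k + 1 \<le> w i" using kle[OF iS] by simp
      then show ?thesis unfolding vw[OF iS] one_ereal_def by simp
    qed simp
  qed
qed

end

text \<open>The function \<open>al\<close> plays the role of the inverse of a norm. The map \<open>t\<close>, which separates
  \<open>L / \<pi> L\<close>, only serves to express that this quotient is finite.\<close>

locale normed_lattice = dv_vector_space v F \<pi> M
  for v :: "'k::field_char_0 \<Rightarrow> ereal" and F :: "'k set" and \<pi> :: 'k
    and M :: "('k, 'a) module" (structure) +
  fixes L :: "'a set" and al :: "'a \<Rightarrow> ereal" and Q :: real and t :: "'a \<Rightarrow> 'c"
  assumes submod_L: "submod L"
    and spans: "x \<in> carrier M \<Longrightarrow> \<exists>k::nat. \<pi> ^ k \<odot> x \<in> L"
    and separated: "x \<in> carrier M \<Longrightarrow> (\<And>k::nat. x \<in> scale (\<pi> ^ k) L) \<Longrightarrow> x = \<zero>"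
    and Q_gt: "1 < Q"
    and al_zero: "al \<zero> = \<infinity>" and al_infty: "x \<in> carrier M \<Longrightarrow> al x = \<infinity> \<Longrightarrow> x = \<zero>"
    and al_pos: "x \<in> carrier M \<Longrightarrow> 0 < al x"
    and al_add: "x \<in> carrier M \<Longrightarrow> y \<in> carrier M \<Longrightarrow> min (al x) (al y) \<le> al (x \<oplus> y)"
    and al_unit: "u \<in> F \<Longrightarrow> v u = 0 \<Longrightarrow> x \<in> carrier M \<Longrightarrow> al (u \<odot> x) = al x"
    and al_pi: "x \<in> carrier M \<Longrightarrow> al (\<pi> \<odot> x) = ereal Q * al x"
    and finite_t: "finite (t ` L)"
    and t_eq: "x \<in> L \<Longrightarrow> y \<in> L \<Longrightarrow> t x = t y \<Longrightarrow> x \<ominus> y \<in> scale \<pi> L"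
    and finite_al: "finite (al ` (L - scale \<pi> L))"
begin

lemmas LD = submodD[OF submod_L]

lemma al_pi_power: "x \<in> carrier M \<Longrightarrow> al (\<pi> ^ n \<odot> x) = ereal (Q ^ n) * al x"
proof (induction n)
  case (Suc n)
  have "al (\<pi> ^ Suc n \<odot> x) = al (\<pi> \<odot> (\<pi> ^ n \<odot> x))"
    using Suc.prems smult_assoc[of \<pi> "\<pi> ^ n" x] F_power by simp
  also have "\<dots> = ereal Q * (ereal (Q ^ n) * al x)" using Suc al_pi[of "\<pi> ^ n \<odot> x"] F_power by simp
  also have "\<dots> = ereal (Q ^ Suc n) * al x" by (simp add: mult.assoc[symmetric])
  finally show ?case .
qed (simp add: one_ereal_def[symmetric])

lemma al_pi_powi: assumes x: "x \<in> carrier M" shows "al (\<pi> powi k \<odot> x) = ereal (Q powi k) * al x"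
proof (cases "0 \<le> k")
  case True
  then show ?thesis using al_pi_power[OF x, of "nat k"] by (simp add: power_int_def)
next
  case False
  define n where "n = nat (- k)"
  have k: "k = - int n" using False by (simp add: n_def)
  have Qn: "Q ^ n \<noteq> 0" using Q_gt by simp
  have "\<pi> ^ n \<odot> (\<pi> powi k \<odot> x) = x"
  proof -
    have "\<pi> ^ n * \<pi> powi k = 1" by (simp add: k power_int_minus)
    then show ?thesis using x smult_assoc[of "\<pi> ^ n" "\<pi> powi k" x] F_power[of \<pi> n] F_powi[of \<pi> k] by simp
  qed
  then have "al x = ereal (Q ^ n) * al (\<pi> powi k \<odot> x)"
    using al_pi_power[of "\<pi> powi k \<odot> x" n] x F_powi by simp
  then have "ereal (Q powi k) * al x = ereal (Q powi k * Q ^ n) * al (\<pi> powi k \<odot> x)"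
    by (simp add: mult.assoc[symmetric])
  also have "Q powi k * Q ^ n = 1" using Qn by (simp add: k power_int_minus)
  finally show ?thesis by (simp add: one_ereal_def[symmetric])
qed

lemma al_smult:
  assumes c: "c \<in> F" "v c = ereal (of_int k)" and x: "x \<in> carrier M"
  shows "al (c \<odot> x) = ereal (Q powi k) * al x"
proof -
  have "c \<noteq> 0" using c(2) by auto
  then obtain l u where u: "c = \<pi> powi l * u" "u \<in> F" "v u = 0" "v c = ereal (of_int l)"
    using unit_decomp[OF c(1)] by blast
  have "l = k" using u(4) c(2) by simp
  then have "al (c \<odot> x) = al (\<pi> powi k \<odot> (u \<odot> x))" using u x F_powi smult_assoc by simp
  then show ?thesis using al_pi_powi[of "u \<odot> x" k] u x al_unit by simp
qed

lemma al_less_smult: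
  assumes "c \<in> F" "c \<noteq> 0" "x \<in> carrier M" "y \<in> carrier M" "al x < al y"
  shows "al (c \<odot> x) < al (c \<odot> y)"
proof -
  obtain k :: int where k: "v c = ereal (of_int k)" using F_val assms by blast
  have "0 < Q powi k" using Q_gt by simp
  then have "ereal (Q powi k) * al x < ereal (Q powi k) * al y"
    using assms(5) by (intro ereal_mult_strict_left_mono) auto
  then show ?thesis using al_smult[OF assms(1) k] assms by simp
qed

lemma al_lc_gt:
  assumes "\<forall>i<d. e i \<in> carrier M" "\<forall>i<d. c i \<in> F" "\<forall>i<d. s < al (c i \<odot> e i)" "s < \<infinity>"
  shows "s < al (lc d e c)"
  using assms(1-3)
proof (induction d)
  case (Suc d)
  have eq: "lc (Suc d) e c = lc d e c \<oplus> c d \<odot> e d" using Suc.prems by simp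
  have "s < min (al (lc d e c)) (al (c d \<odot> e d))" using Suc by simp
  also have "\<dots> \<le> al (lc (Suc d) e c)" unfolding eq using Suc.prems by (intro al_add) auto
  finally show ?case .
qed (use assms(4) al_zero in simp)

lemma al_minus_gt:
  assumes "x \<in> carrier M" "y \<in> carrier M" "s < al x" "s < al y" shows "s < al (x \<ominus> y)"
proof -
  have "v (-1) = 0" "-1 \<in> F" using F_uminus[of 1] by auto
  then have "al (\<ominus> y) = al y" using al_unit[of "-1" y] assms smult_uminus_left[of 1 y] by simp
  then have "s < min (al x) (al (\<ominus> y))" using assms by simp
  also have "\<dots> \<le> al (x \<ominus> y)" unfolding a_minus_def using assms by (intro al_add) auto
  finally show ?thesis .
qed

text \<open>A basis of \<open>L\<close> modulo \<open>\<pi> L\<close> is chosen greedily: \<open>e j\<close> maximises \<open>al\<close> outside the span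
  \<open>W j e\<close> of \<open>\<pi> L\<close> and its predecessors. Such a basis is automatically orthogonal.\<close>

definition W :: "nat \<Rightarrow> (nat \<Rightarrow> 'a) \<Rightarrow> 'a set" where
  "W j e = sp j e (\<lambda>_. 0) <+>\<^bsub>M\<^esub> scale \<pi> L"

definition greedy :: "nat \<Rightarrow> (nat \<Rightarrow> 'a) \<Rightarrow> bool" where
  "greedy d e \<longleftrightarrow> (\<forall>j<d. e j \<in> L \<and> e j \<notin> W j e \<and> (\<forall>x\<in>L. x \<notin> W j e \<longrightarrow> al x \<le> al (e j)))"

lemma greedy_L: "greedy d e \<Longrightarrow> \<forall>i<d. e i \<in> L"
  by (simp add: greedy_def)

lemma greedy_carrier: "greedy d e \<Longrightarrow> \<forall>i<d. e i \<in> carrier M"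
  using greedy_L LD(2) by blast

lemma submod_W: "\<forall>i<j. e i \<in> L \<Longrightarrow> submod (W j e)"
  unfolding W_def using LD(2) by (intro submod_set_sum submod_sp submod_scale submod_L) auto

lemma lc_in_W:
  assumes "\<forall>i<j. e i \<in> L" "\<forall>i<j. c i \<in> \<O>" "z \<in> L" shows "lc j e c \<oplus> \<pi> \<odot> z \<in> W j e"
proof -
  have e: "\<forall>i<j. e i \<in> carrier M" using assms(1) LD(2) by blast
  have "lc j e c \<in> sp j e (\<lambda>_. 0)" unfolding mem_sp_iff[OF e]
    using assms(2) by (intro exI[of _ c]) (auto simp: O_iff zero_ereal_def[symmetric])
  then show ?thesis unfolding W_def set_sum_iff using assms(3) by blast
qed

lemma W_memE:
  assumes "\<forall>i<j. e i \<in> L" "x \<in> W j e"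
  obtains c z where "\<forall>i<j. c i \<in> \<O>" "z \<in> L" "x = lc j e c \<oplus> \<pi> \<odot> z"
proof -
  have e: "\<forall>i<j. e i \<in> carrier M" using assms(1) LD(2) by blast
  obtain a b where ab: "a \<in> sp j e (\<lambda>_. 0)" "b \<in> scale \<pi> L" "x = a \<oplus> b"
    using assms(2) unfolding W_def set_sum_iff by blast
  obtain c where "\<forall>i<j. c i \<in> F \<and> ereal (of_int 0) \<le> v (c i)" "a = lc j e c"
    using ab(1) unfolding mem_sp_iff[OF e] by blast
  then have c: "\<forall>i<j. c i \<in> \<O>" "a = lc j e c" by (simp_all add: O_iff zero_ereal_def[symmetric])
  obtain z where "z \<in> L" "b = \<pi> \<odot> z" using ab(2) by blast
  then show ?thesis using ab(3) c(2) by (intro that[OF c(1), of z]) simp_all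
qed

lemma pi_L_W: assumes "\<forall>i<j. e i \<in> L" shows "scale \<pi> L \<subseteq> W j e"
proof
  fix x assume "x \<in> scale \<pi> L"
  then obtain z where z: "z \<in> L" "x = \<pi> \<odot> z" by blast
  have e: "\<forall>i<j. e i \<in> carrier M" using assms LD(2) by blast
  have "lc j e (\<lambda>i. 0) \<oplus> \<pi> \<odot> z \<in> W j e" using assms z by (intro lc_in_W) auto
  then show "x \<in> W j e" using z LD(2) lc_zero[OF e] by simp
qed

lemma W_cong: assumes "\<forall>i<j. e i \<in> L" "\<forall>i<j. e' i = e i" shows "W j e' = W j e"
proof -
  have e: "\<forall>i<j. e i \<in> carrier M" and e': "\<forall>i<j. e' i \<in> carrier M" using assms LD(2) by auto
  have lc: "lc j e' c = lc j e c" if "\<forall>i<j. c i \<in> F" for c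
    using e assms(2) that by (intro lc_cong) auto
  have "sp j e' (\<lambda>_. 0) = sp j e (\<lambda>_. 0)"
    unfolding set_eq_iff mem_sp_iff[OF e] mem_sp_iff[OF e']
    by (intro allI iff_exI conj_cong refl) (simp add: lc)
  then show ?thesis by (simp add: W_def)
qed

text \<open>The maximum exists because \<open>W d e\<close> contains \<open>\<pi> L\<close> and
  \<open>al\<close> takes only finitely many values on \<open>L\<close> outside
  \<open>\<pi> L\<close>.\<close>

lemma greedy_extend:
  assumes g: "greedy d e" and x: "x \<in> L" "x \<notin> W d e" shows "\<exists>e'. greedy (Suc d) e'"
proof -
  define S where "S = L - W d e"
  have "al ` S \<subseteq> al ` (L - scale \<pi> L)" using pi_L_W[OF greedy_L[OF g]] by (auto simp: S_def)
  then have fin: "finite (al ` S)" using finite_al finite_subset by blast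
  have "x \<in> S" using x by (simp add: S_def)
  then have "Max (al ` S) \<in> al ` S" using fin by (intro Max_in) auto
  then obtain y where y: "y \<in> S" "Max (al ` S) = al y" by blast
  have ymax: "al z \<le> al y" if "z \<in> S" for z using fin that unfolding y(2)[symmetric] by simp
  have W: "W j (e(d := y)) = W j e" if "j \<le> d" for j
    using that greedy_L[OF g] by (intro W_cong) auto
  have "greedy (Suc d) (e(d := y))" unfolding greedy_def
  proof (intro allI impI)
    fix j assume "j < Suc d"
    then consider "j = d" | "j < d" by linarith
    then show "(e(d := y)) j \<in> L \<and> (e(d := y)) j \<notin> W j (e(d := y)) \<and>
        (\<forall>x\<in>L. x \<notin> W j (e(d := y)) \<longrightarrow> al x \<le> al ((e(d := y)) j))"
    proof cases
      case 1
      then show ?thesis using y(1) ymax W[of d] by (simp add: S_def)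
    next
      case 2
      then show ?thesis using g W[of j] by (simp add: greedy_def)
    qed
  qed
  then show ?thesis by blast
qed

text \<open>If \<open>t\<close> agreed on \<open>e i\<close> and \<open>e j\<close> with
  \<open>i < j\<close>, then \<open>e j\<close> would lie in \<open>e i + \<pi> L\<close>, hence in
  \<open>W j e\<close>. So the greedy choice stops.\<close>

lemma greedy_bound: assumes g: "greedy d e" shows "d \<le> card (t ` L)"
proof -
  have eL: "\<forall>i<d. e i \<in> L" by (rule greedy_L[OF g])
  have less: "t (e i) \<noteq> t (e j)" if ij: "i < j" "j < d" for i j
  proof
    assume "t (e i) = t (e j)"
    then have "e j \<ominus> e i \<in> scale \<pi> L" using t_eq[of "e j" "e i"] eL ij by simp
    then obtain z where z: "z \<in> L" "e j \<ominus> e i = \<pi> \<odot> z" by blast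
    have c: "e i \<in> carrier M" "e j \<in> carrier M" "\<forall>k<j. e k \<in> carrier M" using eL ij LD(2) by auto
    have "lc j e (\<lambda>k. if k = i then 1 else 0) \<oplus> \<pi> \<odot> z \<in> W j e"
      using eL ij z(1) by (intro lc_in_W) auto
    also have "lc j e (\<lambda>k. if k = i then 1 else 0) = e i" using c ij lc_single[of j e 1 i] by simp
    also have "e i \<oplus> \<pi> \<odot> z = e j \<ominus> e i \<oplus> e i" unfolding z(2)[symmetric] using c by (simp add: a_comm)
    also have "\<dots> = e j" using c by (simp add: a_minus_def a_assoc l_neg)
    finally show False using g ij by (simp add: greedy_def)
  qed
  have "inj_on (\<lambda>i. t (e i)) {..<d}"
    by (rule linorder_inj_onI) (use less in auto)
  then have "card ((\<lambda>i. t (e i)) ` {..<d}) = d" by (simp add: card_image)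
  moreover have "(\<lambda>i. t (e i)) ` {..<d} \<subseteq> t ` L" using eL by auto
  ultimately show ?thesis using card_mono[OF finite_t] by metis
qed

lemma greedy_complete: obtains d e where "greedy d e" "L \<subseteq> W d e"
proof -
  let ?P = "\<lambda>d. \<exists>e. greedy d e"
  have P0: "?P 0" by (simp add: greedy_def)
  have bound: "d \<le> card (t ` L)" if "?P d" for d using greedy_bound that by blast
  define d where "d = (GREATEST d. ?P d)"
  have "?P d" unfolding d_def by (rule GreatestI_nat[of ?P 0]) (use P0 bound in auto)
  then obtain e where e: "greedy d e" by blast
  have "L \<subseteq> W d e"
  proof (rule ccontr)
    assume "\<not> L \<subseteq> W d e"
    then have "?P (Suc d)" using greedy_extend[OF e] by blast
    then have "Suc d \<le> d" unfolding d_def by (rule Greatest_le_nat) (use bound in auto)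
    then show False by simp
  qed
  then show ?thesis using that e by blast
qed

lemma lc_tail:
  assumes e: "\<forall>i<d. e i \<in> L" and c: "\<forall>i<d. c i \<in> \<O>" and m: "m \<le> d"
    and tail: "\<And>i. m \<le> i \<Longrightarrow> i < d \<Longrightarrow> 1 \<le> v (c i)"
  shows "\<exists>z\<in>L. lc d e c = lc m e c \<oplus> \<pi> \<odot> z"
  using m e c tail
proof (induction d rule: dec_induct)
  case base
  have "\<forall>i<m. e i \<in> carrier M" "\<forall>i<m. c i \<in> F" using base LD(2) O_F by blast+
  then show ?case by (intro bexI[of _ \<zero>]) (simp_all add: LD(3))
next
  case (step d)
  then obtain z where z: "z \<in> L" "lc d e c = lc m e c \<oplus> \<pi> \<odot> z" by auto
  have eC: "\<forall>i<Suc d. e i \<in> carrier M" "\<forall>i<Suc d. c i \<in> F" using step.prems LD(2) O_F by blast+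
  then have mC: "lc m e c \<in> carrier M" using step.hyps by (intro lc_closed) auto
  define a where "a = \<pi> powi (- 1) * c d"
  have aO: "a \<in> \<O>" unfolding a_def
    using step.prems(3)[of d] step.hyps eC by (intro pi_powi_mult_O) (auto simp: one_ereal_def)
  have "c d = \<pi> * a" by (simp add: a_def power_int_minus)
  then have cd: "c d \<odot> e d = \<pi> \<odot> (a \<odot> e d)" using eC aO O_F smult_assoc by simp
  have aL: "a \<odot> e d \<in> L" using aO step.prems LD(5) by simp
  have "lc (Suc d) e c = (lc m e c \<oplus> \<pi> \<odot> z) \<oplus> \<pi> \<odot> (a \<odot> e d)"
    using lc_Suc[OF eC] z(2) cd by simp
  also have "\<dots> = lc m e c \<oplus> \<pi> \<odot> (z \<oplus> a \<odot> e d)"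
    using mC LD(2)[OF z(1)] LD(2)[OF aL] by (simp add: smult_add_right a_assoc)
  finally show ?case using LD(4)[OF z(1) aL] by blast
qed

text \<open>Terms after the last unit coefficient \<open>j\<close> are absorbed by
  \<open>\<pi> L\<close>. Modulo \<open>W j e\<close> the combination is thus a unit multiple of
  \<open>e j\<close>, so it was a competitor when \<open>e j\<close> was chosen.\<close>

lemma greedy_unit_lc:
  assumes g: "greedy d e" and c: "\<forall>i<d. c i \<in> \<O>" and j: "j < d" "v (c j) = 0"
    and tail: "\<And>i. j < i \<Longrightarrow> i < d \<Longrightarrow> 1 \<le> v (c i)"
  shows "lc d e c \<notin> W j e" "al (lc d e c) \<le> al (e j)"
proof -
  have eL: "\<forall>i<d. e i \<in> L" by (rule greedy_L[OF g])
  have eLj: "\<forall>i<j. e i \<in> L" using eL j by simp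
  note Wj = submod_W[OF eLj]
  obtain z where z: "z \<in> L" "lc d e c = lc (Suc j) e c \<oplus> \<pi> \<odot> z"
    using lc_tail[OF eL c, of "Suc j"] j tail by auto
  have eC: "\<forall>i<Suc j. e i \<in> carrier M" "\<forall>i<Suc j. c i \<in> F" using eL j c LD(2) O_F by auto
  have cl: "lc j e c \<in> carrier M" "\<pi> \<odot> z \<in> carrier M" "c j \<odot> e j \<in> carrier M"
    using eC LD(2)[OF z(1)] by simp_all
  have y: "lc d e c = c j \<odot> e j \<oplus> (lc j e c \<oplus> \<pi> \<odot> z)"
    unfolding z(2) lc_Suc[OF eC] using cl by (simp add: a_ac)
  show nW: "lc d e c \<notin> W j e"
  proof
    assume "lc d e c \<in> W j e"
    moreover have w: "lc j e c \<oplus> \<pi> \<odot> z \<in> W j e" using eLj c j z(1) by (intro lc_in_W) auto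
    ultimately have "lc d e c \<ominus> (lc j e c \<oplus> \<pi> \<odot> z) \<in> W j e" by (rule submod_minus[OF Wj])
    then have "c j \<odot> e j \<in> W j e" unfolding y using cl by (simp add: a_minus_def a_assoc r_neg)
    moreover have c0: "c j \<noteq> 0" using j(2) by auto
    then have "inverse (c j) \<in> \<O>" using eC(2) j(2) v_inverse[of "c j"] F_inverse by (simp add: O_iff)
    ultimately have "inverse (c j) \<odot> (c j \<odot> e j) \<in> W j e" using submodD(5)[OF Wj] by blast
    then have "e j \<in> W j e" using smult_cancel(1)[of "c j" "e j"] eC c0 by simp
    then show False using g j by (simp add: greedy_def)
  qed
  have "lc d e c \<in> L" by (rule lc_mem_submod[OF submod_L eL c])
  then show "al (lc d e c) \<le> al (e j)" using g j nW by (simp add: greedy_def)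
qed

text \<open>A nontrivial relation, scaled so that its smallest valuation is 0, would place the zero
  vector outside some \<open>W j e\<close>.\<close>

lemma greedy_indep:
  assumes g: "greedy d e" and c: "\<forall>i<d. c i \<in> F" and z: "lc d e c = \<zero>"
  shows "\<forall>i<d. c i = 0"
proof (rule ccontr)
  assume "\<not> ?thesis"
  then have nz: "\<exists>i<d. c i \<noteq> 0" by blast
  obtain k j where kj: "j < d" "c j \<noteq> 0" "\<And>i. i < d \<Longrightarrow> \<pi> powi (- k) * c i \<in> \<O>"
    "v (\<pi> powi (- k) * c j) = 0" "\<And>i. j < i \<Longrightarrow> i < d \<Longrightarrow> 1 \<le> v (\<pi> powi (- k) * c i)"
    by (rule normalize_coeffs[OF c nz]) blast
  have "lc d e (\<lambda>i. \<pi> powi (- k) * c i) = \<pi> powi (- k) \<odot> lc d e c"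
    by (rule lc_smult) (use F_powi c greedy_carrier[OF g] in auto)
  also have "\<dots> = \<zero>" using z F_powi by simp
  finally have "\<zero> \<notin> W j e" using greedy_unit_lc(1)[OF g, of "\<lambda>i. \<pi> powi (- k) * c i" j] kj by simp
  moreover have "submod (W j e)" using greedy_L[OF g] kj(1) by (intro submod_W) auto
  ultimately show False using submodD(3) by blast
qed

text \<open>Successive approximation modulo powers of \<open>\<pi>\<close>.\<close>

lemma greedy_span:
  assumes g: "greedy d e" and LW: "L \<subseteq> W d e" shows "L = sp d e (\<lambda>_. 0)"
proof (intro equalityI subsetI)
  have eL: "\<forall>i<d. e i \<in> L" and eC: "\<forall>i<d. e i \<in> carrier M"
    using greedy_L[OF g] greedy_carrier[OF g] by auto
  fix x
  {
    assume "x \<in> sp d e (\<lambda>_. 0)"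
    then obtain c where "\<forall>i<d. c i \<in> F \<and> ereal (of_int 0) \<le> v (c i)" "x = lc d e c"
      unfolding mem_sp_iff[OF eC] by blast
    then show "x \<in> L" using lc_mem_submod[OF submod_L eL, of c] by (simp add: O_iff zero_ereal_def[symmetric])
  next
    assume x: "x \<in> L"
    have "\<exists>c z. (\<forall>i<d. c i \<in> \<O>) \<and> z \<in> L \<and> y = lc d e c \<oplus> \<pi> \<odot> z" if y: "y \<in> L" for y
      using W_memE[OF eL, of y] LW y by blast
    then obtain C Z where CZ: "\<And>y i. y \<in> L \<Longrightarrow> i < d \<Longrightarrow> C y i \<in> \<O>" "\<And>y. y \<in> L \<Longrightarrow> Z y \<in> L"
      "\<And>y. y \<in> L \<Longrightarrow> y = lc d e (C y) \<oplus> \<pi> \<odot> Z y" by metis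
    \<comment> \<open>\<open>Y m\<close> is what remains of \<open>x\<close> after splitting off
      \<open>m\<close> digits; it enters \<open>x\<close> with the factor
      \<open>\<pi> ^ m\<close>.\<close>
    define Y where "Y m = (Z ^^ m) x" for m
    have Y: "Y m \<in> L" for m by (induction m) (auto simp: Y_def x CZ(2))
    define s where "s m i = (\<Sum>k<m. \<pi> ^ k * C (Y k) i)" for m i
    have sO: "s m i \<in> \<O>" if "i < d" for m i
      unfolding s_def using CZ(1)[OF Y that] by (intro O_sum O_mult O_power) auto
    have approx: "x = lc d e (s m) \<oplus> \<pi> ^ m \<odot> Y m" for m
    proof (induction m)
      case 0
      then show ?case using LD(2)[OF x] lc_zero[OF eC] by (simp add: s_def Y_def)
    next
      case (Suc m)
      have CF: "\<forall>i<d. C (Y m) i \<in> F" "\<forall>i<d. s m i \<in> F" using CZ(1)[OF Y] sO O_F by blast+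
      have cl: "lc d e (s m) \<in> carrier M" "lc d e (C (Y m)) \<in> carrier M" "Y (Suc m) \<in> carrier M"
        using eC CF LD(2)[OF Y] by simp_all
      have "s (Suc m) = (\<lambda>i. s m i + \<pi> ^ m * C (Y m) i)" by (simp add: s_def fun_eq_iff)
      then have "lc d e (s (Suc m)) = lc d e (\<lambda>i. s m i + \<pi> ^ m * C (Y m) i)" by simp
      also have "\<dots> = lc d e (s m) \<oplus> lc d e (\<lambda>i. \<pi> ^ m * C (Y m) i)"
        using eC CF F_mult F_power by (intro lc_add) auto
      also have "lc d e (\<lambda>i. \<pi> ^ m * C (Y m) i) = \<pi> ^ m \<odot> lc d e (C (Y m))"
        using eC CF F_power by (intro lc_smult) auto
      finally have 1: "lc d e (s (Suc m)) = lc d e (s m) \<oplus> \<pi> ^ m \<odot> lc d e (C (Y m))" .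
      have "Y m = lc d e (C (Y m)) \<oplus> \<pi> \<odot> Y (Suc m)" using CZ(3)[OF Y[of m]] by (simp add: Y_def)
      then have "\<pi> ^ m \<odot> Y m = \<pi> ^ m \<odot> (lc d e (C (Y m)) \<oplus> \<pi> \<odot> Y (Suc m))" by simp
      also have "\<dots> = \<pi> ^ m \<odot> lc d e (C (Y m)) \<oplus> \<pi> ^ m \<odot> (\<pi> \<odot> Y (Suc m))"
        using cl F_power by (intro smult_add_right) auto
      also have "\<pi> ^ m \<odot> (\<pi> \<odot> Y (Suc m)) = \<pi> ^ Suc m \<odot> Y (Suc m)"
        using cl F_power smult_assoc[of "\<pi> ^ m" \<pi> "Y (Suc m)"] by (simp add: mult.commute)
      finally show ?case using Suc 1 cl F_power by (simp add: a_assoc F_mult)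
    qed
    have "\<exists>c\<in>\<O>. \<forall>m. \<exists>r\<in>\<O>. c = s m i + \<pi> ^ m * r" if i: "i < d" for i
      using O_series[of "\<lambda>k. C (Y k) i"] CZ(1)[OF Y i] unfolding s_def by metis
    then obtain c where c: "\<And>i. i < d \<Longrightarrow> c i \<in> \<O>"
      "\<And>i m. i < d \<Longrightarrow> \<exists>r\<in>\<O>. c i = s m i + \<pi> ^ m * r" by metis
    have cF: "\<forall>i<d. c i \<in> F" using c(1) O_F by blast
    have clc: "lc d e c \<in> carrier M" using eC cF by simp
    have "x \<ominus> lc d e c = \<zero>"
    proof (rule separated)
      show "x \<ominus> lc d e c \<in> carrier M" using LD(2)[OF x] clc by simp
      fix m
      obtain r where r: "\<And>i. i < d \<Longrightarrow> r i \<in> \<O>" "\<And>i. i < d \<Longrightarrow> c i = s m i + \<pi> ^ m * r i"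
        using c(2)[of _ m] by metis
      have rF: "\<forall>i<d. r i \<in> F" "\<forall>i<d. s m i \<in> F" using r(1) sO O_F by blast+
      have "lc d e c = lc d e (\<lambda>i. s m i + \<pi> ^ m * r i)"
        using eC cF by (intro lc_cong) (auto simp flip: r(2))
      also have "\<dots> = lc d e (s m) \<oplus> lc d e (\<lambda>i. \<pi> ^ m * r i)"
        using eC rF F_mult F_power by (intro lc_add) auto
      also have "lc d e (\<lambda>i. \<pi> ^ m * r i) = \<pi> ^ m \<odot> lc d e r"
        using eC rF F_power by (intro lc_smult) auto
      finally have lcc: "lc d e c = lc d e (s m) \<oplus> \<pi> ^ m \<odot> lc d e r" .
      have cl: "lc d e (s m) \<in> carrier M" "lc d e r \<in> carrier M" "Y m \<in> carrier M" "\<pi> ^ m \<in> F"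
        using eC rF LD(2)[OF Y] F_power by simp_all
      have rL: "lc d e r \<in> L" using r(1) by (intro lc_mem_submod[OF submod_L eL]) simp
      have "\<pi> ^ m \<odot> (Y m \<ominus> lc d e r) \<oplus> lc d e c = lc d e (s m) \<oplus> (\<pi> ^ m \<odot> (Y m \<ominus> lc d e r) \<oplus> \<pi> ^ m \<odot> lc d e r)"
        unfolding lcc using cl by (simp add: a_ac)
      also have "\<pi> ^ m \<odot> (Y m \<ominus> lc d e r) \<oplus> \<pi> ^ m \<odot> lc d e r = \<pi> ^ m \<odot> (Y m \<ominus> lc d e r \<oplus> lc d e r)"
        using cl by (intro smult_add_right[symmetric]) auto
      also have "Y m \<ominus> lc d e r \<oplus> lc d e r = Y m" using cl by (simp add: a_minus_def a_assoc l_neg)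
      finally have "\<pi> ^ m \<odot> (Y m \<ominus> lc d e r) \<oplus> lc d e c = x" using approx[of m] by simp
      then have "x \<ominus> lc d e c = \<pi> ^ m \<odot> (Y m \<ominus> lc d e r) \<oplus> lc d e c \<ominus> lc d e c" by simp
      also have "\<dots> = \<pi> ^ m \<odot> (Y m \<ominus> lc d e r)" using cl clc by (intro add_minus_cancel) auto
      finally show "x \<ominus> lc d e c \<in> scale (\<pi> ^ m) L"
        using submod_minus[OF submod_L Y[of m] rL] by simp
    qed
    then have "x \<ominus> lc d e c \<oplus> lc d e c = lc d e c" using clc by simp
    then have "x = lc d e c" using LD(2)[OF x] clc by (simp add: a_minus_def a_assoc l_neg)
    then show "x \<in> sp d e (\<lambda>_. 0)" unfolding mem_sp_iff[OF eC]
      using cF c(1) by (intro exI[of _ c]) (auto simp: O_iff zero_ereal_def[symmetric])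
  }
qed

lemma greedy_basis:
  assumes g: "greedy d e" and LW: "L \<subseteq> W d e" shows "is_basis F M d e"
proof (rule is_basisI)
  show eC: "\<forall>i<d. e i \<in> carrier M" by (rule greedy_carrier[OF g])
  fix x assume x: "x \<in> carrier M"
  obtain k :: nat where k: "\<pi> ^ k \<odot> x \<in> L" using spans[OF x] by blast
  then obtain c where c: "\<forall>i<d. c i \<in> F \<and> ereal (of_int 0) \<le> v (c i)" "\<pi> ^ k \<odot> x = lc d e c"
    unfolding greedy_span[OF g LW] mem_sp_iff[OF eC] by blast
  have "x = inverse (\<pi> ^ k) \<odot> lc d e c" using smult_cancel(1)[of "\<pi> ^ k" x] x F_power c(2) by simp
  also have "\<dots> = lc d e (\<lambda>i. inverse (\<pi> ^ k) * c i)"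
    using c(1) eC F_power F_inverse by (intro lc_smult[symmetric]) auto
  finally show "\<exists>c. (\<forall>i<d. c i \<in> F) \<and> x = lc d e c"
    using c(1) by (intro exI[of _ "\<lambda>i. inverse (\<pi> ^ k) * c i"]) (auto intro!: F_mult F_inverse F_power)
qed (rule greedy_indep[OF g])

lemma al_real:
  assumes "x \<in> carrier M" "x \<noteq> \<zero>" obtains r where "al x = ereal r" "0 < r"
  using al_pos[OF assms(1)] al_infty[OF assms(1)] assms(2) by (cases "al x") auto

lemma powi_interval:
  assumes "0 < r" "0 < \<mu>" obtains a :: int where "Q powi (a - 1) * r < \<mu>" "\<mu> \<le> Q powi a * r"
proof -
  define a where "a = \<lceil>log Q (\<mu> / r)\<rceil>"
  have pw: "Q powi k = Q powr (of_int k)" for k :: int using Q_gt by (simp add: powr_real_of_int')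
  have mr: "\<mu> / r = Q powr (log Q (\<mu> / r))" using assms Q_gt by simp
  have "log Q (\<mu> / r) \<le> of_int a" "of_int (a - 1) < log Q (\<mu> / r)" by (simp_all add: a_def) linarith
  then have "\<mu> / r \<le> Q powi a" "Q powi (a - 1) < \<mu> / r"
    unfolding pw using Q_gt by (subst mr, simp)+
  then show ?thesis using that[of a] assms by (simp add: field_simps)
qed

text \<open>Orthogonality: if \<open>al\<close> of a combination exceeds the smallest value \<open>s\<close> of \<open>al\<close> on its terms, the
  terms with value \<open>s\<close> give, after scaling, a counterexample to the maximality of some \<open>e j\<close>.\<close>

lemma greedy_orthogonal:
  assumes g: "greedy d e" and c: "\<forall>i<d. c i \<in> F" and \<mu>: "\<mu> \<le> al (lc d e c)" and i: "i < d"
  shows "\<mu> \<le> al (c i \<odot> e i)"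
proof (rule ccontr)
  assume neg: "\<not> \<mu> \<le> al (c i \<odot> e i)"
  have eC: "\<forall>i<d. e i \<in> carrier M" by (rule greedy_carrier[OF g])
  define s where "s = Min ((\<lambda>i. al (c i \<odot> e i)) ` {..<d})"
  have sle: "s \<le> al (c j \<odot> e j)" if "j < d" for j using that by (simp add: s_def)
  have "s \<in> (\<lambda>i. al (c i \<odot> e i)) ` {..<d}" unfolding s_def using i by (intro Min_in) auto
  then obtain j0 where j0: "j0 < d" "s = al (c j0 \<odot> e j0)" by auto
  have s_less: "s < al (lc d e c)" using sle[OF i] neg \<mu> by simp
  then have s_inf: "s < \<infinity>" by auto
  define P where "P j \<longleftrightarrow> al (c j \<odot> e j) = s" for j
  define c1 c2 where "c1 j = (if P j then c j else 0)" and "c2 j = (if P j then 0 else c j)" for j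
  have cF: "\<forall>i<d. c1 i \<in> F" "\<forall>i<d. c2 i \<in> F" using c by (auto simp: c1_def c2_def)
  have split: "lc d e c = lc d e c1 \<oplus> lc d e c2"
    unfolding c1_def c2_def by (rule lc_split[OF eC c])
  have cl: "lc d e c1 \<in> carrier M" "lc d e c2 \<in> carrier M" "lc d e c \<in> carrier M" using eC cF c by simp_all
  have "s < al (c2 j \<odot> e j)" if "j < d" for j
    using sle[OF that] s_inf al_zero eC that by (auto simp: c2_def P_def)
  then have "s < al (lc d e c2)" using eC cF s_inf by (intro al_lc_gt) auto
  moreover have "lc d e c1 = lc d e c \<ominus> lc d e c2" unfolding split using cl by (simp add: a_minus_def a_assoc r_neg)
  ultimately have c1_gt: "s < al (lc d e c1)" using al_minus_gt cl s_less by simp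
  have nz: "\<exists>i<d. c1 i \<noteq> 0"
  proof (intro exI conjI)
    show "j0 < d" by (rule j0)
    have "c j0 \<noteq> 0" using s_inf al_zero j0 eC by auto
    then show "c1 j0 \<noteq> 0" using j0 by (simp add: c1_def P_def)
  qed
  obtain k j where kj: "j < d" "c1 j \<noteq> 0" "\<And>i. i < d \<Longrightarrow> \<pi> powi (- k) * c1 i \<in> \<O>"
    "v (\<pi> powi (- k) * c1 j) = 0" "\<And>i. j < i \<Longrightarrow> i < d \<Longrightarrow> 1 \<le> v (\<pi> powi (- k) * c1 i)"
    by (rule normalize_coeffs[OF cF(1) nz]) blast
  have Pj: "P j" "c1 j = c j" using kj(2) by (auto simp: c1_def split: if_splits)
  have pk: "\<pi> powi (- k) \<in> F" "\<pi> powi (- k) \<noteq> 0" using F_powi by auto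
  have ej: "e j \<in> carrier M" "c j \<in> F" using eC c kj(1) by auto
  \<comment> \<open>The chain returns to its start: the normalised combination is at most
    \<open>al (e j)\<close> by the greedy choice, and this equals the left-hand side because the
    normalised coefficient at \<open>j\<close> is a unit.\<close>
  have "al (\<pi> powi (- k) \<odot> (c j \<odot> e j)) < al (\<pi> powi (- k) \<odot> lc d e c1)"
    using c1_gt Pj(1) pk ej cl by (intro al_less_smult) (auto simp: P_def)
  also have "\<pi> powi (- k) \<odot> lc d e c1 = lc d e (\<lambda>i. \<pi> powi (- k) * c1 i)"
    using pk eC cF by (intro lc_smult[symmetric]) auto
  also have "al \<dots> \<le> al (e j)" using kj by (intro greedy_unit_lc(2)[OF g]) auto
  also have "al (e j) = al ((\<pi> powi (- k) * c j) \<odot> e j)"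
    using kj(4) Pj(2) pk ej F_mult by (intro al_unit[symmetric]) auto
  also have "\<dots> = al (\<pi> powi (- k) \<odot> (c j \<odot> e j))" using pk ej smult_assoc by simp
  finally show False by simp
qed

text \<open>Orthogonality reduces membership to a condition on each coordinate. The threshold
  \<open>a i\<close> is the integer where \<open>Q powi k * al (e i)\<close> first reaches
  \<open>\<mu>\<close> as \<open>k\<close> grows.\<close>

lemma greedy_filtration:
  assumes g: "greedy d e" and LW: "L \<subseteq> W d e" and \<mu>: "0 < \<mu>"
  obtains a where "{x \<in> carrier M. ereal \<mu> \<le> al x} = sp d e a"
proof -
  have eC: "\<forall>i<d. e i \<in> carrier M" by (rule greedy_carrier[OF g])
  have "\<exists>a::int. \<exists>r>0. al (e i) = ereal r \<and> Q powi (a - 1) * r < \<mu> \<and> \<mu> \<le> Q powi a * r" if i: "i < d" for i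
  proof -
    have "submod (W i e)" using greedy_L[OF g] i by (intro submod_W) auto
    then have "e i \<noteq> \<zero>" using g i submodD(3) unfolding greedy_def by metis
    then obtain r where r: "al (e i) = ereal r" "0 < r" using al_real eC i by blast
    then show ?thesis using powi_interval[OF r(2) \<mu>] by metis
  qed
  then obtain a r where ar: "\<And>i. i < d \<Longrightarrow> 0 < r i" "\<And>i. i < d \<Longrightarrow> al (e i) = ereal (r i)"
    "\<And>i. i < d \<Longrightarrow> Q powi (a i - 1) * r i < \<mu>" "\<And>i. i < d \<Longrightarrow> \<mu> \<le> Q powi (a i) * r i" by metis
  have key: "ereal \<mu> \<le> al (c \<odot> e i) \<longleftrightarrow> ereal (of_int (a i)) \<le> v c" if i: "i < d" and c: "c \<in> F" for c i
  proof (cases "c = 0")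
    case True
    then show ?thesis using eC i al_zero by simp
  next
    case False
    obtain k :: int where k: "v c = ereal (of_int k)" using F_val[OF c False] by blast
    have al: "al (c \<odot> e i) = ereal (Q powi k * r i)" using al_smult[OF c k] eC i ar(2)[OF i] by simp
    show ?thesis
    proof (cases "a i \<le> k")
      case True
      then have "Q powi (a i) \<le> Q powi k" using Q_gt by (simp add: power_int_increasing)
      then have "Q powi (a i) * r i \<le> Q powi k * r i" using ar(1)[OF i] by simp
      then show ?thesis using ar(4)[OF i] True al k by simp
    next
      case False
      then have "Q powi k \<le> Q powi (a i - 1)" using Q_gt by (intro power_int_increasing) auto
      then have "Q powi k * r i \<le> Q powi (a i - 1) * r i" using ar(1)[OF i] by simp
      then show ?thesis using ar(3)[OF i] False al k by simp
    qed
  qed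
  have "{x \<in> carrier M. ereal \<mu> \<le> al x} = sp d e a"
  proof (intro equalityI subsetI)
    fix x
    {
      assume x: "x \<in> {x \<in> carrier M. ereal \<mu> \<le> al x}"
      have "\<exists>c. (\<forall>i<d. c i \<in> F) \<and> x = lc d e c"
      proof -
        have "x \<in> carrier M" using x by simp
        then have "\<exists>c. c \<in> {..<d} \<rightarrow>\<^sub>E F \<and> x = lc d e c"
          using greedy_basis[OF g LW] unfolding is_basis_def by blast
        then show ?thesis by (auto simp: PiE_iff)
      qed
      then obtain c where c: "\<forall>i<d. c i \<in> F" "x = lc d e c" by (elim exE conjE)
      then have "ereal (of_int (a i)) \<le> v (c i)" if "i < d" for i
        using key[OF that, of "c i"] greedy_orthogonal[OF g c(1) _ that] x that by simp
      then show "x \<in> sp d e a" unfolding mem_sp_iff[OF eC] using c by (intro exI[of _ c]) simp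
    next
      assume "x \<in> sp d e a"
      then obtain c where c: "\<forall>i<d. c i \<in> F \<and> ereal (of_int (a i)) \<le> v (c i)" "x = lc d e c"
        unfolding mem_sp_iff[OF eC] by blast
      have "x \<in> carrier M" using c eC by simp
      moreover have "ereal \<mu> \<le> al x"
      proof (rule ccontr)
        assume less: "\<not> ereal \<mu> \<le> al x"
        have "al x < al (c i \<odot> e i)" if "i < d" for i
          using key[OF that, of "c i"] c(1) that less by (meson less_le_trans not_le)
        then have "al x < al (lc d e c)" using c eC less by (intro al_lc_gt) auto
        then show False using c(2) by simp
      qed
      ultimately show "x \<in> {x \<in> carrier M. ereal \<mu> \<le> al x}" by simp
    }
  qed
  then show ?thesis using that by blast
qed

theorem adapted_basis:
  obtains d e where "is_basis F M d e" "L = sp d e (\<lambda>_. 0)"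
    "\<And>\<mu>::real. 0 < \<mu> \<Longrightarrow> \<exists>a. {x \<in> carrier M. ereal \<mu> \<le> al x} = sp d e a"
proof -
  obtain d e where g: "greedy d e" "L \<subseteq> W d e" by (rule greedy_complete)
  have "\<exists>a. {x \<in> carrier M. ereal \<mu> \<le> al x} = sp d e a" if \<mu>: "0 < \<mu>" for \<mu> :: real
    by (rule greedy_filtration[OF g \<mu>]) (rule exI)
  then show ?thesis by (rule that[OF greedy_basis[OF g] greedy_span[OF g]])
qed

end

section \<open>The rational Tate module\<close>

text \<open>\<open>Q\<close> stands for the order \<open>q ^ n\<close> of \<open>H[\<pi>]\<close>;
  residue field and height enter the argument only through this number.\<close>

locale tate = ac_valued_field v + dv_subfield v F \<pi>
  for v :: "'k::{alg_closed_field, field_char_0} \<Rightarrow> ereal" and F :: "'k set" and \<pi> :: 'k +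
  fixes H :: "'k formal_module" and Q :: nat and \<epsilon> :: real
  assumes formal: "formal_O_module v F H" and Q_ge: "2 \<le> Q"
    and act_pi_less: "\<And>i. i < Q \<Longrightarrow> 0 < v (act H \<pi> $ i)" and act_pi_Q: "v (act H \<pi> $ Q) = 0"
    and eps: "S_bound v \<pi> H \<epsilon>"
begin

lemma fgl_law: "formal_group_law v (fgl H)"
  using formal by (simp add: formal_O_module_def)

lemma int_fgl: "int2 (fgl H)"
  using fgl_law by (simp add: formal_group_law_def fps_all_def int0_def)

lemma fgl_00: "fgl H $ 0 $ 0 = 0"
proof -
  have "subst2 (fgl H) X1 0 $ 0 $ 0 $ 0 = (X1 :: 'k fps3) $ 0 $ 0 $ 0"
    using fgl_law by (simp add: formal_group_law_def)
  then show ?thesis by (simp add: subst2_def X1_def)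
qed

lemma
  assumes "a \<in> \<O>"
  shows int_act: "int1 (act H a)" and act_0: "act H a $ 0 = 0" and act_1: "act H a $ 1 = a"
  using formal assms by (simp_all add: formal_O_module_def fps_all_def int0_def)

sublocale weierstrass_series_bound v "act H \<pi>" Q \<epsilon>
proof unfold_locales
  fix z assume "0 < v z" "ev (act H \<pi>) z = 0"
  then show "ereal \<epsilon> \<le> v z" using eps by (auto simp: S_bound_def pi_torsion_points_def points_def)
qed (use int_act act_0 Q_ge act_pi_less act_pi_Q eps in \<open>auto simp: S_bound_def\<close>)

subsection \<open>The group of points\<close>

abbreviation pl :: "'k \<Rightarrow> 'k \<Rightarrow> 'k" where "pl x y \<equiv> eval2 v (fgl H) x y"

abbreviation ac :: "'k \<Rightarrow> 'k \<Rightarrow> 'k" where "ac a x \<equiv> ev (act H a) x"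

lemma pl_ge:
  assumes "0 < C" "ereal C \<le> v x" "ereal C \<le> v y" shows "ereal C \<le> v (pl x y)"
proof -
  have "0 < v x" "0 < v y" using assms by (meson ereal_less(2) less_le_trans)+
  then have "pl x y = ev2 x y (fgl H)" by (rule eval2_eq_ev2[OF int_fgl])
  moreover have "ereal ((real 1 - real 0) * C) \<le> v (ev2 x y (fgl H))"
    by (rule ev2_low[OF int_fgl assms]) (simp add: fgl_00)
  ultimately show ?thesis by simp
qed

lemma pl_pos: assumes "0 < v x" "0 < v y" shows "0 < v (pl x y)"
proof -
  obtain r where "0 < r" "ereal r \<le> v x" "ereal r \<le> v y" using v_pos_real2[OF assms] by blast
  then show ?thesis using pl_ge by (meson ereal_less(2) less_le_trans)
qed

lemma ac_ge: "a \<in> \<O> \<Longrightarrow> 0 < v x \<Longrightarrow> v x \<le> v (ac a x)"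
  by (intro ev_no_const_ge int_act act_0)

lemma ac_pos: "a \<in> \<O> \<Longrightarrow> 0 < v x \<Longrightarrow> 0 < v (ac a x)"
  by (rule less_le_trans[OF _ ac_ge])

lemma ac_zero: "a \<in> \<O> \<Longrightarrow> ac a 0 = 0"
  using ac_ge[of a 0] by simp

lemma ev3_pl:
  assumes "int3 A" "low 1 A" "int3 B" "low 1 B" "0 < v x" "0 < v y" "0 < v z"
  shows "ev3 x y z (subst2 (fgl H) A B) = pl (ev3 x y z A) (ev3 x y z B)"
  by (rule ev3_subst2[OF int_fgl assms])

lemma pl_assoc: assumes x: "0 < v x" "0 < v y" "0 < v z" shows "pl (pl x y) z = pl x (pl y z)"
proof -
  have eq: "subst2 (fgl H) (subst2 (fgl H) X1 X2) X3 = subst2 (fgl H) X1 (subst2 (fgl H) X2 X3)"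
    using fgl_law unfolding formal_group_law_def by blast
  note I = int3_X low_X int3_subst2[OF int_fgl] low_subst2[of "fgl H", OF fgl_00]
  have "ev3 x y z (subst2 (fgl H) (subst2 (fgl H) X1 X2) X3) = pl (pl x y) z"
    using x by (simp add: ev3_pl I ev3_X del: One_nat_def)
  moreover have "ev3 x y z (subst2 (fgl H) X1 (subst2 (fgl H) X2 X3)) = pl x (pl y z)"
    using x by (simp add: ev3_pl I ev3_X del: One_nat_def)
  ultimately show ?thesis by (simp add: eq)
qed

lemma pl_commute: assumes x: "0 < v x" "0 < v y" shows "pl x y = pl y x"
proof -
  have eq: "subst2 (fgl H) X1 X2 = subst2 (fgl H) X2 X1" using fgl_law by (simp add: formal_group_law_def)
  have "0 < v (0::'k)" by simp
  then show ?thesis using arg_cong[OF eq, of "ev3 x y 0"] x by (simp add: ev3_pl int3_X low_X ev3_X del: One_nat_def)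
qed

lemma pl_zero: assumes x: "0 < v x" shows "pl x 0 = x" "pl 0 x = x"
proof -
  interpret h: hom_pred int3 "ev3 x 0 0" by (rule ev3_hom) (use x in auto)
  have eq: "subst2 (fgl H) X1 0 = X1" using fgl_law by (simp add: formal_group_law_def)
  show "pl x 0 = x"
    using arg_cong[OF eq, of "ev3 x 0 0"] x by (simp add: ev3_pl int3_X low_X ev3_X i3.I_0 low_0 h.h_0 del: One_nat_def)
  then show "pl 0 x = x" using pl_commute[of x 0] x by simp
qed

lemma ac_pl: assumes a: "a \<in> \<O>" and x: "0 < v x" "0 < v y" shows "ac a (pl x y) = pl (ac a x) (ac a y)"
proof -
  have eq: "subst1 (act H a) (subst2 (fgl H) X1 X2) = subst2 (fgl H) (subst1 (act H a) X1) (subst1 (act H a) X2)"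
    using formal a by (simp add: formal_O_module_def)
  have z: "0 < v (0::'k)" by simp
  note I = int3_X low_X int3_subst2[OF int_fgl] low_subst2[of "fgl H", OF fgl_00]
    int3_subst1[OF int_act[OF a]] low_subst1[OF act_0[OF a]] ev3_subst1[OF int_act[OF a]]
  show ?thesis using arg_cong[OF eq, of "ev3 x y 0"] x z by (simp add: ev3_pl I ev3_X del: One_nat_def)
qed

lemma ac_add:
  assumes a: "a \<in> \<O>" "b \<in> \<O>" and x: "0 < v x" shows "ac (a + b) x = pl (ac a x) (ac b x)"
proof -
  have eq: "subst1 (act H (a + b)) X1 = subst2 (fgl H) (subst1 (act H a) X1) (subst1 (act H b) X1)"
    using formal a by (simp add: formal_O_module_def)
  have z: "0 < v (0::'k)" by simp
  have ab: "a + b \<in> \<O>" using a by (rule O_add)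
  note I = int3_X low_X int3_subst1[OF int_act] low_subst1[OF act_0] ev3_subst1[OF int_act]
  show ?thesis using arg_cong[OF eq, of "ev3 x 0 0"] x z a ab by (simp add: ev3_pl I ev3_X del: One_nat_def)
qed

lemma ac_mult:
  assumes "a \<in> \<O>" "b \<in> \<O>" "0 < v x" shows "ac (a * b) x = ac a (ac b x)"
proof -
  have "act H (a * b) = act H a oo act H b" using formal assms by (simp add: formal_O_module_def)
  then show ?thesis using ev_compose[OF int_act int_act act_0] assms by simp
qed

lemma ac_one: "0 < v x \<Longrightarrow> ac 1 x = x"
  using formal by (simp add: formal_O_module_def)

text \<open>The series \<open>[0]\<close> is idempotent under composition and starts in degree two.\<close>

lemma ac_0: assumes x: "0 < v x" shows "ac 0 x = 0"
proof (rule ccontr)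
  assume nz: "ac 0 x \<noteq> 0"
  define y where "y = ac 0 x"
  have y0: "0 < v y" using ac_pos[of 0 x] x by (simp add: y_def)
  have idem: "ac 0 y = y" using ac_mult[of 0 0 x] x by (simp add: y_def)
  define g where "g = fps_shift 1 (act H 0)"
  have ig: "int1 g" using int_act[of 0] by (simp add: g_def fps_all_def)
  have g0: "g $ 0 = 0" using act_1[of 0] by (simp add: g_def)
  have "act H 0 = fps_X * g" using act_0[of 0] by (auto simp: g_def fps_eq_iff)
  then have "ac 0 y = y * ev g y" using ev_X_mult[OF ig y0] by simp
  then have "v y = v y + v (ev g y)" using idem v_mult by metis
  moreover have "v y \<le> v (ev g y)" by (rule ev_no_const_ge[OF ig g0 y0])
  moreover obtain r where "v y = ereal r" using v_real nz y_def by blast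
  ultimately show False using y0 by (cases "v (ev g y)") auto
qed

text \<open>The formal group law comes without an inverse series; the action of \<open>-1\<close>
  provides it, through \<open>[-1] + [1] = [0]\<close>.\<close>

lemma ac_inverse: assumes x: "0 < v x" shows "pl (ac (-1) x) x = 0" "pl x (ac (-1) x) = 0"
proof -
  have m: "-1 \<in> \<O>" using O_uminus[OF O_1] by simp
  show 1: "pl (ac (-1) x) x = 0" using ac_add[OF m O_1 x] ac_one[OF x] ac_0[OF x] by simp
  show "pl x (ac (-1) x) = 0" using pl_commute[OF x ac_pos[OF m x]] 1 by simp
qed

lemma pl_cancel:
  assumes "0 < v x" "0 < v y" "0 < v z" "pl x y = pl z y" shows "x = z"
proof -
  have m: "-1 \<in> \<O>" using O_uminus[OF O_1] by simp
  have *: "pl (pl w y) (ac (-1) y) = w" if "0 < v w" for w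
    using that assms(2) ac_inverse(2)[OF assms(2)] ac_pos[OF m] by (simp add: pl_assoc pl_zero)
  show ?thesis using *[OF assms(1)] *[OF assms(3)] unfolding assms(4) by (rule trans[OF sym])
qed

lemma v_ac_unit: assumes u: "u \<in> F" "v u = 0" and x: "0 < v x" shows "v (ac u x) = v x"
proof (rule antisym)
  have u0: "u \<noteq> 0" using u by auto
  have uO: "u \<in> \<O>" "inverse u \<in> \<O>" using u u0 v_inverse[of u] F_inverse by (auto simp: O_iff)
  show "v x \<le> v (ac u x)" by (rule ac_ge[OF uO(1) x])
  have "ac (inverse u) (ac u x) = x" using ac_mult[OF uO(2,1) x] ac_one[OF x] u0 by simp
  then show "v (ac u x) \<le> v x" using ac_ge[OF uO(2) ac_pos[OF uO(1) x]] by simp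
qed

subsection \<open>The vector space\<close>

abbreviation "V \<equiv> V_p v \<pi> H"

lemma mem_V: "x \<in> carrier V \<longleftrightarrow>
    (\<forall>i. 0 < v (x i)) \<and> (\<forall>i. ac \<pi> (x (i + 1)) = x i) \<and> (\<exists>N. \<forall>i<N. x i = 0)"
  by (simp add: V_p_def points_def)

lemma V_pos: "x \<in> carrier V \<Longrightarrow> 0 < v (x i)"
  and V_step: "x \<in> carrier V \<Longrightarrow> ac \<pi> (x (i + 1)) = x i"
  by (simp_all add: mem_V)

lemma V_add: "(x \<oplus>\<^bsub>V\<^esub> y) i = pl (x i) (y i)"
  by (simp add: V_p_def)

lemma V_zero: "\<zero>\<^bsub>V\<^esub> = (\<lambda>i. 0)"
  by (simp add: V_p_def)

lemma V_power: assumes x: "x \<in> carrier V" shows "ac (\<pi> ^ k) (x (i + int k)) = x i"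
proof (induction k arbitrary: i)
  case 0
  then show ?case using ac_one V_pos[OF x] by simp
next
  case (Suc k)
  have "ac (\<pi> ^ Suc k) (x (i + int (Suc k))) = ac (\<pi> ^ k * \<pi>) (x ((i + int k) + 1))"
    by (simp add: algebra_simps)
  also have "\<dots> = x i" using ac_mult[OF O_power[OF O_pi] O_pi V_pos[OF x]] V_step[OF x] Suc by simp
  finally show ?case .
qed

text \<open>Frees the scalar action from the \<open>LEAST\<close> in its definition: an extra factor
  \<open>\<pi> ^ m\<close> is undone by moving \<open>m\<close> places along the sequence. Two
  scalars can then be compared at a common \<open>k\<close>.\<close>

lemma V_smult:
  assumes c: "c \<in> F" and x: "x \<in> carrier V" and k: "0 \<le> v (c * \<pi> ^ k)"
  shows "(c \<odot>\<^bsub>V\<^esub> x) i = ac (c * \<pi> ^ k) (x (i + int k))"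
proof -
  define k0 where "k0 = (LEAST k. 0 \<le> v (c * \<pi> ^ k))"
  have k0: "0 \<le> v (c * \<pi> ^ k0)" "k0 \<le> k"
    unfolding k0_def using k by (auto intro: LeastI Least_le)
  define m where "m = k - k0"
  have km: "k = k0 + m" using k0 by (simp add: m_def)
  have O: "c * \<pi> ^ k0 \<in> \<O>" using k0 c by (simp add: O_iff F_mult F_power)
  have "ac (c * \<pi> ^ k) (x (i + int k)) = ac ((c * \<pi> ^ k0) * \<pi> ^ m) (x ((i + int k0) + int m))"
    by (simp add: km power_add algebra_simps)
  also have "\<dots> = ac (c * \<pi> ^ k0) (x (i + int k0))"
    using ac_mult[OF O O_power[OF O_pi] V_pos[OF x]] V_power[OF x] by simp
  finally show ?thesis by (simp add: V_p_def Let_def k0_def)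
qed

lemma ex_pi_power_int: assumes "c \<in> F" shows "\<exists>K. \<forall>k\<ge>K. 0 \<le> v (c * \<pi> ^ k)"
proof (cases "c = 0")
  case False
  then obtain r where r: "v c = ereal r" using v_real by blast
  obtain K :: nat where "- r \<le> real K" using real_arch_simple by blast
  then have "0 \<le> v (c * \<pi> ^ k)" if "K \<le> k" for k using that r by (simp add: v_mult v_pi_power)
  then show ?thesis by blast
qed simp

lemma V_smult_int: "c \<in> \<O> \<Longrightarrow> x \<in> carrier V \<Longrightarrow> (c \<odot>\<^bsub>V\<^esub> x) i = ac c (x i)"
  using V_smult[of c x 0] by (simp add: O_iff)

sublocale dv_vector_space v F \<pi> V
proof -
  have m: "-1 \<in> \<O>" using O_uminus[OF O_1] by simp
  have zero: "(\<lambda>i. 0) \<in> carrier V" by (simp add: mem_V ac_zero)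
  have ac_V: "(\<lambda>i. ac a (x (i + int k))) \<in> carrier V" if a: "a \<in> \<O>" and x: "x \<in> carrier V" for a x k
    unfolding mem_V
  proof (intro conjI allI)
    fix i
    show "0 < v (ac a (x (i + int k)))" by (rule ac_pos[OF a V_pos[OF x]])
    have "ac \<pi> (ac a (x (i + 1 + int k))) = ac a (ac \<pi> (x (i + 1 + int k)))"
      using ac_mult[OF O_pi a V_pos[OF x]] ac_mult[OF a O_pi V_pos[OF x]] by (metis mult.commute)
    also have "ac \<pi> (x (i + 1 + int k)) = x (i + int k)" using V_step[OF x, of "i + int k"] by (simp add: algebra_simps)
    finally show "ac \<pi> (ac a (x (i + 1 + int k))) = ac a (x (i + int k))" .
  next
    obtain N where "\<forall>i<N. x i = 0" using x by (auto simp: mem_V)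
    then have "\<forall>i<N - int k. ac a (x (i + int k)) = 0" using ac_zero[OF a] by simp
    then show "\<exists>N. \<forall>i<N. ac a (x (i + int k)) = 0" by blast
  qed
  have closed: "x \<oplus>\<^bsub>V\<^esub> y \<in> carrier V" if x: "x \<in> carrier V" and y: "y \<in> carrier V" for x y
    unfolding mem_V V_add
  proof (intro conjI allI)
    fix i
    show "0 < v (pl (x i) (y i))" by (rule pl_pos[OF V_pos[OF x] V_pos[OF y]])
    show "ac \<pi> (pl (x (i + 1)) (y (i + 1))) = pl (x i) (y i)"
      using ac_pl[OF O_pi V_pos[OF x] V_pos[OF y]] V_step[OF x] V_step[OF y] by simp
  next
    obtain N N' where "\<forall>i<N. x i = 0" "\<forall>i<N'. y i = 0" using x y by (auto simp: mem_V)
    then have "\<forall>i<min N N'. pl (x i) (y i) = 0" using pl_zero(1)[of 0] by simp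
    then show "\<exists>N. \<forall>i<N. pl (x i) (y i) = 0" by blast
  qed
  interpret abelian_group V
  proof (rule abelian_groupI)
    fix x y z assume x: "x \<in> carrier V" and y: "y \<in> carrier V" and z: "z \<in> carrier V"
    show "x \<oplus>\<^bsub>V\<^esub> y \<oplus>\<^bsub>V\<^esub> z = x \<oplus>\<^bsub>V\<^esub> (y \<oplus>\<^bsub>V\<^esub> z)"
      using V_pos[OF x] V_pos[OF y] V_pos[OF z] by (simp add: fun_eq_iff V_add pl_assoc)
  next
    fix x y assume x: "x \<in> carrier V" and y: "y \<in> carrier V"
    show "x \<oplus>\<^bsub>V\<^esub> y \<in> carrier V" by (rule closed[OF x y])
    show "x \<oplus>\<^bsub>V\<^esub> y = y \<oplus>\<^bsub>V\<^esub> x"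
      using pl_commute[OF V_pos[OF x] V_pos[OF y]] by (simp add: fun_eq_iff V_add)
  next
    show "\<zero>\<^bsub>V\<^esub> \<in> carrier V" using zero by (simp add: V_zero)
    fix x assume x: "x \<in> carrier V"
    show "\<zero>\<^bsub>V\<^esub> \<oplus>\<^bsub>V\<^esub> x = x" using pl_zero(2)[OF V_pos[OF x]] by (simp add: fun_eq_iff V_add V_zero)
    have "(\<lambda>i. ac (-1) (x (i + int 0))) \<in> carrier V" by (rule ac_V[OF m x])
    moreover have "(\<lambda>i. ac (-1) (x (i + int 0))) \<oplus>\<^bsub>V\<^esub> x = \<zero>\<^bsub>V\<^esub>"
      using ac_inverse(1)[OF V_pos[OF x]] by (simp add: fun_eq_iff V_add V_zero)
    ultimately show "\<exists>y\<in>carrier V. y \<oplus>\<^bsub>V\<^esub> x = \<zero>\<^bsub>V\<^esub>" by blast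
  qed
  have common: "\<exists>k. c * \<pi> ^ k \<in> \<O> \<and> d * \<pi> ^ k \<in> \<O> \<and> (c + d) * \<pi> ^ k \<in> \<O>"
    if c: "c \<in> F" and d: "d \<in> F" for c d
  proof -
    obtain K K' where K: "\<forall>k\<ge>K. 0 \<le> v (c * \<pi> ^ k)" "\<forall>k\<ge>K'. 0 \<le> v (d * \<pi> ^ k)"
      using ex_pi_power_int[OF c] ex_pi_power_int[OF d] by blast
    have 1: "c * \<pi> ^ max K K' \<in> \<O>" "d * \<pi> ^ max K K' \<in> \<O>"
      using K c d by (auto simp: O_iff F_mult F_power)
    then show ?thesis using O_add[OF 1] by (intro exI[of _ "max K K'"]) (simp add: distrib_right)
  qed
  have sm: "(c \<odot>\<^bsub>V\<^esub> x) i = ac (c * \<pi> ^ k) (x (i + int k))"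
    if "c \<in> F" "x \<in> carrier V" "c * \<pi> ^ k \<in> \<O>" for c x k i
    using V_smult that by (simp add: O_iff)
  have sm_closed: "c \<odot>\<^bsub>V\<^esub> x \<in> carrier V" if c: "c \<in> F" and x: "x \<in> carrier V" for c x
  proof -
    obtain k where k: "c * \<pi> ^ k \<in> \<O>" using common[OF c c] by blast
    have "c \<odot>\<^bsub>V\<^esub> x = (\<lambda>i. ac (c * \<pi> ^ k) (x (i + int k)))" using sm[OF c x k] by (simp add: fun_eq_iff)
    then show ?thesis using ac_V[OF k x] by simp
  qed
  show "dv_vector_space v F \<pi> V"
  proof unfold_locales
    fix c x y assume c: "c \<in> F" and x: "x \<in> carrier V" and y: "y \<in> carrier V"
    obtain k where k: "c * \<pi> ^ k \<in> \<O>" using common[OF c c] by blast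
    show "c \<odot>\<^bsub>V\<^esub> (x \<oplus>\<^bsub>V\<^esub> y) = c \<odot>\<^bsub>V\<^esub> x \<oplus>\<^bsub>V\<^esub> c \<odot>\<^bsub>V\<^esub> y"
      using ac_pl[OF k V_pos[OF x] V_pos[OF y]]
      by (simp add: fun_eq_iff V_add sm[OF c closed[OF x y] k] sm[OF c x k] sm[OF c y k])
  next
    fix c d x assume c: "c \<in> F" and d: "d \<in> F" and x: "x \<in> carrier V"
    obtain k where k: "c * \<pi> ^ k \<in> \<O>" "d * \<pi> ^ k \<in> \<O>" "(c + d) * \<pi> ^ k \<in> \<O>"
      using common[OF c d] by blast
    show "(c + d) \<odot>\<^bsub>V\<^esub> x = c \<odot>\<^bsub>V\<^esub> x \<oplus>\<^bsub>V\<^esub> d \<odot>\<^bsub>V\<^esub> x"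
      using ac_add[OF k(1,2) V_pos[OF x]]
      by (simp add: fun_eq_iff V_add sm[OF F_add[OF c d] x k(3)] sm[OF c x k(1)] sm[OF d x k(2)] distrib_right)
    have cd: "(c * d) * \<pi> ^ (k + k) \<in> \<O>"
      using O_mult[OF k(1,2)] by (simp add: power_add algebra_simps)
    show "(c * d) \<odot>\<^bsub>V\<^esub> x = c \<odot>\<^bsub>V\<^esub> (d \<odot>\<^bsub>V\<^esub> x)"
      using ac_mult[OF k(1,2) V_pos[OF x]]
      by (simp add: fun_eq_iff sm[OF F_mult[OF c d] x cd] sm[OF c sm_closed[OF d x] k(1)] sm[OF d x k(2)]
          power_add algebra_simps)
  next
    fix x assume x: "x \<in> carrier V"
    show "1 \<odot>\<^bsub>V\<^esub> x = x" using ac_one[OF V_pos[OF x]] V_smult_int[OF O_1 x] by (simp add: fun_eq_iff)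
  qed (use sm_closed in auto)
qed

lemma V_pi_powi: assumes x: "x \<in> carrier V" shows "(\<pi> powi k \<odot>\<^bsub>V\<^esub> x) i = x (i - k)"
proof (cases "0 \<le> k")
  case True
  define n where "n = nat k"
  have n: "k = int n" using True by (simp add: n_def)
  have "(\<pi> ^ n \<odot>\<^bsub>V\<^esub> x) i = ac (\<pi> ^ n) (x ((i - k) + int n))"
    using V_smult_int[OF O_power[OF O_pi] x] by (simp add: n)
  also have "\<dots> = x (i - k)" by (rule V_power[OF x])
  finally show ?thesis by (simp add: n)
next
  case False
  define n where "n = nat (- k)"
  have n: "k = - int n" using False by (simp add: n_def)
  have 1: "\<pi> powi k * \<pi> ^ n = 1" by (simp add: n power_int_minus)
  have "(\<pi> powi k \<odot>\<^bsub>V\<^esub> x) i = ac (\<pi> powi k * \<pi> ^ n) (x (i + int n))"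
    by (rule V_smult[OF F_powi[OF pi_F] x]) (simp add: 1)
  also have "\<dots> = x (i - k)" unfolding 1 using ac_one[OF V_pos[OF x]] by (simp add: n)
  finally show ?thesis .
qed

lemma V_pi_power: "x \<in> carrier V \<Longrightarrow> (\<pi> ^ k \<odot>\<^bsub>V\<^esub> x) i = x (i - int k)"
  using V_pi_powi[of x "int k"] by simp

lemma V_pi: "x \<in> carrier V \<Longrightarrow> (\<pi> \<odot>\<^bsub>V\<^esub> x) i = x (i - 1)"
  using V_pi_powi[of x 1] by simp

lemma V_minus_eq_0:
  assumes x: "x \<in> carrier V" and y: "y \<in> carrier V" and eq: "x i = y i" shows "(x \<ominus>\<^bsub>V\<^esub> y) i = 0"
proof -
  have z: "x \<ominus>\<^bsub>V\<^esub> y \<in> carrier V" using x y by simp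
  have "x \<ominus>\<^bsub>V\<^esub> y \<oplus>\<^bsub>V\<^esub> y = x" using x y by (simp add: a_minus_def a_assoc l_neg)
  then have "pl ((x \<ominus>\<^bsub>V\<^esub> y) i) (y i) = y i" using V_add eq by metis
  then have "pl ((x \<ominus>\<^bsub>V\<^esub> y) i) (y i) = pl 0 (y i)" using pl_zero(2)[OF V_pos[OF y]] by simp
  then show ?thesis using pl_cancel[OF V_pos[OF z] V_pos[OF y], of 0] by simp
qed

lemma V_zero_below: assumes x: "x \<in> carrier V" and "x j = 0" "i \<le> j" shows "x i = 0"
  using V_power[OF x, of "nat (j - i)" i] assms ac_zero[OF O_power[OF O_pi]] by simp

subsection \<open>Multiplication by the uniformizer on points\<close>

lemma ac_pi_small: assumes z: "0 < v z" "v z < ereal \<epsilon>" shows "v (ac \<pi> z) = ereal (real Q) * v z"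
proof -
  obtain m where m: "v z = ereal m" using z by (cases "v z") auto
  have m0: "0 < m" "m < \<epsilon>" using z m by auto
  define L where "L = real Q * m + min (\<epsilon> - m) m"
  define h where "h = act H \<pi> - fps_const (act H \<pi> $ Q) * fps_X ^ Q"
  have h: "h $ i = (if i = Q then 0 else act H \<pi> $ i)" for i
    by (simp add: h_def fps_X_power_nth)
  have ih: "int1 h" using int_f_nth by (simp add: fps_all_def h int0_def)
  have "ereal L \<le> v (ev h z)"
  proof (rule ev_ge[OF ih z(1)])
    fix i
    consider "i = Q" | "i < Q" | "Q < i" by linarith
    then show "ereal L \<le> v (h $ i * z ^ i)"
    proof cases
      case 1
      then show ?thesis by (simp add: h)
    next
      case 2
      have "ereal (real (Q - i) * \<epsilon> + real i * m) \<le> v (act H \<pi> $ i * z ^ i)"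
        using coeff_ge[of i] 2 m by (intro v_mult_ge v_power_ge) auto
      moreover have "L \<le> real (Q - i) * \<epsilon> + real i * m"
      proof -
        have "1 * (\<epsilon> - m) \<le> real (Q - i) * (\<epsilon> - m)" using 2 m0 by (intro mult_right_mono) auto
        then show ?thesis using 2 by (simp add: L_def of_nat_diff algebra_simps)
      qed
      ultimately show ?thesis using 2 by (simp add: h) (meson ereal_less_eq(3) order_trans)
    next
      case 3
      have "ereal (0 + real i * m) \<le> v (act H \<pi> $ i * z ^ i)"
        using int_f_nth[of i] m by (intro v_mult_ge v_power_ge) (auto simp: zero_ereal_def)
      moreover have "L \<le> real i * m"
      proof -
        have "real (Suc Q) * m \<le> real i * m" using 3 m0 by (intro mult_right_mono) auto
        then show ?thesis by (simp add: L_def algebra_simps)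
      qed
      ultimately show ?thesis using 3 by (simp add: h) (meson ereal_less_eq(3) order_trans)
    qed
  qed
  moreover have vq: "v (act H \<pi> $ Q * z ^ Q) = ereal (real Q * m)" by (simp add: v_mult v_power m f_Q)
  moreover have "real Q * m < L" using m0 by (simp add: L_def)
  ultimately have less: "v (act H \<pi> $ Q * z ^ Q) < v (ev h z)" by (metis less_ereal.simps(1) less_le_trans)
  interpret e: hom_pred int1 "\<lambda>f. ev f z" by (rule ev_hom[OF z(1)])
  have ic: "int1 (fps_const (act H \<pi> $ Q))" using int_f_nth by (simp add: fps_all_def int0_def)
  have iX: "int1 fps_X" by (simp add: fps_all_def int0_def fps_X_def)
  have iq: "int1 (fps_const (act H \<pi> $ Q) * fps_X ^ Q)" using ic iX by (intro i1.I_mult i1.I_power)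
  have "act H \<pi> = fps_const (act H \<pi> $ Q) * fps_X ^ Q + h" by (simp add: h_def)
  then have "ac \<pi> z = ev (fps_const (act H \<pi> $ Q) * fps_X ^ Q) z + ev h z" using e.h_add[OF iq ih] by simp
  also have "ev (fps_const (act H \<pi> $ Q) * fps_X ^ Q) z = act H \<pi> $ Q * z ^ Q"
    using e.h_mult[OF ic i1.I_power[OF iX]] e.h_power[OF iX] z by simp
  finally have "v (ac \<pi> z) = v (act H \<pi> $ Q * z ^ Q)" using v_add_eq[OF less] by simp
  then show ?thesis using vq m by simp
qed

text \<open>Degrees beyond \<open>Q\<close> are dominated by degree \<open>Q\<close>, whose
  coefficient is a unit, so only finitely many terms have to be bounded.\<close>

lemma ac_pi_ge:
  assumes z: "ereal C \<le> v z" "0 < C" and D: "\<And>i. 1 \<le> i \<Longrightarrow> i \<le> Q \<Longrightarrow> ereal D \<le> v (act H \<pi> $ i) + ereal (real i * C)"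
  shows "ereal D \<le> v (ac \<pi> z)"
proof (rule ev_ge[OF int_f])
  show "0 < v z" using z by (meson ereal_less(2) less_le_trans)
  fix i
  have ge: "v (act H \<pi> $ i) + ereal (real i * C) \<le> v (act H \<pi> $ i * z ^ i)"
    using v_power_ge[OF z(1), of i] by (simp add: v_mult add_left_mono)
  consider "i = 0" | "1 \<le> i" "i \<le> Q" | "Q < i" by linarith
  then show "ereal D \<le> v (act H \<pi> $ i * z ^ i)"
  proof cases
    case 1
    then show ?thesis using f_0 by simp
  next
    case 2
    then show ?thesis using D[OF 2] ge order_trans by blast
  next
    case 3
    have "ereal D \<le> ereal (real Q * C)" using D[of Q] Q_ge f_Q by simp
    also have "\<dots> \<le> 0 + ereal (real i * C)" using 3 z by simp
    also have "\<dots> \<le> v (act H \<pi> $ i) + ereal (real i * C)" using int_f_nth[of i] by (intro add_right_mono)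
    finally show ?thesis using ge order_trans by blast
  qed
qed

lemma coeff_plus_ge:
  assumes "1 \<le> i" "i \<le> Q" "D \<le> real (Q - i) * \<epsilon> + real i * C"
  shows "ereal D \<le> v (act H \<pi> $ i) + ereal (real i * C)"
proof -
  have "ereal D \<le> ereal (real (Q - i) * \<epsilon>) + ereal (real i * C)" using assms(3) by simp
  also have "\<dots> \<le> v (act H \<pi> $ i) + ereal (real i * C)" using coeff_ge[OF assms(2)] by (intro add_right_mono)
  finally show ?thesis .
qed

lemma ac_pi_large: assumes z: "ereal \<epsilon> \<le> v z" shows "ereal (real Q * \<epsilon>) \<le> v (ac \<pi> z)"
  by (rule ac_pi_ge[OF z eps_pos], rule coeff_plus_ge) (auto simp: of_nat_diff algebra_simps)

text \<open>For \<open>i < Q\<close> the coefficient itself contributes \<open>\<epsilon>\<close>;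
  for \<open>i = Q\<close> the assumption \<open>2 \<le> Q\<close> gives
  \<open>Q C \<ge> 2 C \<ge> C + \<epsilon>\<close>.\<close>

lemma ac_pi_shift:
  assumes z: "ereal C \<le> v z" and C: "\<epsilon> \<le> C" shows "ereal (C + \<epsilon>) \<le> v (ac \<pi> z)"
proof (rule ac_pi_ge[OF z])
  show C0: "0 < C" using C eps_pos by simp
  fix i assume i: "1 \<le> i" "i \<le> Q"
  show "ereal (C + \<epsilon>) \<le> v (act H \<pi> $ i) + ereal (real i * C)"
  proof (rule coeff_plus_ge[OF i])
    show "C + \<epsilon> \<le> real (Q - i) * \<epsilon> + real i * C"
    proof (cases "i = Q")
      case True
      have "2 * C \<le> real Q * C" using Q_ge C0 by (intro mult_right_mono) auto
      then show ?thesis using True C by simp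
    next
      case False
      have "1 * \<epsilon> \<le> real (Q - i) * \<epsilon>" "1 * C \<le> real i * C"
        using i False C0 eps_pos by (intro mult_right_mono; simp)+
      then show ?thesis by simp
    qed
  qed
qed

lemma V_shift_ge:
  assumes x: "x \<in> carrier V" and "ereal \<epsilon> \<le> v (x (i + int j))"
  shows "ereal (\<epsilon> + real j * \<epsilon>) \<le> v (x i)"
  using assms(2)
proof (induction j arbitrary: i)
  case (Suc j)
  have "(i + 1) + int j = i + int (Suc j)" by simp
  then have "ereal (\<epsilon> + real j * \<epsilon>) \<le> v (x (i + 1))" using Suc by metis
  then have "ereal ((\<epsilon> + real j * \<epsilon>) + \<epsilon>) \<le> v (ac \<pi> (x (i + 1)))"
    using eps_pos by (intro ac_pi_shift) auto
  then show ?case unfolding V_step[OF x] by (simp add: algebra_simps)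
qed simp

text \<open>Writing \<open>[\<pi>](z) = z (\<pi> + z g(z))\<close>, a nonzero torsion point
  satisfies \<open>z g(z) = - \<pi>\<close> with \<open>g(z)\<close> integral.\<close>

lemma torsion_le: assumes z: "0 < v z" "z \<noteq> 0" "ac \<pi> z = 0" shows "v z \<le> 1"
proof (rule ccontr)
  assume gt: "\<not> v z \<le> 1"
  obtain m where m: "v z = ereal m" using v_real[OF z(2)] by blast
  have m1: "1 < m" using gt m by (simp add: one_ereal_def)
  define h where "h = fps_shift 1 (act H \<pi>)"
  define g where "g = fps_shift 1 h"
  have ih: "int1 h" and ig: "int1 g" using int_f by (simp_all add: h_def g_def fps_all_def)
  have f: "act H \<pi> = fps_X * h" using f_0 by (auto simp: h_def fps_eq_iff)
  have h: "h = fps_const \<pi> + fps_X * g" using act_1[OF O_pi] by (auto simp: h_def g_def fps_eq_iff)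
  interpret e: hom_pred int1 "\<lambda>f. ev f z" by (rule ev_hom[OF z(1)])
  have ic: "int1 (fps_const \<pi>)" using v_pi by (simp add: fps_all_def int0_def)
  have iX: "int1 fps_X" by (simp add: fps_all_def int0_def fps_X_def)
  have "ac \<pi> z = z * ev h z" unfolding f using ev_X_mult[OF ih z(1)] .
  then have "ev h z = 0" using z by simp
  moreover have "ev h z = \<pi> + z * ev g z"
    unfolding h using e.h_add[OF ic i1.I_mult[OF iX ig]] ev_X_mult[OF ig z(1)] by simp
  ultimately have "z * ev g z = - \<pi>" by (simp add: eq_neg_iff_add_eq_0 add.commute)
  then have "v z + v (ev g z) = 1" using v_pi v_mult[of z "ev g z"] by simp
  moreover have "0 \<le> v (ev g z)" using ev_int[OF ig z(1)] by (simp add: int0_def)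
  ultimately show False using m m1 by (cases "v (ev g z)") (auto simp: one_ereal_def)
qed

end

section \<open>Joins of homothety classes and their transport\<close>

context dv_vector_space
begin

text \<open>This is \<open>[A] \<or> [B]\<close>: up to homothety, only the first lattice has to be scaled.\<close>

definition joins :: "'a set \<Rightarrow> 'a set \<Rightarrow> 'a set set set" where
  "joins A B = {hc (scale c A <+>\<^bsub>M\<^esub> B) |c. c \<in> F - {0}}"

lemma hc_set_sum_scale:
  assumes "A \<subseteq> carrier M" "B \<subseteq> carrier M" "c \<in> F" "d \<in> F" "d \<noteq> 0"
  shows "hc (scale c A <+>\<^bsub>M\<^esub> scale d B) = hc (scale (c * inverse d) A <+>\<^bsub>M\<^esub> B)"
proof -
  have cd: "c * inverse d \<in> F" using assms F_mult F_inverse by blast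
  have "scale d (scale (c * inverse d) A) = scale c A"
  proof -
    have "d * (c * inverse d) = c" using assms(5) by simp
    then show ?thesis using scale_scale[OF assms(4) cd assms(1)] by (simp only:)
  qed
  then have "scale c A <+>\<^bsub>M\<^esub> scale d B = scale d (scale (c * inverse d) A <+>\<^bsub>M\<^esub> B)"
    using scale_set_sum[OF assms(4) scale_closed[OF cd assms(1)] assms(2)] by simp
  then show ?thesis
    using hc_scale[OF assms(4,5) set_sum_closed[OF scale_closed[OF cd assms(1)] assms(2)]] by simp
qed

lemma hc_sum_mem_joins:
  assumes "A \<subseteq> carrier M" "B \<subseteq> carrier M" "c \<in> F" "c \<noteq> 0" "d \<in> F" "d \<noteq> 0"
  shows "hc (scale c A <+>\<^bsub>M\<^esub> scale d B) \<in> joins A B"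
  unfolding hc_set_sum_scale[OF assms(1,2,3,5,6)] joins_def
  using assms F_mult F_inverse by (intro CollectI exI[of _ "c * inverse d"]) simp

lemma joins_scale:
  assumes A: "A \<subseteq> carrier M" and B: "B \<subseteq> carrier M" and a: "a \<in> F" "a \<noteq> 0" and b: "b \<in> F" "b \<noteq> 0"
  shows "joins (scale a A) (scale b B) = joins A B"
proof (intro equalityI subsetI)
  fix Y assume "Y \<in> joins (scale a A) (scale b B)"
  then obtain c where c: "c \<in> F" "c \<noteq> 0" "Y = hc (scale c (scale a A) <+>\<^bsub>M\<^esub> scale b B)"
    by (auto simp: joins_def)
  then have "Y = hc (scale (c * a) A <+>\<^bsub>M\<^esub> scale b B)" using scale_scale[OF c(1) a(1) A] by simp
  then show "Y \<in> joins A B" using hc_sum_mem_joins[OF A B _ _ b, of "c * a"] c a F_mult by simp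
next
  fix Y assume "Y \<in> joins A B"
  then obtain c where c: "c \<in> F" "c \<noteq> 0" "Y = hc (scale c A <+>\<^bsub>M\<^esub> B)" by (auto simp: joins_def)
  define d where "d = b * c * inverse a"
  have d: "d \<in> F" "d \<noteq> 0" using a b c F_mult F_inverse by (simp_all add: d_def)
  have "scale d (scale a A) = scale (b * c) A"
  proof -
    have "d * a = b * c" using a by (simp add: d_def)
    then show ?thesis using scale_scale[OF d(1) a(1) A] by (simp only:)
  qed
  then have "hc (scale d (scale a A) <+>\<^bsub>M\<^esub> scale b B) = hc (scale (b * c * inverse b) A <+>\<^bsub>M\<^esub> B)"
    using hc_set_sum_scale[OF A B F_mult[OF b(1) c(1)] b] by simp
  also have "b * c * inverse b = c" using b by simp
  also have "hc (scale c A <+>\<^bsub>M\<^esub> B) = Y" using c(3) by simp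
  finally show "Y \<in> joins (scale a A) (scale b B)" using d unfolding joins_def by blast
qed

lemma joins_cong:
  assumes "A \<subseteq> carrier M" "B \<subseteq> carrier M" "A' \<subseteq> carrier M" "B' \<subseteq> carrier M" "hc A = hc A'" "hc B = hc B'"
  shows "joins A B = joins A' B'"
proof -
  obtain a where a: "a \<in> F" "a \<noteq> 0" "A = scale a A'" using hc_eqD[OF assms(5,1)] by blast
  obtain b where b: "b \<in> F" "b \<noteq> 0" "B = scale b B'" using hc_eqD[OF assms(6,2)] by blast
  show ?thesis unfolding a(3) b(3) by (rule joins_scale[OF assms(3,4) a(1,2) b(1,2)])
qed

lemma lattice_closed: assumes "is_lattice v F M \<Lambda>" shows "\<Lambda> \<subseteq> carrier M"
proof -
  obtain d e where e: "is_basis F M d e" "\<Lambda> = O_span v F M d e" using assms by (auto simp: is_lattice_def)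
  then have eC: "\<forall>i<d. e i \<in> carrier M" by (simp add: is_basis_def)
  show ?thesis unfolding e(2) O_span_eq_sp[OF eC] by (rule sp_closed[OF eC])
qed

text \<open>The definition of the join quantifies over lattices; the basis shows that the scaled
  sets are lattices indeed.\<close>

lemma vertex_join_eq_joins:
  assumes b: "is_basis F M d e" and A: "A = sp d e a" and B: "B = sp d e b"
  shows "vertex_join v F M (hc A) (hc B) = joins A B"
proof -
  have e: "\<forall>i<d. e i \<in> carrier M" using b by (simp add: is_basis_def)
  have cl: "A \<subseteq> carrier M" "B \<subseteq> carrier M" unfolding A B by (rule sp_closed[OF e])+
  show ?thesis
  proof (intro equalityI subsetI)
    fix Y assume "Y \<in> vertex_join v F M (hc A) (hc B)"
    then obtain L1 L2 where L: "is_lattice v F M L1" "is_lattice v F M L2" "hc L1 = hc A" "hc L2 = hc B"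
      "Y = hc (L1 <+>\<^bsub>M\<^esub> L2)" by (auto simp: vertex_join_def)
    obtain c where c: "c \<in> F" "c \<noteq> 0" "L1 = scale c A" using hc_eqD[OF L(3) lattice_closed[OF L(1)]] by blast
    obtain d where d: "d \<in> F" "d \<noteq> 0" "L2 = scale d B" using hc_eqD[OF L(4) lattice_closed[OF L(2)]] by blast
    show "Y \<in> joins A B" unfolding L(5) c(3) d(3) by (rule hc_sum_mem_joins[OF cl c(1,2) d(1,2)])
  next
    fix Y assume "Y \<in> joins A B"
    then obtain c where c: "c \<in> F" "c \<noteq> 0" "Y = hc (scale c A <+>\<^bsub>M\<^esub> B)" by (auto simp: joins_def)
    obtain k where "v c = ereal (of_int k)" using F_val[OF c(1,2)] by blast
    then have "scale c A = sp d e (\<lambda>i. a i + k)" unfolding A by (rule scale_sp[OF e c(1)])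
    then have "is_lattice v F M (scale c A)" using is_lattice_sp[OF b] by simp
    moreover have "is_lattice v F M B" unfolding B by (rule is_lattice_sp[OF b])
    moreover have "hc (scale c A) = hc A" by (rule hc_scale[OF c(1,2) cl(1)])
    ultimately show "Y \<in> vertex_join v F M (hc A) (hc B)" unfolding c(3) vertex_join_def by blast
  qed
qed

lemma set_sum_absorb:
  assumes A: "submod A" and B: "B \<subseteq> A" "\<zero> \<in> B" shows "A <+>\<^bsub>M\<^esub> B = A"
proof (intro equalityI subsetI)
  fix x assume "x \<in> A <+>\<^bsub>M\<^esub> B"
  then obtain a b where "a \<in> A" "b \<in> B" "x = a \<oplus> b" unfolding set_sum_iff by blast
  then show "x \<in> A" using submodD(4)[OF A] B by blast
next
  fix x assume x: "x \<in> A"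
  then have "x = x \<oplus> \<zero>" using submodD(2)[OF A] by simp
  then show "x \<in> A <+>\<^bsub>M\<^esub> B" unfolding set_sum_iff using x B(2) by blast
qed

text \<open>For integral \<open>c\<close> the lattice \<open>c B\<close> disappears into
  \<open>B\<close>. Repeating the operation that sends \<open>A\<close> to
  \<open>\<pi> A + T\<close> therefore yields \<open>\<pi> ^ k A + T\<close>.\<close>

lemma set_sum_scale_absorb:
  assumes A: "submod A" and B: "submod B" and c: "c \<in> \<O>"
  shows "scale c (A <+>\<^bsub>M\<^esub> B) <+>\<^bsub>M\<^esub> B = scale c A <+>\<^bsub>M\<^esub> B"
proof (intro equalityI subsetI)
  note cl = submodD(2)[OF A] submodD(2)[OF B] O_F[OF c]
  fix x
  {
    assume "x \<in> scale c (A <+>\<^bsub>M\<^esub> B) <+>\<^bsub>M\<^esub> B"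
    then obtain w b' where w: "w \<in> A <+>\<^bsub>M\<^esub> B" "b' \<in> B" "x = c \<odot> w \<oplus> b'"
      using set_sum_iff[of x "scale c (A <+>\<^bsub>M\<^esub> B)" B] by blast
    obtain a b where ab: "a \<in> A" "b \<in> B" "w = a \<oplus> b" using w(1) set_sum_iff[of w A B] by blast
    have "x = c \<odot> a \<oplus> (c \<odot> b \<oplus> b')" unfolding w(3) ab(3) using ab w(2) cl by (simp add: smult_add_right a_assoc)
    moreover have "c \<odot> b \<oplus> b' \<in> B" using submodD(4,5)[OF B] c ab w(2) by simp
    ultimately show "x \<in> scale c A <+>\<^bsub>M\<^esub> B" unfolding set_sum_iff using ab(1) by blast
  next
    assume "x \<in> scale c A <+>\<^bsub>M\<^esub> B"
    then obtain a b where ab: "a \<in> A" "b \<in> B" "x = c \<odot> a \<oplus> b" unfolding set_sum_iff by blast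
    have "a = a \<oplus> \<zero>" using ab cl by simp
    then have "a \<in> A <+>\<^bsub>M\<^esub> B" unfolding set_sum_iff using ab(1) submodD(3)[OF B] by blast
    then show "x \<in> scale c (A <+>\<^bsub>M\<^esub> B) <+>\<^bsub>M\<^esub> B"
      using set_sum_iff[of x "scale c (A <+>\<^bsub>M\<^esub> B)" B] ab(2,3) by blast
  }
qed

end

text \<open>Joins are made of homotheties and sums only, and these are respected by every linear
  isomorphism. This is what the determination of the vertices rests on.\<close>

lemma linear_iso_joins:
  assumes M: "dv_vector_space v F \<pi> M" and M': "dv_vector_space v F \<pi> M'" and iso: "linear_iso F M M' \<phi>"
    and A: "A \<subseteq> carrier M" and B: "B \<subseteq> carrier M"
  shows "vertex_image \<phi> ` dv_vector_space.joins F M A B = dv_vector_space.joins F M' (\<phi> ` A) (\<phi> ` B)"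
    and "vertex_image \<phi> (homothety_class F M A) = homothety_class F M' (\<phi> ` A)"
    and "\<phi> ` A \<subseteq> carrier M'"
proof -
  interpret M: dv_vector_space v F \<pi> M by fact
  interpret M': dv_vector_space v F \<pi> M' by fact
  have bij: "bij_betw \<phi> (carrier M) (carrier M')"
    and add: "\<And>x y. x \<in> carrier M \<Longrightarrow> y \<in> carrier M \<Longrightarrow> \<phi> (x \<oplus>\<^bsub>M\<^esub> y) = \<phi> x \<oplus>\<^bsub>M'\<^esub> \<phi> y"
    and smult: "\<And>c x. c \<in> F \<Longrightarrow> x \<in> carrier M \<Longrightarrow> \<phi> (c \<odot>\<^bsub>M\<^esub> x) = c \<odot>\<^bsub>M'\<^esub> \<phi> x"
    using iso by (auto simp: linear_iso_def)
  show cl: "\<phi> ` A \<subseteq> carrier M'" using A bij by (auto simp: bij_betw_def)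
  have scale: "\<phi> ` M.scale c D = M'.scale c (\<phi> ` D)" if "c \<in> F" "D \<subseteq> carrier M" for c D
    unfolding image_image using that smult by (intro image_cong refl) auto
  have sum: "\<phi> ` (D <+>\<^bsub>M\<^esub> E) = \<phi> ` D <+>\<^bsub>M'\<^esub> \<phi> ` E" if D: "D \<subseteq> carrier M" and E: "E \<subseteq> carrier M" for D E
  proof (intro equalityI subsetI)
    fix y
    {
      assume "y \<in> \<phi> ` (D <+>\<^bsub>M\<^esub> E)"
      then obtain w where w: "w \<in> D <+>\<^bsub>M\<^esub> E" "y = \<phi> w" by blast
      obtain a b where "a \<in> D" "b \<in> E" "w = a \<oplus>\<^bsub>M\<^esub> b" using w(1) unfolding M.set_sum_iff by blast
      with w have ab: "a \<in> D" "b \<in> E" "y = \<phi> (a \<oplus>\<^bsub>M\<^esub> b)" by simp_all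
      then have "y = \<phi> a \<oplus>\<^bsub>M'\<^esub> \<phi> b" using add D E by blast
      then show "y \<in> \<phi> ` D <+>\<^bsub>M'\<^esub> \<phi> ` E" unfolding M'.set_sum_iff using ab by blast
    next
      assume "y \<in> \<phi> ` D <+>\<^bsub>M'\<^esub> \<phi> ` E"
      then obtain a b where ab: "a \<in> D" "b \<in> E" "y = \<phi> a \<oplus>\<^bsub>M'\<^esub> \<phi> b" unfolding M'.set_sum_iff by blast
      then have "y = \<phi> (a \<oplus>\<^bsub>M\<^esub> b)" using add D E by (metis subsetD)
      moreover have "a \<oplus>\<^bsub>M\<^esub> b \<in> D <+>\<^bsub>M\<^esub> E" unfolding M.set_sum_iff using ab by blast
      ultimately show "y \<in> \<phi> ` (D <+>\<^bsub>M\<^esub> E)" by blast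
    }
  qed
  have hc: "vertex_image \<phi> (M.hc D) = M'.hc (\<phi> ` D)" if D: "D \<subseteq> carrier M" for D
  proof -
    have "vertex_image \<phi> (M.hc D) = {\<phi> ` M.scale c D |c. c \<in> F - {0}}"
      unfolding vertex_image_def homothety_class_def by blast
    also have "\<dots> = {M'.scale c (\<phi> ` D) |c. c \<in> F - {0}}" 
      by (intro Collect_cong iff_exI rev_conj_cong refl) (simp add: scale[OF _ D])
    finally show ?thesis by (simp add: homothety_class_def)
  qed
  then show "vertex_image \<phi> (M.hc A) = M'.hc (\<phi> ` A)" using A by blast
  have key: "vertex_image \<phi> (M.hc (M.scale c A <+>\<^bsub>M\<^esub> B)) = M'.hc (M'.scale c (\<phi> ` A) <+>\<^bsub>M'\<^esub> \<phi> ` B)"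
    if c: "c \<in> F" for c
    unfolding hc[OF M.set_sum_closed[OF M.scale_closed[OF c A] B]] sum[OF M.scale_closed[OF c A] B]
      scale[OF c A] ..
  show "vertex_image \<phi> ` M.joins A B = M'.joins (\<phi> ` A) (\<phi> ` B)"
  proof (intro equalityI subsetI)
    fix Y
    {
      assume "Y \<in> vertex_image \<phi> ` M.joins A B"
      then obtain c where "c \<in> F - {0}" "Y = vertex_image \<phi> (M.hc (M.scale c A <+>\<^bsub>M\<^esub> B))"
        unfolding M.joins_def by blast
      then show "Y \<in> M'.joins (\<phi> ` A) (\<phi> ` B)" unfolding M'.joins_def using key by blast
    next
      assume "Y \<in> M'.joins (\<phi> ` A) (\<phi> ` B)"
      then obtain c where c: "c \<in> F - {0}" "Y = M'.hc (M'.scale c (\<phi> ` A) <+>\<^bsub>M'\<^esub> \<phi> ` B)"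
        unfolding M'.joins_def by blast
      then have "Y = vertex_image \<phi> (M.hc (M.scale c A <+>\<^bsub>M\<^esub> B))" using key by simp
      moreover have "M.hc (M.scale c A <+>\<^bsub>M\<^esub> B) \<in> M.joins A B" unfolding M.joins_def using c(1) by blast
      ultimately show "Y \<in> vertex_image \<phi> ` M.joins A B" by blast
    }
  qed
qed

context tate
begin

subsection \<open>The ramification filtration\<close>

abbreviation "\<F> \<mu> \<equiv> Fil v \<pi> H \<mu>"

abbreviation "T \<equiv> \<F> \<infinity>"

lemma mem_Fil: "x \<in> \<F> \<mu> \<longleftrightarrow> x \<in> carrier V \<and> \<mu> \<le> v (x 0)"
  by (simp add: Fil_def)

lemma mem_T: "x \<in> T \<longleftrightarrow> x \<in> carrier V \<and> x 0 = 0"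
  by (auto simp: mem_Fil)

lemma Fil_closed: "\<F> \<mu> \<subseteq> carrier V"
  by (auto simp: mem_Fil)

lemma submod_Fil: assumes \<mu>: "0 < \<mu>" shows "submod (\<F> \<mu>)"
  unfolding submod_def
proof (intro conjI ballI)
  show "\<F> \<mu> \<subseteq> carrier V" by (rule Fil_closed)
  show "\<zero>\<^bsub>V\<^esub> \<in> \<F> \<mu>" using zero_closed by (simp add: mem_Fil V_zero)
  fix x assume x: "x \<in> \<F> \<mu>"
  then have xC: "x \<in> carrier V" by (simp add: mem_Fil)
  {
    fix y assume y: "y \<in> \<F> \<mu>"
    then have yC: "y \<in> carrier V" by (simp add: mem_Fil)
    have "\<mu> \<le> v (pl (x 0) (y 0))"
    proof (cases "x 0 = 0 \<or> y 0 = 0")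
      case True
      then show ?thesis using x y pl_zero V_pos[OF xC] V_pos[OF yC] by (auto simp: mem_Fil)
    next
      case False
      then obtain r s where rs: "v (x 0) = ereal r" "v (y 0) = ereal s" using v_real by metis
      then have "ereal (min r s) \<le> v (pl (x 0) (y 0))"
        using V_pos[OF xC, of 0] V_pos[OF yC, of 0] by (intro pl_ge) auto
      moreover have "\<mu> \<le> ereal (min r s)" using x y rs by (auto simp: mem_Fil min_def)
      ultimately show ?thesis by (rule order_trans[rotated])
    qed
    then show "x \<oplus>\<^bsub>V\<^esub> y \<in> \<F> \<mu>" using xC yC by (simp add: mem_Fil V_add)
  next
    fix c assume c: "c \<in> \<O>"
    show "c \<odot>\<^bsub>V\<^esub> x \<in> \<F> \<mu>"
      using x xC ac_ge[OF c V_pos[OF xC]] O_F[OF c] by (auto simp: mem_Fil V_smult_int[OF c xC] intro: order_trans)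
  }
qed

lemma submod_T: "submod T"
  by (rule submod_Fil) simp

lemma Fil_antimono: "\<mu> \<le> \<nu> \<Longrightarrow> \<F> \<nu> \<subseteq> \<F> \<mu>"
  by (auto simp: mem_Fil intro: order_trans)

lemma T_sub_Fil: "T \<subseteq> \<F> \<mu>"
  by (rule Fil_antimono) simp

text \<open>The valuation of \<open>\<pi>\<^sup>-\<^sup>k x\<close>, rescaled by \<open>Q\<^sup>k\<close>, is constant for large \<open>k\<close>; its value is the
  inverse of a norm on \<open>V\<close>, and its superlevel sets are the \<open>Fil\<^sub>\<mu>\<close> for \<open>\<mu> \<le> \<epsilon>\<close>.\<close>

definition al :: "(int \<Rightarrow> 'k) \<Rightarrow> ereal" where
  "al x = (if x = \<zero>\<^bsub>V\<^esub> then \<infinity> else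
     (let k = (LEAST k::nat. v (x (int k)) < ereal \<epsilon>) in ereal (real Q ^ k) * v (x (int k))))"

text \<open>If the next term were at least \<open>\<epsilon>\<close>, applying
  \<open>[\<pi>]\<close> to it would give at least \<open>Q \<epsilon>\<close>. So once a sequence
  has dropped below \<open>\<epsilon>\<close> it stays there, and its valuations are divided by
  \<open>Q\<close> at each place.\<close>

lemma V_small_Suc:
  assumes x: "x \<in> carrier V" and less: "v (x i) < ereal \<epsilon>"
  shows "v (x (i + 1)) < ereal \<epsilon>" "v (x i) = ereal (real Q) * v (x (i + 1))"
proof -
  have "1 * \<epsilon> \<le> real Q * \<epsilon>" using Q_ge eps_pos by (intro mult_right_mono) auto
  then have le: "ereal \<epsilon> \<le> ereal (real Q * \<epsilon>)" by simp
  show 1: "v (x (i + 1)) < ereal \<epsilon>"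
  proof (rule ccontr)
    assume "\<not> ?thesis"
    then have "ereal (real Q * \<epsilon>) \<le> v (x i)"
      using ac_pi_large[of "x (i + 1)"] unfolding V_step[OF x] by simp
    then have "ereal \<epsilon> \<le> v (x i)" by (rule order_trans[OF le])
    then show False using less by simp
  qed
  show "v (x i) = ereal (real Q) * v (x (i + 1))"
    using ac_pi_small[OF V_pos[OF x] 1] V_step[OF x, of i] by simp
qed

lemma V_small_mono:
  assumes x: "x \<in> carrier V" and less: "v (x (int k)) < ereal \<epsilon>" and "k \<le> l"
  shows "v (x (int l)) < ereal \<epsilon> \<and> ereal (real Q ^ l) * v (x (int l)) = ereal (real Q ^ k) * v (x (int k))"
  using assms(3)
proof (induction l rule: dec_induct)
  case base
  then show ?case using less by simp
next
  case (step l)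
  have "v (x (int l + 1)) < ereal \<epsilon>" "v (x (int l)) = ereal (real Q) * v (x (int l + 1))"
    using V_small_Suc[OF x] step.IH by blast+
  moreover have "ereal (real Q ^ Suc l) * v (x (int l + 1)) = ereal (real Q ^ l) * (ereal (real Q) * v (x (int l + 1)))"
    by (simp add: mult.assoc[symmetric] mult.commute)
  ultimately show ?case using step.IH by (simp add: add.commute)
qed

lemma al_eq:
  assumes x: "x \<in> carrier V" and less: "v (x (int k)) < ereal \<epsilon>"
  shows "al x = ereal (real Q ^ k) * v (x (int k))"
proof -
  define k0 where "k0 = (LEAST k::nat. v (x (int k)) < ereal \<epsilon>)"
  have k0: "v (x (int k0)) < ereal \<epsilon>" "k0 \<le> k" unfolding k0_def using less by (auto intro: LeastI Least_le)
  have "x \<noteq> \<zero>\<^bsub>V\<^esub>" using less by (auto simp: V_zero)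
  then have "al x = ereal (real Q ^ k0) * v (x (int k0))" by (simp add: al_def k0_def Let_def)
  then show ?thesis using V_small_mono[OF x k0] by simp
qed

text \<open>Otherwise every term is the image, under arbitrarily many applications of
  \<open>[\<pi>]\<close>, of a point of valuation at least \<open>\<epsilon>\<close>. Each
  application adds \<open>\<epsilon>\<close>, so all terms vanish.\<close>

lemma V_eventually_small:
  assumes x: "x \<in> carrier V" and nz: "x \<noteq> \<zero>\<^bsub>V\<^esub>" obtains K where "\<And>k. K \<le> k \<Longrightarrow> v (x (int k)) < ereal \<epsilon>"
proof -
  have "\<exists>k. v (x (int k)) < ereal \<epsilon>"
  proof (rule ccontr)
    assume "\<not> ?thesis"
    then have ge: "ereal \<epsilon> \<le> v (x (int k))" for k by (simp add: not_less)
    have "x i = 0" for i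
    proof (rule v_eqI)
      fix C :: real
      obtain N where N: "\<And>n. N \<le> n \<Longrightarrow> C \<le> real n * \<epsilon>" using archimedean_bound[OF eps_pos] by blast
      define j where "j = max N (nat (- i))"
      have "i + int j = int (nat (i + int j))" by (simp add: j_def)
      then have "ereal \<epsilon> \<le> v (x (i + int j))" using ge by metis
      then have "ereal (\<epsilon> + real j * \<epsilon>) \<le> v (x i)" by (rule V_shift_ge[OF x])
      moreover have "C \<le> \<epsilon> + real j * \<epsilon>" using N[of j] eps_pos by (simp add: j_def)
      ultimately show "ereal C \<le> v (x i - 0)" by (simp add: order_trans[of _ "ereal (\<epsilon> + real j * \<epsilon>)"])
    qed
    then show False using nz by (simp add: V_zero fun_eq_iff)
  qed
  then obtain K where "v (x (int K)) < ereal \<epsilon>" by blast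
  then have "v (x (int k)) < ereal \<epsilon>" if "K \<le> k" for k using V_small_mono[OF x _ that] by blast
  then show ?thesis by (rule that)
qed

text \<open>Torsion points have bounded valuation, so those of valuation at least \<open>\<epsilon>\<close> have bounded order.\<close>

definition torsion_exponent :: nat where "torsion_exponent = (SOME m. 1 < \<epsilon> + real m * \<epsilon>)"

lemma torsion_exponent: "1 < \<epsilon> + real torsion_exponent * \<epsilon>"
  unfolding torsion_exponent_def
proof (rule someI_ex)
  obtain N where N: "\<And>n. N \<le> n \<Longrightarrow> 1 \<le> real n * \<epsilon>" using archimedean_bound[OF eps_pos] by blast
  show "\<exists>m. 1 < \<epsilon> + real m * \<epsilon>" using N[of N] eps_pos by (intro exI[of _ N]) simp
qed

lemma V_bounded_order:
  assumes x: "x \<in> carrier V" and ge: "ereal \<epsilon> \<le> v (x i)" shows "x (i - int torsion_exponent) = 0"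
proof (rule ccontr)
  assume nz: "x (i - int torsion_exponent) \<noteq> 0"
  obtain N where N: "\<forall>i<N. x i = 0" using x by (auto simp: mem_V)
  define P where "P j \<longleftrightarrow> x (i - int j) \<noteq> 0" for j
  have Pm: "P torsion_exponent" using nz by (simp add: P_def)
  have bound: "j \<le> nat (i - N)" if "P j" for j using that N by (force simp: P_def)
  \<comment> \<open>Going down from \<open>i\<close>, this is the last nonzero place. Its term is
    killed by \<open>[\<pi>]\<close>, so its valuation is at most 1, which is impossible so far
    below \<open>i\<close>.\<close>
  define j where "j = (GREATEST j. P j)"
  have Pj: "P j" unfolding j_def by (rule GreatestI_nat[of P torsion_exponent]) (use Pm bound in auto)
  have jm: "torsion_exponent \<le> j" unfolding j_def by (rule Greatest_le_nat[of P torsion_exponent]) (use Pm bound in auto)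
  have "\<not> P (Suc j)"
  proof
    assume "P (Suc j)"
    then have "Suc j \<le> j" unfolding j_def by (rule Greatest_le_nat[of P]) (use bound in auto)
    then show False by simp
  qed
  moreover have "(i - int (Suc j)) + 1 = i - int j" by simp
  ultimately have "ac \<pi> (x (i - int j)) = 0" using V_step[OF x, of "i - int (Suc j)"] by (simp add: P_def)
  then have "v (x (i - int j)) \<le> 1" using torsion_le V_pos[OF x] Pj by (simp add: P_def)
  moreover have "ereal (\<epsilon> + real j * \<epsilon>) \<le> v (x (i - int j))" using ge by (intro V_shift_ge[OF x]) simp
  ultimately have "ereal (\<epsilon> + real j * \<epsilon>) \<le> 1" by (rule order_trans[rotated])
  then have "\<epsilon> + real j * \<epsilon> \<le> 1" by (simp add: one_ereal_def)
  moreover have "real torsion_exponent * \<epsilon> \<le> real j * \<epsilon>" using jm eps_pos by (intro mult_right_mono) auto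
  ultimately show False using torsion_exponent by simp
qed

definition tors :: "nat \<Rightarrow> 'k set" where "tors m = {z. 0 < v z \<and> ac (\<pi> ^ m) z = 0}"

text \<open>The fibres of \<open>[\<pi>]\<close> are translates of its kernel, and the kernel
  consists of the finitely many zeros of the series.\<close>

lemma finite_tors: "finite (tors m)"
proof (induction m)
  case 0
  have "tors 0 \<subseteq> {0}" using ac_one by (auto simp: tors_def)
  then show ?case using finite_subset by blast
next
  case (Suc m)
  have fib: "finite {z. 0 < v z \<and> ac \<pi> z = y}" for y
  proof (cases "{z. 0 < v z \<and> ac \<pi> z = y} = {}")
    case False
    then obtain z0 where z0: "0 < v z0" "ac \<pi> z0 = y" by blast
    have m: "-1 \<in> \<O>" using O_uminus[OF O_1] by simp
    note n0 = ac_pos[OF m z0(1)]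
    have "(\<lambda>z. pl z (ac (-1) z0)) ` {z. 0 < v z \<and> ac \<pi> z = y} \<subseteq> {z. 0 < v z \<and> ac \<pi> z = 0}"
    proof safe
      fix z assume z: "0 < v z" "y = ac \<pi> z"
      show "0 < v (pl z (ac (- 1) z0))" by (rule pl_pos[OF z(1) n0])
      have "ac \<pi> (pl z (ac (-1) z0)) = pl (ac \<pi> z) (ac (-1) (ac \<pi> z0))"
        using ac_pl[OF O_pi z(1) n0] ac_mult[OF O_pi m z0(1)] ac_mult[OF m O_pi z0(1)] by (metis mult.commute)
      also have "\<dots> = 0" using z z0 ac_inverse(2)[OF ac_pos[OF O_pi z0(1)]] by simp
      finally show "ac \<pi> (pl z (ac (-1) z0)) = 0" .
    qed
    moreover have "inj_on (\<lambda>z. pl z (ac (-1) z0)) {z. 0 < v z \<and> ac \<pi> z = y}"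
      using pl_cancel[OF _ n0] by (auto intro!: inj_onI)
    ultimately show ?thesis using inj_on_finite finite_zeros by blast
  next
    case True
    show ?thesis unfolding True by simp
  qed
  have "tors (Suc m) \<subseteq> (\<Union>y\<in>tors m. {z. 0 < v z \<and> ac \<pi> z = y})"
  proof
    fix z assume z: "z \<in> tors (Suc m)"
    then have "ac (\<pi> ^ m) (ac \<pi> z) = 0" "0 < v z"
      using ac_mult[OF O_power[OF O_pi] O_pi, of z m] by (simp_all add: tors_def mult.commute)
    then show "z \<in> (\<Union>y\<in>tors m. {z. 0 < v z \<and> ac \<pi> z = y})"
      using ac_pos[OF O_pi] by (auto simp: tors_def)
  qed
  then show ?case using Suc fib finite_subset by blast
qed

lemma V_tors: assumes x: "x \<in> carrier V" and z: "x (i - int m) = 0" shows "x i \<in> tors m"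
proof -
  have "ac (\<pi> ^ m) (x (i - int m + int m)) = x (i - int m)" by (rule V_power[OF x])
  then show ?thesis using z V_pos[OF x, of i] by (simp add: tors_def)
qed

end

section \<open>The inverse norm on the rational Tate module\<close>

context tate
begin

lemma al_zero: "al \<zero>\<^bsub>V\<^esub> = \<infinity>"
  by (simp add: al_def)

lemma al_nonzero:
  assumes x: "x \<in> carrier V" "x \<noteq> \<zero>\<^bsub>V\<^esub>"
  shows "0 < al x" "al x < \<infinity>"
proof -
  obtain K where K: "\<And>k. K \<le> k \<Longrightarrow> v (x (int k)) < ereal \<epsilon>" using V_eventually_small[OF x] by blast
  obtain r where r: "v (x (int K)) = ereal r" using K[of K] V_pos[OF x(1), of "int K"]
    by (cases "v (x (int K))") auto
  have "0 < r" using V_pos[OF x(1), of "int K"] r by simp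
  then show "0 < al x" "al x < \<infinity>" using al_eq[OF x(1) K[of K]] r Q_ge by simp_all
qed

lemma al_add: assumes x: "x \<in> carrier V" and y: "y \<in> carrier V" shows "min (al x) (al y) \<le> al (x \<oplus>\<^bsub>V\<^esub> y)"
proof -
  consider "x = \<zero>\<^bsub>V\<^esub>" | "y = \<zero>\<^bsub>V\<^esub>" | "x \<oplus>\<^bsub>V\<^esub> y = \<zero>\<^bsub>V\<^esub>"
    | "x \<noteq> \<zero>\<^bsub>V\<^esub>" "y \<noteq> \<zero>\<^bsub>V\<^esub>" "x \<oplus>\<^bsub>V\<^esub> y \<noteq> \<zero>\<^bsub>V\<^esub>" by blast
  then show ?thesis
  proof cases
    case 1 then show ?thesis using y by simp
  next
    case 2 then show ?thesis using x by simp
  next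
    case 3 then show ?thesis by (simp add: al_zero)
  next
    case 4
    have xy: "x \<oplus>\<^bsub>V\<^esub> y \<in> carrier V" using x y by simp
    obtain K1 where K1: "\<And>k. K1 \<le> k \<Longrightarrow> v (x (int k)) < ereal \<epsilon>" using V_eventually_small[OF x 4(1)] by blast
    obtain K2 where K2: "\<And>k. K2 \<le> k \<Longrightarrow> v (y (int k)) < ereal \<epsilon>" using V_eventually_small[OF y 4(2)] by blast
    obtain K3 where K3: "\<And>k. K3 \<le> k \<Longrightarrow> v ((x \<oplus>\<^bsub>V\<^esub> y) (int k)) < ereal \<epsilon>"
      using V_eventually_small[OF xy 4(3)] by blast
    define k where "k = max K1 (max K2 K3)"
    have k: "K1 \<le> k" "K2 \<le> k" "K3 \<le> k" by (simp_all add: k_def)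
    define a b where "a = v (x (int k))" and "b = v (y (int k))"
    have pos: "0 < a" "0 < b" unfolding a_def b_def using V_pos[OF x] V_pos[OF y] by blast+
    have "a < ereal \<epsilon>" "b < ereal \<epsilon>" unfolding a_def b_def using K1[OF k(1)] K2[OF k(2)] by blast+
    then obtain r s where rs: "a = ereal r" "b = ereal s" using pos by (cases a; cases b) auto
    have "ereal (min r s) \<le> v (pl (x (int k)) (y (int k)))"
      using rs pos by (intro pl_ge) (auto simp flip: a_def b_def)
    then have "min a b \<le> v ((x \<oplus>\<^bsub>V\<^esub> y) (int k))" using rs by (simp add: V_add min_def split: if_splits)
    then have le: "ereal (real Q ^ k) * min a b \<le> al (x \<oplus>\<^bsub>V\<^esub> y)"
      unfolding al_eq[OF xy K3[OF k(3)]] by (intro ereal_mult_left_mono) auto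
    have "min (al x) (al y) = ereal (real Q ^ k) * min a b"
      unfolding al_eq[OF x K1[OF k(1)]] al_eq[OF y K2[OF k(2)]] a_def[symmetric] b_def[symmetric] rs
      using Q_ge by (auto simp: min_def)
    then show ?thesis using le by simp
  qed
qed

lemma al_unit: assumes u: "u \<in> F" "v u = 0" and x: "x \<in> carrier V" shows "al (u \<odot>\<^bsub>V\<^esub> x) = al x"
proof (cases "x = \<zero>\<^bsub>V\<^esub>")
  case True
  then show ?thesis using u by simp
next
  case False
  obtain K where K: "\<And>k. K \<le> k \<Longrightarrow> v (x (int k)) < ereal \<epsilon>" using V_eventually_small[OF x False] by blast
  have uO: "u \<in> \<O>" using u by (simp add: O_iff)
  have ux: "u \<odot>\<^bsub>V\<^esub> x \<in> carrier V" using u x by simp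
  have eq: "v ((u \<odot>\<^bsub>V\<^esub> x) (int K)) = v (x (int K))"
    unfolding V_smult_int[OF uO x] by (rule v_ac_unit[OF u V_pos[OF x]])
  then have "v ((u \<odot>\<^bsub>V\<^esub> x) (int K)) < ereal \<epsilon>" using K[of K] by simp
  from al_eq[OF ux this] show ?thesis unfolding al_eq[OF x K[OF order_refl]] eq .
qed

lemma al_pi: assumes x: "x \<in> carrier V" shows "al (\<pi> \<odot>\<^bsub>V\<^esub> x) = ereal (real Q) * al x"
proof (cases "x = \<zero>\<^bsub>V\<^esub>")
  case True
  then show ?thesis using Q_ge by (simp add: al_zero)
next
  case False
  obtain K where K: "\<And>k. K \<le> k \<Longrightarrow> v (x (int k)) < ereal \<epsilon>" using V_eventually_small[OF x False] by blast
  have px: "\<pi> \<odot>\<^bsub>V\<^esub> x \<in> carrier V" using x by simp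
  have eq: "(\<pi> \<odot>\<^bsub>V\<^esub> x) (int (Suc K)) = x (int K)" unfolding V_pi[OF x] by simp
  have "v ((\<pi> \<odot>\<^bsub>V\<^esub> x) (int (Suc K))) < ereal \<epsilon>" unfolding eq using K by simp
  from al_eq[OF px this] show ?thesis
    unfolding al_eq[OF x K[OF order_refl]] eq by (simp add: mult.assoc[symmetric])
qed

text \<open>If the term at 0 is not small, let \<open>l\<close> be the last place before the
  sequence becomes small. Then \<open>al x = Q ^ l v(x l)\<close>, and \<open>v(x l)\<close> is
  still at least \<open>\<epsilon>\<close>, so both sides hold.\<close>

lemma al_ge_iff:
  assumes x: "x \<in> carrier V" and \<mu>: "\<mu> \<le> \<epsilon>" shows "ereal \<mu> \<le> al x \<longleftrightarrow> ereal \<mu> \<le> v (x 0)"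
proof (cases "v (x (int 0)) < ereal \<epsilon>")
  case True
  then show ?thesis using al_eq[OF x True] by (simp add: one_ereal_def[symmetric])
next
  case False
  then have "ereal \<epsilon> \<le> v (x 0)" by simp
  moreover have "ereal \<epsilon> \<le> al x"
  proof (cases "x = \<zero>\<^bsub>V\<^esub>")
    case True
    then show ?thesis by (simp add: al_zero)
  next
    case nz: False
    let ?P = "\<lambda>k. v (x (int k)) < ereal \<epsilon>"
    obtain K where "?P K" using V_eventually_small[OF x nz] by blast
    define k where "k = (LEAST k. ?P k)"
    have Pk: "?P k" unfolding k_def by (rule LeastI[of ?P, OF \<open>?P K\<close>])
    have "k \<noteq> 0" using Pk False by (cases k) auto
    then obtain l where l: "k = Suc l" using not0_implies_Suc by blast
    have "\<not> ?P l" using not_less_Least[of l ?P] l unfolding k_def by simp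
    then have ge: "ereal \<epsilon> \<le> v (x (int l))" by simp
    have kl: "int k = int l + 1" by (simp add: l)
    have "v (x (int l + 1)) < ereal \<epsilon>" using Pk unfolding kl .
    from ac_pi_small[OF V_pos[OF x] this] have "v (x (int l)) = ereal (real Q) * v (x (int k))"
      unfolding V_step[OF x] kl .
    then have "al x = ereal (real Q ^ l) * v (x (int l))"
      unfolding al_eq[OF x Pk] l by (simp add: mult.assoc[symmetric] mult.commute)
    moreover have "1 * v (x (int l)) \<le> ereal (real Q ^ l) * v (x (int l))"
      using Q_ge V_pos[OF x, of "int l"] by (intro ereal_mult_right_mono) (auto simp: one_ereal_def)
    ultimately have "v (x (int l)) \<le> al x" by simp
    with ge show ?thesis by (rule order_trans)
  qed
  moreover have "ereal \<mu> \<le> ereal \<epsilon>" using \<mu> by simp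
  ultimately show ?thesis using order_trans by blast
qed

text \<open>The term at 1 embeds \<open>T / \<pi> T\<close> into \<open>H[\<pi>]\<close>; it serves
  as the separating map \<open>t\<close> of \<open>normed_lattice\<close>.\<close>

lemma T_finite_torsion: "finite ((\<lambda>x. x 1) ` T)"
proof (rule finite_subset[OF _ finite_zeros])
  show "(\<lambda>x. x 1) ` T \<subseteq> {z. 0 < v z \<and> ac \<pi> z = 0}"
  proof
    fix z assume "z \<in> (\<lambda>x. x 1) ` T"
    then obtain x where xT: "z = x 1" "x \<in> T" by (rule imageE)
    then have x: "x \<in> carrier V" "x 0 = 0" by (simp_all only: mem_T)
    have "ac \<pi> (x 1) = 0" using V_step[OF x(1), of 0] x(2) by simp
    then show "z \<in> {z. 0 < v z \<and> ac \<pi> z = 0}" using V_pos[OF x(1), of 1] xT(1) by simp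
  qed
qed

lemma mem_pi_T: assumes x: "x \<in> carrier V" and z: "x 1 = 0" shows "x \<in> scale \<pi> T"
proof
  have pF: "\<pi> powi (-1) \<in> F" by (rule F_powi[OF pi_F])
  have "\<pi> powi (-1) = inverse \<pi>" by (simp add: power_int_minus)
  then show "x = \<pi> \<odot>\<^bsub>V\<^esub> (\<pi> powi (-1) \<odot>\<^bsub>V\<^esub> x)" using smult_cancel(2)[OF pi_F pi_nz x] by simp
  have "(\<pi> powi (-1) \<odot>\<^bsub>V\<^esub> x) 0 = 0" by (subst V_pi_powi[OF x]) (simp add: z)
  then show "\<pi> powi (-1) \<odot>\<^bsub>V\<^esub> x \<in> T" 
    unfolding mem_T by (rule conjI[OF smult_closed[OF pF x]])
qed

text \<open>Outside \<open>\<pi> T\<close> the term at 1 is nonzero, so the term at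
  \<open>torsion_exponent + 1\<close> must lie below \<open>\<epsilon>\<close>. There
  \<open>al\<close> can be read off, and that term belongs to a finite torsion set.\<close>

lemma T_finite_al: "finite (al ` (T - scale \<pi> T))"
proof (rule finite_subset)
  show "finite ((\<lambda>z. ereal (real Q ^ Suc torsion_exponent) * v z) ` tors (Suc torsion_exponent))" by (rule finite_imageI[OF finite_tors])
  show "al ` (T - scale \<pi> T) \<subseteq> (\<lambda>z. ereal (real Q ^ Suc torsion_exponent) * v z) ` tors (Suc torsion_exponent)"
  proof
    fix y assume "y \<in> al ` (T - scale \<pi> T)"
    then obtain x where xT: "x \<in> T" "x \<notin> scale \<pi> T" "y = al x" by blast
    then have x: "x \<in> carrier V" "x 0 = 0" unfolding mem_T by blast+
    have "x 1 \<noteq> 0" using mem_pi_T[OF x(1)] xT(2) by blast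
    then have "x (int (Suc torsion_exponent) - int torsion_exponent) \<noteq> 0" by simp
    then have "\<not> ereal \<epsilon> \<le> v (x (int (Suc torsion_exponent)))" using V_bounded_order[OF x(1)] by blast
    then have "al x = ereal (real Q ^ Suc torsion_exponent) * v (x (int (Suc torsion_exponent)))" by (intro al_eq[OF x(1)]) simp
    moreover have "x (int (Suc torsion_exponent)) \<in> tors (Suc torsion_exponent)" by (rule V_tors[OF x(1)]) (simp add: x(2))
    ultimately show "y \<in> (\<lambda>z. ereal (real Q ^ Suc torsion_exponent) * v z) ` tors (Suc torsion_exponent)" using xT(3) by blast
  qed
qed

lemma T_spans: assumes x: "x \<in> carrier V" shows "\<exists>k::nat. \<pi> ^ k \<odot>\<^bsub>V\<^esub> x \<in> T"
proof -
  obtain N where N: "\<forall>i<N. x i = 0" using x by (auto simp: mem_V)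
  have "0 - int (nat (1 - N)) < N" by linarith
  then have "(\<pi> ^ nat (1 - N) \<odot>\<^bsub>V\<^esub> x) 0 = 0" unfolding V_pi_power[OF x] using N by blast
  then have "\<pi> ^ nat (1 - N) \<odot>\<^bsub>V\<^esub> x \<in> T"
    unfolding mem_T by (rule conjI[OF smult_closed[OF F_power[OF pi_F] x]])
  then show ?thesis by blast
qed

lemma T_separated:
  assumes x: "x \<in> carrier V" and sep: "\<And>k::nat. x \<in> scale (\<pi> ^ k) T" shows "x = \<zero>\<^bsub>V\<^esub>"
proof -
  have z: "x (int k) = 0" for k
  proof -
    obtain y where y: "y \<in> T" "x = \<pi> ^ k \<odot>\<^bsub>V\<^esub> y" using sep[of k] by blast
    then have "y \<in> carrier V" "y 0 = 0" unfolding mem_T by blast+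
    then show ?thesis unfolding y(2) by (simp add: V_pi_power)
  qed
  have "x i = 0" for i by (rule V_zero_below[OF x z[of "nat i"]]) simp
  then show ?thesis by (simp add: V_zero fun_eq_iff)
qed

lemma T_minus: assumes "x \<in> T" "y \<in> T" "x 1 = y 1" shows "x \<ominus>\<^bsub>V\<^esub> y \<in> scale \<pi> T"
proof -
  have xy: "x \<in> carrier V" "y \<in> carrier V" using assms unfolding mem_T by blast+
  show ?thesis by (rule mem_pi_T[OF minus_closed[OF xy] V_minus_eq_0[OF xy assms(3)]])
qed

lemma al_pos: assumes "x \<in> carrier V" shows "0 < al x"
proof (cases "x = \<zero>\<^bsub>V\<^esub>")
  case True
  then show ?thesis by (simp only: al_zero) simp
next
  case False
  then show ?thesis by (rule al_nonzero(1)[OF assms])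
qed

lemma al_infty: assumes "x \<in> carrier V" "al x = \<infinity>" shows "x = \<zero>\<^bsub>V\<^esub>"
proof (rule ccontr)
  assume "x \<noteq> \<zero>\<^bsub>V\<^esub>"
  then have "al x < \<infinity>" by (rule al_nonzero(2)[OF assms(1)])
  then show False using assms(2) by simp
qed

lemma normed_lattice_T: "normed_lattice v F \<pi> V T al (real Q) (\<lambda>x. x 1)"
proof (rule normed_lattice.intro[OF dv_vector_space_axioms normed_lattice_axioms.intro])
  show "1 < real Q" using Q_ge by simp
qed (fact submod_T T_spans T_separated al_zero al_infty al_pos al_add al_unit al_pi T_finite_torsion
    T_minus T_finite_al)+

lemma Fil_eq_al: "\<mu> \<le> \<epsilon> \<Longrightarrow> \<F> (ereal \<mu>) = {x \<in> carrier V. ereal \<mu> \<le> al x}"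
  unfolding set_eq_iff mem_Fil mem_Collect_eq using al_ge_iff by blast

text \<open>The common apartment of \<open>S\<close> and \<open>[T]\<close>. The range stops at
  \<open>\<epsilon>\<close> because only there the filtration is given by \<open>al\<close>.\<close>

lemma Fil_basis:
  obtains d e where "is_basis F V d e" "T = sp d e (\<lambda>_. 0)"
    "\<And>\<mu>. 0 < \<mu> \<Longrightarrow> \<mu> \<le> \<epsilon> \<Longrightarrow> \<exists>a. \<F> (ereal \<mu>) = sp d e a"
proof -
  obtain d e where de: "is_basis F V d e" "T = sp d e (\<lambda>_. 0)"
    "\<And>\<mu>::real. 0 < \<mu> \<Longrightarrow> \<exists>a. {x \<in> carrier V. ereal \<mu> \<le> al x} = sp d e a"
    using normed_lattice.adapted_basis[OF normed_lattice_T] by blast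
  have "\<exists>a. \<F> (ereal \<mu>) = sp d e a" if "0 < \<mu>" "\<mu> \<le> \<epsilon>" for \<mu>
    unfolding Fil_eq_al[OF that(2)] by (rule de(3)[OF that(1)])
  then show ?thesis by (rule that[OF de(1,2)])
qed

subsection \<open>Finiteness of the simplex\<close>

text \<open>From \<open>\<epsilon> / Q\<close> on, one application of \<open>[\<pi>]\<close> reaches
  \<open>\<epsilon>\<close>, where points have bounded order. So such a lattice is described by a
  subset of one finite set, which leaves finitely many lattices.\<close>

lemma Fil_eq_tors:
  assumes \<mu>: "\<epsilon> / real Q \<le> \<mu>"
  shows "\<F> (ereal \<mu>) = {x \<in> carrier V. x 0 \<in> {z \<in> tors (Suc torsion_exponent). ereal \<mu> \<le> v z}}"
proof -
  have "x 0 \<in> tors (Suc torsion_exponent)" if x: "x \<in> carrier V" and ge: "ereal \<mu> \<le> v (x 0)" for x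
  proof -
    have "ereal \<epsilon> \<le> v (x (- 1))"
    proof (cases "v (x 0) < ereal \<epsilon>")
      case True
      have "v (x (-1)) = ereal (real Q) * v (x 0)"
        using ac_pi_small[OF V_pos[OF x] True] V_step[OF x, of "-1"] by simp
      moreover have "ereal \<epsilon> \<le> ereal (real Q) * ereal \<mu>" using \<mu> Q_ge by (simp add: field_simps)
      then have "ereal \<epsilon> \<le> ereal (real Q) * v (x 0)"
        by (rule order_trans) (use ge in \<open>intro ereal_mult_left_mono; simp\<close>)
      ultimately show ?thesis by simp
    next
      case False
      then have "ereal \<epsilon> \<le> v (x 0)" by simp
      also have "v (x 0) \<le> v (ac \<pi> (x 0))" by (rule ac_ge[OF O_pi V_pos[OF x]])
      also have "ac \<pi> (x 0) = x (-1)" using V_step[OF x, of "-1"] by simp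
      finally show ?thesis .
    qed
    from V_bounded_order[OF x this] have "x (0 - int (Suc torsion_exponent)) = 0" by simp
    then show ?thesis by (rule V_tors[OF x])
  qed
  then show ?thesis by (auto simp: mem_Fil)
qed

lemma Fil_pi_scale:
  assumes \<mu>: "0 < \<mu>" "real Q * \<mu> \<le> \<epsilon>" shows "\<F> (ereal (real Q * \<mu>)) = scale \<pi> (\<F> (ereal \<mu>))"
proof -
  have "1 * \<mu> \<le> real Q * \<mu>" using \<mu>(1) Q_ge by (intro mult_right_mono) auto
  then have \<mu>': "\<mu> \<le> \<epsilon>" using \<mu>(2) by simp
  have iff: "ereal (real Q * \<mu>) \<le> al (\<pi> \<odot>\<^bsub>V\<^esub> x) \<longleftrightarrow> ereal \<mu> \<le> al x" if "x \<in> carrier V" for x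
    unfolding al_pi[OF that] using Q_ge by (cases "al x") auto
  show ?thesis unfolding Fil_eq_al[OF \<mu>(2)] Fil_eq_al[OF \<mu>']
  proof (intro equalityI subsetI)
    fix x assume x: "x \<in> {x \<in> carrier V. ereal (real Q * \<mu>) \<le> al x}"
    define y where "y = inverse \<pi> \<odot>\<^bsub>V\<^esub> x"
    have y: "y \<in> carrier V" "x = \<pi> \<odot>\<^bsub>V\<^esub> y"
      using x smult_cancel(2)[of \<pi> x] F_inverse[OF pi_F] by (simp_all add: y_def)
    then show "x \<in> scale \<pi> {x \<in> carrier V. ereal \<mu> \<le> al x}" using x iff[OF y(1)] by blast
  next
    fix x assume "x \<in> scale \<pi> {x \<in> carrier V. ereal \<mu> \<le> al x}"
    then obtain y where "y \<in> carrier V" "ereal \<mu> \<le> al y" "x = \<pi> \<odot>\<^bsub>V\<^esub> y" by blast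
    then show "x \<in> {x \<in> carrier V. ereal (real Q * \<mu>) \<le> al x}" using iff by simp
  qed
qed

text \<open>Scaling by \<open>\<pi>\<close> multiplies the index by \<open>Q\<close> without
  changing the class, so any index can be moved into the interval from \<open>\<epsilon> / Q\<close>
  to \<open>\<epsilon>\<close>.\<close>

lemma hc_Fil_bounded:
  assumes \<mu>: "0 < \<mu>" "\<mu> \<le> \<epsilon>"
  shows "\<exists>\<nu>. \<epsilon> / real Q \<le> \<nu> \<and> \<nu> \<le> \<epsilon> \<and> hc (\<F> (ereal \<mu>)) = hc (\<F> (ereal \<nu>))"
proof -
  have "\<exists>\<nu>. \<epsilon> / real Q \<le> \<nu> \<and> \<nu> \<le> \<epsilon> \<and> hc (\<F> (ereal \<mu>)) = hc (\<F> (ereal \<nu>))"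
    if "\<epsilon> / real Q ^ Suc n \<le> \<mu>" "0 < \<mu>" "\<mu> \<le> \<epsilon>" for n \<mu>
    using that
  proof (induction n arbitrary: \<mu>)
    case 0
    then show ?case by auto
  next
    case (Suc n)
    show ?case
    proof (cases "real Q * \<mu> \<le> \<epsilon>")
      case True
      have "\<epsilon> / real Q ^ Suc n \<le> real Q * \<mu>" using Suc.prems(1) Q_ge by (simp add: field_simps)
      moreover have "0 < real Q * \<mu>" using Suc.prems(2) Q_ge by simp
      moreover have "hc (\<F> (ereal \<mu>)) = hc (\<F> (ereal (real Q * \<mu>)))"
        unfolding Fil_pi_scale[OF Suc.prems(2) True] using hc_scale[OF pi_F pi_nz Fil_closed] by simp
      ultimately show ?thesis using Suc.IH[of "real Q * \<mu>"] True by simp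
    next
      case False
      then have "\<epsilon> / real Q \<le> \<mu>" using Q_ge by (simp add: field_simps)
      then show ?thesis using Suc.prems by blast
    qed
  qed
  moreover obtain n where "\<epsilon> / \<mu> < real Q ^ n" using real_arch_pow[of "real Q"] Q_ge by auto
  then have "\<epsilon> / real Q ^ Suc n \<le> \<mu>"
  proof -
    have "real Q ^ n \<le> real Q ^ Suc n" using Q_ge by (intro power_increasing) auto
    then have "\<epsilon> / \<mu> \<le> real Q ^ Suc n" using \<open>\<epsilon> / \<mu> < real Q ^ n\<close> by linarith
    then show ?thesis using \<mu> Q_ge by (simp add: field_simps)
  qed
  ultimately show ?thesis using \<mu> by blast
qed

lemma S_vertices_eq: "S_vertices v F \<pi> H \<epsilon> = {hc (\<F> (ereal \<mu>)) |\<mu>. 0 < \<mu> \<and> \<mu> \<le> \<epsilon>}"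
proof (intro equalityI subsetI)
  fix Y assume "Y \<in> S_vertices v F \<pi> H \<epsilon>"
  then obtain \<mu> where \<mu>: "Y = hc (\<F> \<mu>)" "0 < \<mu>" "\<mu> \<le> ereal \<epsilon>"
    unfolding S_vertices_def Fil_vertex_def by blast
  obtain r where r: "\<mu> = ereal r" using \<mu>(2,3) by (cases \<mu>) auto
  then have "0 < r \<and> r \<le> \<epsilon>" using \<mu>(2,3) by simp
  then show "Y \<in> {hc (\<F> (ereal \<mu>)) |\<mu>. 0 < \<mu> \<and> \<mu> \<le> \<epsilon>}" using \<mu>(1) r by blast
next
  fix Y assume "Y \<in> {hc (\<F> (ereal \<mu>)) |\<mu>. 0 < \<mu> \<and> \<mu> \<le> \<epsilon>}"
  then obtain r where r: "Y = hc (\<F> (ereal r))" "0 < r" "r \<le> \<epsilon>" by blast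
  then show "Y \<in> S_vertices v F \<pi> H \<epsilon>"
    unfolding S_vertices_def Fil_vertex_def by (intro CollectI exI[of _ "ereal r"]) simp
qed

lemma finite_S: "finite (S_vertices v F \<pi> H \<epsilon>)"
proof (rule finite_subset)
  let ?g = "\<lambda>A. hc {x \<in> carrier V. x 0 \<in> A}"
  show "finite (?g ` Pow (tors (Suc torsion_exponent)))" using finite_tors by simp
  show "S_vertices v F \<pi> H \<epsilon> \<subseteq> ?g ` Pow (tors (Suc torsion_exponent))"
  proof
    fix Y assume "Y \<in> S_vertices v F \<pi> H \<epsilon>"
    then obtain \<mu> where \<mu>: "0 < \<mu>" "\<mu> \<le> \<epsilon>" "Y = hc (\<F> (ereal \<mu>))" unfolding S_vertices_eq by blast
    then obtain \<nu> where \<nu>: "\<epsilon> / real Q \<le> \<nu>" "Y = hc (\<F> (ereal \<nu>))" using hc_Fil_bounded by metis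
    show "Y \<in> ?g ` Pow (tors (Suc torsion_exponent))" unfolding \<nu>(2) Fil_eq_tors[OF \<nu>(1)] by blast
  qed
qed

subsection \<open>The filtration as joins\<close>

text \<open>If \<open>\<kappa>' = min\<^sub>i (v(f\<^sub>i) + i \<kappa>)\<close> for \<open>f = [\<pi>]\<close>, then \<open>[\<pi>]\<close> maps the points of valuation at least
  \<open>\<kappa>\<close> onto those of valuation at least \<open>\<kappa>'\<close>.\<close>

lemma Fil_step:
  assumes \<kappa>: "0 < \<kappa>" and ge: "\<And>i. 1 \<le> i \<Longrightarrow> i \<le> Q \<Longrightarrow> ereal \<kappa>' \<le> v (act H \<pi> $ i) + ereal (real i * \<kappa>)"
    and i: "1 \<le> i" "v (act H \<pi> $ i) + ereal (real i * \<kappa>) \<le> ereal \<kappa>'"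
  shows "\<F> (ereal \<kappa>') = scale \<pi> (\<F> (ereal \<kappa>)) <+>\<^bsub>V\<^esub> T"
proof (intro equalityI subsetI)
  have "0 < ereal (real i * \<kappa>)" using i \<kappa> by simp
  also have "\<dots> \<le> v (act H \<pi> $ i) + ereal (real i * \<kappa>)" using int_f_nth[of i] by (simp add: add_increasing)
  finally have \<kappa>': "0 < ereal \<kappa>'" using i(2) by (rule less_le_trans)
  fix x
  {
    assume "x \<in> scale \<pi> (\<F> (ereal \<kappa>)) <+>\<^bsub>V\<^esub> T"
    then obtain y t where y: "y \<in> \<F> (ereal \<kappa>)" "t \<in> T" "x = \<pi> \<odot>\<^bsub>V\<^esub> y \<oplus>\<^bsub>V\<^esub> t" unfolding set_sum_iff by blast
    have yC: "y \<in> carrier V" "ereal \<kappa> \<le> v (y 0)" using y(1) by (simp_all add: mem_Fil)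
    have "ereal \<kappa>' \<le> v (ac \<pi> (y 0))" by (rule ac_pi_ge[OF yC(2) \<kappa> ge])
    then have "\<pi> \<odot>\<^bsub>V\<^esub> y \<in> \<F> (ereal \<kappa>')" using yC(1) V_smult_int[OF O_pi yC(1)] by (simp add: mem_Fil)
    then show "x \<in> \<F> (ereal \<kappa>')"
      unfolding y(3) using submodD(4)[OF submod_Fil[OF \<kappa>']] T_sub_Fil y(2) by blast
  next
    assume x: "x \<in> \<F> (ereal \<kappa>')"
    then have xC: "x \<in> carrier V" and "ereal \<kappa>' \<le> v (x 0)" by (simp_all add: mem_Fil)
    then have "v (act H \<pi> $ i) + ereal (real i * \<kappa>) \<le> v (x 0)" using i(2) by simp
    then obtain z where z: "ac \<pi> z = x 0" "ereal \<kappa> \<le> v z" using root_ge[OF i(1) \<kappa>] by blast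
    have z0: "0 < v z" using z(2) \<kappa> by (meson ereal_less(2) less_le_trans)
    \<comment> \<open>The unit coefficient in degree \<open>Q\<close> makes \<open>[\<pi>]\<close>
      surjective on points.\<close>
    have "\<exists>w. 0 < v w \<and> ac \<pi> w = u" if u: "0 < v u" for u
    proof -
      obtain r where r: "0 < r" "ereal r \<le> v u" using v_pos_real[OF u] by blast
      have "v (act H \<pi> $ Q) + ereal (real Q * (r / real Q)) \<le> v u" using f_Q Q_pos r by simp
      then obtain w where "ac \<pi> w = u" "ereal (r / real Q) \<le> v w"
        using root_ge[of Q "r / real Q" u] Q_pos r by auto
      moreover have "0 < ereal (r / real Q)" using r Q_pos by simp
      ultimately show ?thesis using less_le_trans by blast
    qed
    then obtain lift where lift: "\<And>u. 0 < v u \<Longrightarrow> 0 < v (lift u)" "\<And>u. 0 < v u \<Longrightarrow> ac \<pi> (lift u) = u" by metis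
    define g where "g k = (lift ^^ k) z" for k
    have g: "0 < v (g k)" for k by (induction k) (simp_all add: g_def z0 lift)
    have gS: "ac \<pi> (g (Suc k)) = g k" for k using lift(2)[OF g[of k]] by (simp add: g_def)
    \<comment> \<open>\<open>w\<close> continues \<open>z\<close> upwards by chosen preimages and is
      \<open>x\<close> moved by one place below 0. Then \<open>\<pi> w\<close> agrees with
      \<open>x\<close> at place 0, so the difference lies in \<open>T\<close>.\<close>
    define w where "w i = (if 0 \<le> i then g (nat i) else x (i + 1))" for i
    have wV: "w \<in> carrier V" unfolding mem_V
    proof (intro conjI allI)
      fix i
      show "0 < v (w i)" using g V_pos[OF xC] by (simp add: w_def)
      consider "0 \<le> i" | "i = -1" | "i < -1" by linarith
      then show "ac \<pi> (w (i + 1)) = w i"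
      proof cases
        case 1
        then show ?thesis using gS[of "nat i"] by (simp add: w_def nat_add_distrib)
      next
        case 2
        then show ?thesis using z(1) by (simp add: w_def g_def)
      next
        case 3
        then show ?thesis using V_step[OF xC, of "i + 1"] by (simp add: w_def)
      qed
    next
      obtain N where N: "\<forall>i<N. x i = 0" using xC by (auto simp: mem_V)
      have "\<forall>i<min (N - 1) 0. w i = 0" using N by (simp add: w_def)
      then show "\<exists>N. \<forall>i<N. w i = 0" by blast
    qed
    have "w 0 = z" by (simp add: w_def g_def)
    then have wF: "w \<in> \<F> (ereal \<kappa>)" using wV z(2) by (simp add: mem_Fil)
    have pw: "\<pi> \<odot>\<^bsub>V\<^esub> w \<in> carrier V" using wV by simp
    have "(\<pi> \<odot>\<^bsub>V\<^esub> w) 0 = x 0" unfolding V_pi[OF wV] by (simp add: w_def)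
    then have "x \<ominus>\<^bsub>V\<^esub> \<pi> \<odot>\<^bsub>V\<^esub> w \<in> T" using V_minus_eq_0[OF xC pw, of 0] xC pw by (simp add: mem_T)
    moreover have "x = \<pi> \<odot>\<^bsub>V\<^esub> w \<oplus>\<^bsub>V\<^esub> (x \<ominus>\<^bsub>V\<^esub> \<pi> \<odot>\<^bsub>V\<^esub> w)"
    proof -
      have "\<pi> \<odot>\<^bsub>V\<^esub> w \<oplus>\<^bsub>V\<^esub> (x \<ominus>\<^bsub>V\<^esub> \<pi> \<odot>\<^bsub>V\<^esub> w) = x \<ominus>\<^bsub>V\<^esub> \<pi> \<odot>\<^bsub>V\<^esub> w \<oplus>\<^bsub>V\<^esub> \<pi> \<odot>\<^bsub>V\<^esub> w"
        by (rule a_comm) (use xC pw in simp_all)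
      also have "\<dots> = x" using xC pw by (simp add: a_minus_def a_assoc l_neg)
      finally show ?thesis by simp
    qed
    ultimately show "x \<in> scale \<pi> (\<F> (ereal \<kappa>)) <+>\<^bsub>V\<^esub> T" unfolding set_sum_iff using wF by blast
  }
qed

lemma Fil_step_up: assumes \<kappa>: "0 < \<kappa>" shows "\<exists>\<kappa>'>0. \<F> (ereal \<kappa>') = scale \<pi> (\<F> (ereal \<kappa>)) <+>\<^bsub>V\<^esub> T"
proof -
  let ?t = "\<lambda>i. v (act H \<pi> $ i) + ereal (real i * \<kappa>)"
  define m where "m = Min (?t ` {1..Q})"
  have fin: "finite (?t ` {1..Q})" "?t ` {1..Q} \<noteq> {}" using Q_pos by auto
  have ge: "m \<le> ?t i" if "1 \<le> i" "i \<le> Q" for i unfolding m_def using fin that by (intro Min_le) auto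
  have "m \<in> ?t ` {1..Q}" unfolding m_def using fin by (rule Min_in)
  then obtain i where i: "1 \<le> i" "i \<le> Q" "m = ?t i" by auto
  have "m \<le> ereal (real Q * \<kappa>)" using ge[of Q] Q_pos f_Q by simp
  moreover have "0 < m"
  proof -
    have "0 < ereal (real i * \<kappa>)" using i \<kappa> by simp
    also have "\<dots> \<le> ?t i" using int_f_nth[of i] by (simp add: add_increasing)
    finally show ?thesis using i(3) by simp
  qed
  ultimately obtain \<kappa>' where \<kappa>': "m = ereal \<kappa>'" "0 < \<kappa>'" by (cases m) auto
  have "\<F> (ereal \<kappa>') = scale \<pi> (\<F> (ereal \<kappa>)) <+>\<^bsub>V\<^esub> T"
    by (rule Fil_step[OF \<kappa> _ i(1)]) (use ge i(3) \<kappa>' in auto)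
  then show ?thesis using \<kappa>'(2) by blast
qed

text \<open>Here \<open>\<kappa>\<close> solves \<open>min (w i + i \<kappa>) = \<kappa>'\<close>
  over the nonzero coefficients, so it is the maximum of \<open>(\<kappa>' - w i) / i\<close>. If it
  is attained at \<open>Q\<close>, then \<open>\<kappa> \<le> \<kappa>' / 2\<close>; otherwise
  \<open>w i \<ge> \<epsilon>\<close> and \<open>\<kappa> \<le> \<kappa>' - \<epsilon>\<close>.
  Either way the index drops by at least \<open>\<epsilon> / 2\<close>.\<close>

lemma Fil_step_down:
  assumes \<kappa>': "\<epsilon> < \<kappa>'"
  shows "\<exists>\<kappa>>0. \<kappa> \<le> \<kappa>' - \<epsilon> / 2 \<and> \<F> (ereal \<kappa>') = scale \<pi> (\<F> (ereal \<kappa>)) <+>\<^bsub>V\<^esub> T"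
proof -
  define S where "S = {i \<in> {1..Q}. act H \<pi> $ i \<noteq> 0}"
  define w where "w i = real_of_ereal (v (act H \<pi> $ i))" for i
  have w: "v (act H \<pi> $ i) = ereal (w i)" if "i \<in> S" for i
  proof -
    have "act H \<pi> $ i \<noteq> 0" using that by (simp add: S_def)
    then obtain r where "v (act H \<pi> $ i) = ereal r" using v_real by blast
    then show ?thesis by (simp add: w_def)
  qed
  have QS: "Q \<in> S" using Q_pos f_Q by (auto simp: S_def)
  define \<kappa> where "\<kappa> = Max ((\<lambda>i. (\<kappa>' - w i) / real i) ` S)"
  have fin: "finite S" "S \<noteq> {}" using QS by (auto simp: S_def)
  have ge: "(\<kappa>' - w i) / real i \<le> \<kappa>" if "i \<in> S" for i unfolding \<kappa>_def using fin that by (intro Max_ge) auto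
  have "\<kappa> \<in> (\<lambda>i. (\<kappa>' - w i) / real i) ` S" unfolding \<kappa>_def using fin by (intro Max_in) auto
  then obtain i where i: "i \<in> S" "\<kappa> = (\<kappa>' - w i) / real i" by blast
  have wQ: "w Q = 0" using f_Q by (simp add: w_def)
  have "\<kappa>' / real Q \<le> \<kappa>" using ge[OF QS] wQ by simp
  moreover have "0 < \<kappa>' / real Q" using \<kappa>' eps_pos Q_pos by simp
  ultimately have \<kappa>0: "0 < \<kappa>" by simp
  have i1: "1 \<le> i" "i \<le> Q" using i(1) by (auto simp: S_def)
  have ki: "real i * \<kappa> = \<kappa>' - w i" using i(2) i1 by simp
  have bound: "\<kappa> \<le> \<kappa>' - \<epsilon> / 2"
  proof (cases "i = Q")
    case True
    have "2 * \<kappa> \<le> real Q * \<kappa>" using \<kappa>0 Q_ge by (intro mult_right_mono) auto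
    then show ?thesis using ki True wQ \<kappa>' by simp
  next
    case False
    have "1 * \<epsilon> \<le> real (Q - i) * \<epsilon>" using False i1 eps_pos by (intro mult_right_mono) auto
    moreover have "real (Q - i) * \<epsilon> \<le> w i" using coeff_ge[OF i1(2)] w[OF i(1)] by simp
    moreover have "1 * \<kappa> \<le> real i * \<kappa>" using \<kappa>0 i1 by (intro mult_right_mono) auto
    ultimately show ?thesis using ki eps_pos by linarith
  qed
  have "\<F> (ereal \<kappa>') = scale \<pi> (\<F> (ereal \<kappa>)) <+>\<^bsub>V\<^esub> T"
  proof (rule Fil_step[OF \<kappa>0 _ i1(1)])
    show "v (act H \<pi> $ i) + ereal (real i * \<kappa>) \<le> ereal \<kappa>'" using w[OF i(1)] ki by simp
    fix j assume j: "1 \<le> j" "j \<le> Q"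
    show "ereal \<kappa>' \<le> v (act H \<pi> $ j) + ereal (real j * \<kappa>)"
    proof (cases "act H \<pi> $ j = 0")
      case False
      then have jS: "j \<in> S" using j by (simp add: S_def)
      have "\<kappa>' \<le> w j + real j * \<kappa>" using ge[OF jS] j by (simp add: field_simps)
      then show ?thesis using w[OF jS] by simp
    qed simp
  qed
  then show ?thesis using \<kappa>0 bound by blast
qed

lemma scale_pi_power_Suc: "scale (\<pi> ^ Suc k) (\<F> \<mu>) = scale \<pi> (scale (\<pi> ^ k) (\<F> \<mu>))"
  using scale_scale[OF pi_F F_power[OF pi_F] Fil_closed] by simp

lemma step_power:
  assumes "0 < \<mu>"
  shows "scale \<pi> (scale (\<pi> ^ k) (\<F> \<mu>) <+>\<^bsub>V\<^esub> T) <+>\<^bsub>V\<^esub> T = scale (\<pi> ^ Suc k) (\<F> \<mu>) <+>\<^bsub>V\<^esub> T"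
  unfolding scale_pi_power_Suc
  by (rule set_sum_scale_absorb[OF submod_scale[OF submod_Fil[OF assms] F_power[OF pi_F]] submod_T O_pi])

lemma Fil_sum_T: assumes "0 < \<mu>" shows "\<F> \<mu> <+>\<^bsub>V\<^esub> T = \<F> \<mu>"
  by (rule set_sum_absorb[OF submod_Fil[OF assms] T_sub_Fil submodD(3)[OF submod_T]])

text \<open>A descent by at least \<open>\<epsilon> / 2\<close> per step ends at an index at most
  \<open>\<epsilon>\<close>; \<open>step_power\<close> merges the nested sums into one.\<close>

lemma Fil_is_join:
  assumes "0 < \<kappa>" shows "\<exists>k \<mu>. 0 < \<mu> \<and> \<mu> \<le> \<epsilon> \<and> \<F> (ereal \<kappa>) = scale (\<pi> ^ k) (\<F> (ereal \<mu>)) <+>\<^bsub>V\<^esub> T"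
proof -
  have "\<exists>k \<mu>. 0 < \<mu> \<and> \<mu> \<le> \<epsilon> \<and> \<F> (ereal \<kappa>) = scale (\<pi> ^ k) (\<F> (ereal \<mu>)) <+>\<^bsub>V\<^esub> T"
    if "0 < \<kappa>" "\<kappa> \<le> \<epsilon> + real n * (\<epsilon> / 2)" for n \<kappa>
    using that
  proof (induction n arbitrary: \<kappa>)
    case 0
    then show ?case using Fil_sum_T[of "ereal \<kappa>"] scale_1[OF Fil_closed]
      by (intro exI[of _ 0] exI[of _ \<kappa>]) simp
  next
    case (Suc n)
    show ?case
    proof (cases "\<kappa> \<le> \<epsilon>")
      case True
      then show ?thesis using Suc.prems Fil_sum_T[of "ereal \<kappa>"] scale_1[OF Fil_closed]
        by (intro exI[of _ 0] exI[of _ \<kappa>]) simp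
    next
      case False
      then obtain \<kappa>1 where \<kappa>1: "0 < \<kappa>1" "\<kappa>1 \<le> \<kappa> - \<epsilon> / 2"
        "\<F> (ereal \<kappa>) = scale \<pi> (\<F> (ereal \<kappa>1)) <+>\<^bsub>V\<^esub> T" using Fil_step_down[of \<kappa>] by auto
      have "real (Suc n) * (\<epsilon> / 2) = real n * (\<epsilon> / 2) + \<epsilon> / 2" by (simp add: field_simps)
      then have "\<kappa>1 \<le> \<epsilon> + real n * (\<epsilon> / 2)" using \<kappa>1(2) Suc.prems(2) by linarith
      then obtain k \<mu> where k: "0 < \<mu>" "\<mu> \<le> \<epsilon>" "\<F> (ereal \<kappa>1) = scale (\<pi> ^ k) (\<F> (ereal \<mu>)) <+>\<^bsub>V\<^esub> T"
        using Suc.IH[OF \<kappa>1(1)] by (elim meta_impE exE conjE)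
      have "\<F> (ereal \<kappa>) = scale (\<pi> ^ Suc k) (\<F> (ereal \<mu>)) <+>\<^bsub>V\<^esub> T"
        unfolding \<kappa>1(3) k(3) by (rule step_power) (simp add: k(1))
      then show ?thesis using k(1,2) by blast
    qed
  qed
  moreover obtain n where "\<kappa> \<le> real n * (\<epsilon> / 2)"
    using archimedean_bound[of "\<epsilon> / 2" \<kappa>] eps_pos by (meson half_gt_zero order_refl)
  then have "\<kappa> \<le> \<epsilon> + real n * (\<epsilon> / 2)" using eps_pos by simp
  ultimately show ?thesis using assms by blast
qed

lemma join_is_Fil: assumes "0 < \<mu>" shows "\<exists>\<kappa>>0. scale (\<pi> ^ k) (\<F> (ereal \<mu>)) <+>\<^bsub>V\<^esub> T = \<F> (ereal \<kappa>)"
proof (induction k)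
  case 0
  then show ?case using assms Fil_sum_T[of "ereal \<mu>"] scale_1[OF Fil_closed] by (intro exI[of _ \<mu>]) simp
next
  case (Suc k)
  then obtain \<kappa> where \<kappa>: "0 < \<kappa>" "scale (\<pi> ^ k) (\<F> (ereal \<mu>)) <+>\<^bsub>V\<^esub> T = \<F> (ereal \<kappa>)" by blast
  obtain \<kappa>' where \<kappa>': "0 < \<kappa>'" "\<F> (ereal \<kappa>') = scale \<pi> (\<F> (ereal \<kappa>)) <+>\<^bsub>V\<^esub> T"
    using Fil_step_up[OF \<kappa>(1)] by blast
  have "scale (\<pi> ^ Suc k) (\<F> (ereal \<mu>)) <+>\<^bsub>V\<^esub> T = \<F> (ereal \<kappa>')"
    unfolding \<kappa>'(2) \<kappa>(2)[symmetric] by (rule step_power[symmetric]) (simp add: assms)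
  then show ?case using \<kappa>'(1) by blast
qed

text \<open>Covers the index \<open>\<infinity>\<close>, which no descent from a finite index
  reaches: points of valuation at least \<open>\<epsilon>\<close> that belong to a sequence of
  \<open>V\<close> are torsion of bounded order.\<close>

lemma T_is_join: "scale (\<pi> ^ torsion_exponent) (\<F> (ereal \<epsilon>)) <+>\<^bsub>V\<^esub> T = T"
proof -
  have sub: "scale (\<pi> ^ torsion_exponent) (\<F> (ereal \<epsilon>)) \<subseteq> T"
  proof
    fix y assume "y \<in> scale (\<pi> ^ torsion_exponent) (\<F> (ereal \<epsilon>))"
    then obtain x where x: "x \<in> carrier V" "ereal \<epsilon> \<le> v (x 0)" "y = \<pi> ^ torsion_exponent \<odot>\<^bsub>V\<^esub> x" by (auto simp: mem_Fil)
    have "y 0 = 0" unfolding x(3) V_pi_power[OF x(1)] by (rule V_bounded_order[OF x(1,2)])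
    then show "y \<in> T" unfolding mem_T using x F_power[OF pi_F] by simp
  qed
  have "0 < ereal \<epsilon>" using eps_pos by simp
  then have z: "\<zero>\<^bsub>V\<^esub> \<in> scale (\<pi> ^ torsion_exponent) (\<F> (ereal \<epsilon>))"
    by (intro submodD(3) submod_scale submod_Fil F_power pi_F)
  show ?thesis
  proof (intro equalityI subsetI)
    fix y assume "y \<in> scale (\<pi> ^ torsion_exponent) (\<F> (ereal \<epsilon>)) <+>\<^bsub>V\<^esub> T"
    then obtain a b where ab: "a \<in> scale (\<pi> ^ torsion_exponent) (\<F> (ereal \<epsilon>))" "b \<in> T" "y = a \<oplus>\<^bsub>V\<^esub> b"
      unfolding set_sum_iff by blast
    show "y \<in> T" unfolding ab(3) by (rule submodD(4)[OF submod_T]) (use ab sub in blast)+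
  next
    fix y assume y: "y \<in> T"
    then have "y = \<zero>\<^bsub>V\<^esub> \<oplus>\<^bsub>V\<^esub> y" using submodD(2)[OF submod_T] by simp
    then show "y \<in> scale (\<pi> ^ torsion_exponent) (\<F> (ereal \<epsilon>)) <+>\<^bsub>V\<^esub> T" unfolding set_sum_iff using z y by blast
  qed
qed

lemma Fil_vertices_eq_joins: "Fil_vertices v F \<pi> H = (\<Union>\<mu>\<in>{0<..\<epsilon>}. joins (\<F> (ereal \<mu>)) T)"
proof (intro equalityI subsetI)
  fix Y assume "Y \<in> Fil_vertices v F \<pi> H"
  then obtain \<kappa> where \<kappa>: "0 < \<kappa>" "Y = hc (\<F> \<kappa>)" by (auto simp: Fil_vertices_def Fil_vertex_def)
  have "\<exists>k \<mu>. 0 < \<mu> \<and> \<mu> \<le> \<epsilon> \<and> \<F> \<kappa> = scale (\<pi> ^ k) (\<F> (ereal \<mu>)) <+>\<^bsub>V\<^esub> T"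
  proof (cases \<kappa>)
    case (real r)
    then show ?thesis using Fil_is_join \<kappa>(1) by simp
  next
    case PInf
    show ?thesis unfolding PInf using T_is_join eps_pos by (intro exI[of _ torsion_exponent] exI[of _ \<epsilon>]) simp
  qed (use \<kappa> in auto)
  then obtain k \<mu> where k: "0 < \<mu>" "\<mu> \<le> \<epsilon>" "\<F> \<kappa> = scale (\<pi> ^ k) (\<F> (ereal \<mu>)) <+>\<^bsub>V\<^esub> T" by blast
  have "Y \<in> joins (\<F> (ereal \<mu>)) T"
    unfolding \<kappa>(2) k(3) joins_def using F_power[OF pi_F] by (intro CollectI exI[of _ "\<pi> ^ k"]) simp
  then show "Y \<in> (\<Union>\<mu>\<in>{0<..\<epsilon>}. joins (\<F> (ereal \<mu>)) T)" using k(1,2) by auto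
next
  fix Y assume "Y \<in> (\<Union>\<mu>\<in>{0<..\<epsilon>}. joins (\<F> (ereal \<mu>)) T)"
  then obtain \<mu> c where \<mu>: "0 < \<mu>" "\<mu> \<le> \<epsilon>" and c: "c \<in> F" "c \<noteq> 0"
    and Y: "Y = hc (scale c (\<F> (ereal \<mu>)) <+>\<^bsub>V\<^esub> T)" by (auto simp: joins_def)
  have \<mu>0: "0 < ereal \<mu>" using \<mu> by simp
  note sF = submod_Fil[OF \<mu>0]
  obtain k where k: "scale c (\<F> (ereal \<mu>)) = scale (\<pi> powi k) (\<F> (ereal \<mu>))" using scale_powi[OF sF c] by blast
  have "\<exists>\<kappa>>0. Y = hc (\<F> (ereal \<kappa>))"
  proof (cases "0 \<le> k")
    case True
    then have "\<pi> powi k = \<pi> ^ nat k" by (simp add: power_int_def)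
    then show ?thesis using join_is_Fil[OF \<mu>(1), of "nat k"] unfolding Y k by auto
  next
    case False
    have pF: "\<pi> powi k \<in> F" by (rule F_powi[OF pi_F])
    \<comment> \<open>For negative exponents the scaled lattice already contains \<open>T\<close>,
      so the join is just the vertex of \<open>S\<close> it started from.\<close>
    have "T \<subseteq> scale (\<pi> powi k) (\<F> (ereal \<mu>))"
    proof
      fix x assume x: "x \<in> T"
      then have xC: "x \<in> carrier V" by (simp add: mem_T)
      have "\<pi> ^ nat (- k) \<odot>\<^bsub>V\<^esub> x \<in> \<F> (ereal \<mu>)"
        using submodD(5)[OF sF O_power[OF O_pi]] T_sub_Fil x by blast
      moreover have "\<pi> powi k * \<pi> ^ nat (- k) = 1" using False by (simp add: power_int_def power_inverse)
      then have "\<pi> powi k \<odot>\<^bsub>V\<^esub> (\<pi> ^ nat (- k) \<odot>\<^bsub>V\<^esub> x) = x"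
        using smult_assoc[OF pF F_power[OF pi_F] xC, of "nat (- k)"] xC by simp
      ultimately show "x \<in> scale (\<pi> powi k) (\<F> (ereal \<mu>))" by (metis image_eqI)
    qed
    then have "scale (\<pi> powi k) (\<F> (ereal \<mu>)) <+>\<^bsub>V\<^esub> T = scale (\<pi> powi k) (\<F> (ereal \<mu>))"
      using submodD(3)[OF submod_T] by (intro set_sum_absorb submod_scale[OF sF pF])
    then have "Y = hc (\<F> (ereal \<mu>))" unfolding Y k using hc_scale[OF pF _ Fil_closed] by simp
    then show ?thesis using \<mu>(1) by blast
  qed
  then obtain \<kappa> where "0 < \<kappa>" "Y = hc (\<F> (ereal \<kappa>))" by blast
  then show "Y \<in> Fil_vertices v F \<pi> H"
    unfolding Fil_vertices_def Fil_vertex_def by (intro CollectI exI[of _ "ereal \<kappa>"]) simp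
qed

lemma Fil_vertices_eq:
  "Fil_vertices v F \<pi> H = (\<Union>x\<in>S_vertices v F \<pi> H \<epsilon>. vertex_join v F V x (Fil_vertex v F \<pi> H \<infinity>))"
proof -
  obtain d e where de: "is_basis F V d e" "T = sp d e (\<lambda>_. 0)"
    "\<And>\<mu>. 0 < \<mu> \<Longrightarrow> \<mu> \<le> \<epsilon> \<Longrightarrow> \<exists>a. \<F> (ereal \<mu>) = sp d e a" using Fil_basis by blast
  have vj: "vertex_join v F V (hc (\<F> (ereal \<mu>))) (hc T) = joins (\<F> (ereal \<mu>)) T"
    if \<mu>: "\<mu> \<in> {0<..\<epsilon>}" for \<mu>
  proof -
    obtain a where "\<F> (ereal \<mu>) = sp d e a" using de(3)[of \<mu>] \<mu> by auto
    then show ?thesis by (rule vertex_join_eq_joins[OF de(1) _ de(2)])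
  qed
  have "S_vertices v F \<pi> H \<epsilon> = (\<lambda>\<mu>. hc (\<F> (ereal \<mu>))) ` {0<..\<epsilon>}"
    unfolding S_vertices_eq by auto
  then show ?thesis unfolding Fil_vertices_eq_joins Fil_vertex_def by (simp add: vj)
qed

lemma Fil_vertices_enclosure:
  "contained_in_enclosure v F \<pi> V (Fil_vertices v F \<pi> H) (S_vertices v F \<pi> H \<epsilon> \<union> {Fil_vertex v F \<pi> H \<infinity>})"
  unfolding contained_in_enclosure_def
proof (intro conjI allI impI)
  let ?X = "S_vertices v F \<pi> H \<epsilon> \<union> {Fil_vertex v F \<pi> H \<infinity>}"
  show "finite ?X" using finite_S by simp
  show "\<exists>d e. is_basis F V d e \<and> ?X \<subseteq> apartment v F \<pi> V d e"
  proof -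
    obtain d e where de: "is_basis F V d e" "T = sp d e (\<lambda>_. 0)"
      "\<And>\<mu>. 0 < \<mu> \<Longrightarrow> \<mu> \<le> \<epsilon> \<Longrightarrow> \<exists>a. \<F> (ereal \<mu>) = sp d e a" using Fil_basis by blast
    have "hc (sp d e a) \<in> apartment v F \<pi> V d e" for a
      unfolding apartment_def apartment_vertex_eq[symmetric] by blast
    note ap = this
    have "?X \<subseteq> apartment v F \<pi> V d e"
    proof
      fix Y assume "Y \<in> ?X"
      then consider \<mu> where "0 < \<mu>" "\<mu> \<le> \<epsilon>" "Y = hc (\<F> (ereal \<mu>))" | "Y = hc T"
        unfolding S_vertices_eq Fil_vertex_def by blast
      then have "\<exists>a. Y = hc (sp d e a)"
      proof cases
        case 1
        then show ?thesis using de(3)[OF 1(1,2)] by auto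
      next
        case 2
        show ?thesis unfolding 2 using de(2) by (intro exI[of _ "\<lambda>_. 0"]) simp
      qed
      then show "Y \<in> apartment v F \<pi> V d e" using ap by blast
    qed
    then show ?thesis using de(1) by blast
  qed
  fix d e assume de: "is_basis F V d e \<and> ?X \<subseteq> apartment v F \<pi> V d e"
  then have e: "\<forall>i<d. e i \<in> carrier V" by (simp add: is_basis_def)
  show "Fil_vertices v F \<pi> H \<subseteq> enclosure_in v F \<pi> V d e ?X"
  proof
    fix Y assume "Y \<in> Fil_vertices v F \<pi> H"
    then obtain \<mu> c where \<mu>: "0 < \<mu>" "\<mu> \<le> \<epsilon>" and c: "c \<in> F" "c \<noteq> 0"
      and Y: "Y = hc (scale c (\<F> (ereal \<mu>)) <+>\<^bsub>V\<^esub> T)" unfolding Fil_vertices_eq_joins by (auto simp: joins_def)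
    have "hc (scale c (\<F> (ereal \<mu>))) \<in> ?X"
      unfolding hc_scale[OF c Fil_closed] S_vertices_eq using \<mu> by blast
    moreover have "hc T \<in> ?X" by (simp add: Fil_vertex_def)
    ultimately show "Y \<in> enclosure_in v F \<pi> V d e ?X"
      unfolding Y using de by (intro join_in_enclosure[OF e _ scale_closed[OF c(1) Fil_closed] Fil_closed]) auto
  qed
qed

end

section \<open>The theorem for the given field and module\<close>

lemma padic_setting_tate:
  assumes ps: "padic_setting p v F \<pi>" and H: "formal_O_module v F H" "O_height v F \<pi> H n" "S_bound v \<pi> H \<epsilon>"
  shows "tate v F \<pi> H (residue_card v F ^ n) \<epsilon>"
proof -
  interpret dv_subfield v F \<pi> by (rule padic_setting_dv_subfield[OF ps])
  let ?Q = "residue_card v F ^ n"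
  have Q: "\<And>i. i < ?Q \<Longrightarrow> 0 < v (act H \<pi> $ i)" "v (act H \<pi> $ ?Q) = 0"
    using H(2) by (auto simp: O_height_def)
  have "act H \<pi> $ 0 = 0" "act H \<pi> $ 1 = \<pi>" using H(1) by (simp_all add: formal_O_module_def)
  \<comment> \<open>The coefficients of \<open>[\<pi>]\<close> in degrees 0 and 1 are 0 and
    \<open>\<pi>\<close>, neither of valuation 0, whereas the one in degree \<open>q ^ n\<close> is
    a unit. This gives \<open>q ^ n \<ge> 2\<close>.\<close>
  then have "v (act H \<pi> $ 0) \<noteq> 0" "v (act H \<pi> $ 1) \<noteq> 0" using v_pi by simp_all
  then have "?Q \<noteq> 0" "?Q \<noteq> 1" using Q(2) by metis+
  then have "2 \<le> ?Q" by linarith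
  then show ?thesis by unfold_locales (use H Q in auto)
qed

theorem proposition2p11:
  fixes v :: "'k::{alg_closed_field, field_char_0} \<Rightarrow> ereal"
    and F :: "'k set" and \<pi> :: 'k and p n :: nat
    and H :: "'k formal_module" and \<epsilon> :: real
  assumes "padic_setting p v F \<pi>"
    and "formal_O_module v F H" and "O_height v F \<pi> H n"
    and "S_bound v \<pi> H \<epsilon>"
  shows "(\<forall>H' n' \<epsilon>' \<phi>.
            formal_O_module v F H' \<and> O_height v F \<pi> H' n' \<and> S_bound v \<pi> H' \<epsilon>' \<and>
            linear_iso F (V_p v \<pi> H) (V_p v \<pi> H') \<phi> \<and>
            vertex_image \<phi> ` S_vertices v F \<pi> H \<epsilon> = S_vertices v F \<pi> H' \<epsilon>' \<and>
            vertex_image \<phi> (Fil_vertex v F \<pi> H \<infinity>) = Fil_vertex v F \<pi> H' \<infinity> \<longrightarrow>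
            vertex_image \<phi> ` Fil_vertices v F \<pi> H = Fil_vertices v F \<pi> H')
       \<and> contained_in_enclosure v F \<pi> (V_p v \<pi> H) (Fil_vertices v F \<pi> H)
            (S_vertices v F \<pi> H \<epsilon> \<union> {Fil_vertex v F \<pi> H \<infinity>})
       \<and> Fil_vertices v F \<pi> H =
            (\<Union>x\<in>S_vertices v F \<pi> H \<epsilon>.
               vertex_join v F (V_p v \<pi> H) x (Fil_vertex v F \<pi> H \<infinity>))"
proof -
  interpret A: tate v F \<pi> H "residue_card v F ^ n" \<epsilon> by (rule padic_setting_tate[OF assms])
  have transport: "vertex_image \<phi> ` Fil_vertices v F \<pi> H = Fil_vertices v F \<pi> H'"
    if H': "formal_O_module v F H'" "O_height v F \<pi> H' n'" "S_bound v \<pi> H' \<epsilon>'"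
      and iso: "linear_iso F (V_p v \<pi> H) (V_p v \<pi> H') \<phi>"
      and S: "vertex_image \<phi> ` S_vertices v F \<pi> H \<epsilon> = S_vertices v F \<pi> H' \<epsilon>'"
      and T: "vertex_image \<phi> (Fil_vertex v F \<pi> H \<infinity>) = Fil_vertex v F \<pi> H' \<infinity>" for H' n' \<epsilon>' \<phi>
  proof -
    interpret B: tate v F \<pi> H' "residue_card v F ^ n'" \<epsilon>' by (rule padic_setting_tate[OF assms(1) H'])
    note VA = A.dv_vector_space_axioms and VB = B.dv_vector_space_axioms
    note tr = linear_iso_joins[OF VA VB iso A.Fil_closed A.Fil_closed]
    have T': "B.hc (\<phi> ` A.T) = B.hc B.T" using T tr(2) by (simp add: Fil_vertex_def)
    \<comment> \<open>Matching classes suffice: \<open>joins_cong\<close> replaces the images of the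
      lattices of \<open>H\<close> by the corresponding steps of the filtration of
      \<open>H'\<close>.\<close>
    have J: "vertex_image \<phi> ` A.joins (Fil v \<pi> H (ereal \<mu>)) A.T = B.joins (Fil v \<pi> H' (ereal \<nu>)) B.T"
      if "vertex_image \<phi> (A.hc (Fil v \<pi> H (ereal \<mu>))) = B.hc (Fil v \<pi> H' (ereal \<nu>))" for \<mu> \<nu>
      unfolding tr(1)
      using that tr(2) T' by (intro B.joins_cong tr(3) B.Fil_closed) simp_all
    show ?thesis
    proof (intro equalityI subsetI)
      fix Y assume "Y \<in> vertex_image \<phi> ` Fil_vertices v F \<pi> H"
      then obtain \<mu> where \<mu>: "0 < \<mu>" "\<mu> \<le> \<epsilon>" "Y \<in> vertex_image \<phi> ` A.joins (Fil v \<pi> H (ereal \<mu>)) A.T"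
        unfolding A.Fil_vertices_eq_joins by auto
      have "vertex_image \<phi> (A.hc (Fil v \<pi> H (ereal \<mu>))) \<in> S_vertices v F \<pi> H' \<epsilon>'"
        unfolding S[symmetric] A.S_vertices_eq using \<mu>(1,2) by blast
      then obtain \<nu> where \<nu>: "0 < \<nu>" "\<nu> \<le> \<epsilon>'"
        "vertex_image \<phi> (A.hc (Fil v \<pi> H (ereal \<mu>))) = B.hc (Fil v \<pi> H' (ereal \<nu>))"
        unfolding B.S_vertices_eq by blast
      then show "Y \<in> Fil_vertices v F \<pi> H'" using \<mu>(3) J[OF \<nu>(3)] unfolding B.Fil_vertices_eq_joins by auto
    next
      fix Y assume "Y \<in> Fil_vertices v F \<pi> H'"
      then obtain \<nu> where \<nu>: "0 < \<nu>" "\<nu> \<le> \<epsilon>'" "Y \<in> B.joins (Fil v \<pi> H' (ereal \<nu>)) B.T"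
        unfolding B.Fil_vertices_eq_joins by auto
      have "B.hc (Fil v \<pi> H' (ereal \<nu>)) \<in> vertex_image \<phi> ` S_vertices v F \<pi> H \<epsilon>"
        unfolding S B.S_vertices_eq using \<nu>(1,2) by blast
      then obtain \<mu> where \<mu>: "0 < \<mu>" "\<mu> \<le> \<epsilon>"
        "vertex_image \<phi> (A.hc (Fil v \<pi> H (ereal \<mu>))) = B.hc (Fil v \<pi> H' (ereal \<nu>))"
        unfolding A.S_vertices_eq by auto
      then have "Y \<in> vertex_image \<phi> ` A.joins (Fil v \<pi> H (ereal \<mu>)) A.T" using \<nu>(3) J[OF \<mu>(3)] by simp
      then show "Y \<in> vertex_image \<phi> ` Fil_vertices v F \<pi> H"
        unfolding A.Fil_vertices_eq_joins image_UN using \<mu>(1,2) by (intro UN_I) auto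
    qed
  qed
  show ?thesis
    by (rule conjI[OF _ conjI[OF A.Fil_vertices_enclosure A.Fil_vertices_eq]])
      (intro allI impI, elim conjE, rule transport)
qed

end
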